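(* Let $K\subset\mathbb{R}$ be compact, let $r,l\ge 0$ and $m\geq 1$ be integers, and let $n=r+2l\ge 1$. Let $\lambda_1,\dots,\lambda_r,\alpha_1,\dots,\alpha_l,\omega_1,\dots,\omega_l\in C(K,\mathbb{R})$ be such that each of the functions $\lambda_j$ ($1\le j\le r$) and $\alpha_j\pm i\omega_j$ ($1\le j\le l$) is finite-to-one. Put $$A(\beta)=\operatorname{diag}\{\lambda_1(\beta),\dots,\lambda_r(\beta),G_1(\beta),\dots,G_l(\beta)\}\in\mathbb{R}^{n\times n},\qquad G_j(\beta)=\begin{bmatrix}\alpha_j(\beta)&-\omega_j(\beta)\\ \omega_j(\beta)&\alpha_j(\beta)\end{bmatrix},$$ $$A^{\ast}(\beta)=\operatorname{diag}\{\lambda_1(\beta),\dots,\lambda_r(\beta),G_1^{\ast}(\beta),\dots,G_l^{\ast}(\beta)\},\qquad G_j^{\ast}(\beta)=\begin{bmatrix}\alpha_j(\beta)&\omega_j(\beta)\\ -\omega_j(\beta)&\alpha_j(\beta)\end{bmatrix},$$ and let $B=[b_1,\dots,b_m]\in C(K,\mathbb{R}^{n\times m})$ with columns $b_1,\dots,b_m\in C(K,\mathbb{R}^n)$. Consider the linear ensemble $$\frac{\mathrm{d}}{\mathrm{d}t}X(t,\beta)=A(\beta)X(t,\beta)+\sum_{j=1}^m b_j(\beta)u_j(t),\qquad \beta\in K,$$ with state $X(t,\cdot)\in C(K,\mathbb{R}^n)$ and piecewise constant controls $u=(u_1,\dots,u_m):[0,T]\to\mathbb{R}^m$. Suppose that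 $$\mathcal{L}=\mathrm{span}_{\mathbb{R}}\{A^kb_j: 1\le j\le m,\ k\in\mathbb{N}\}\subset C(K,\mathbb{R}^n)$$ is closed under left multiplication by $A^{\ast}$, i.e. $A^{\ast}(\cdot)f(\cdot)\in\mathcal{L}$ for every $f\in\mathcal{L}$. Then the ensemble is uniformly ensemble controllable on $C(K,\mathbb{R}^n)$ if and only if for every $\eta\in\mathcal{K}$ the finite-dimensional linear system $$\frac{\mathrm{d}}{\mathrm{d}t}Y(t,\eta)=\mathcal{D}_A(\gamma^{-1}(\eta))\,Y(t,\eta)+\mathcal{V}_B(\gamma^{-1}(\eta))\,u(t)$$ is controllable on $\mathbb{R}^{n\kappa(\eta)}$.
   Context: $\mathbb{N}=\{0,1,2,\dots\}$. $C(S,E)$ denotes the space of continuous $E$-valued functions on $S$. A function $\lambda$ on $K$ is finite-to-one if $\lambda^{-1}(\eta)$ is finite for every $\eta\in\lambda(K)$. Uniform ensemble controllability on $C(K,\mathbb{R}^n)$: for every $\epsilon>0$, every initial state $X_0\in C(K,\mathbb{R}^n)$ and every target $X_F\in C(K,\mathbb{R}^n)$, there exist a finite time $T>0$ and a piecewise constant control $u:[0,T]\to\mathbb{R}^m$ (the same $u$ for all $\beta\in K$) such that the solution with $X(0,\cdot)=X_0$ satisfies $\sup_{\beta\in K}\|X(T,\beta)-X_F(\beta)\|<\epsilon$, where $\|\cdot\|$ is any norm on $\mathbb{R}^n$. Set of eigenvalues: $\mathcal{K}=\bigcup_{j=1}^r\lambda_j(K)\cup\bigcup_{j=1}^l(\alpha_j+i\omega_j)(K)\cup\bigcup_{j=1}^l(\alpha_j-i\omega_j)(K)\subset\mathbb{C}$.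 For $\eta\in\mathcal{K}$, $\gamma^{-1}(\eta)=\bigcup_{j=1}^r\lambda_j^{-1}(\eta)\cup\bigcup_{j=1}^l(\alpha_j+i\omega_j)^{-1}(\eta)\cup\bigcup_{j=1}^l(\alpha_j-i\omega_j)^{-1}(\eta)\subset K$ (a union of preimages of $\eta$; a finite set), and $\kappa(\eta)$ is the cardinality of $\gamma^{-1}(\eta)$. For a matrix-valued function $M$ on $K$ and a finite set $S=\{\beta_1,\dots,\beta_p\}\subset K$ (distinct points), $\mathcal{D}_M(S)$ is the block-diagonal matrix with diagonal blocks $M(\beta_1),\dots,M(\beta_p)$, and $\mathcal{V}_M(S)$ is the matrix obtained by stacking $M(\beta_1),\dots,M(\beta_p)$ vertically. *)

theory Defs
  imports
    Complex_Main
    "HOL-Library.Extended_Real"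
    "Jordan_Normal_Form.Matrix"
begin

text \<open>
  The dimensions \<open>n = r + 2 l\<close> and \<open>n \<kappa>(\<eta>)\<close> occur as numbers, so vectors and matrices are those of
  \<open>Jordan_Normal_Form\<close>, with explicit carriers. All index families are 0-based, e.g.
  \<open>\<lambda>\<^sub>1, \<dots>, \<lambda>\<^sub>r\<close> is \<open>lam 0, \<dots>, lam (r - 1)\<close>.
\<close>


subsection \<open>Continuous vector and matrix functions\<close>

text \<open>
  A function on \<open>K\<close> is represented by a function on the whole real line whose values outside \<open>K\<close>
  are irrelevant. Continuity is entrywise, since the types of vectors and matrices carry no topology.
\<close>

definition cont_vec_fun :: "real set \<Rightarrow> nat \<Rightarrow> (real \<Rightarrow> real vec) \<Rightarrow> bool" where
  "cont_vec_fun K n f \<longleftrightarrow>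
     (\<forall>\<beta>\<in>K. f \<beta> \<in> carrier_vec n) \<and> (\<forall>i<n. continuous_on K (\<lambda>\<beta>. f \<beta> $ i))"

definition cont_mat_fun :: "real set \<Rightarrow> nat \<Rightarrow> nat \<Rightarrow> (real \<Rightarrow> real mat) \<Rightarrow> bool" where
  "cont_mat_fun K n m M \<longleftrightarrow>
     (\<forall>\<beta>\<in>K. M \<beta> \<in> carrier_mat n m) \<and>
     (\<forall>i<n. \<forall>j<m. continuous_on K (\<lambda>\<beta>. M \<beta> $$ (i, j)))"

definition finite_to_one_on :: "'a set \<Rightarrow> ('a \<Rightarrow> 'b) \<Rightarrow> bool" where
  "finite_to_one_on K f \<longleftrightarrow> (\<forall>\<eta>\<in>f ` K. finite {\<beta>\<in>K. f \<beta> = \<eta>})"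

definition norm_on :: "nat \<Rightarrow> (real vec \<Rightarrow> real) \<Rightarrow> bool" where
  "norm_on n N \<longleftrightarrow>
     (\<forall>v\<in>carrier_vec n. 0 \<le> N v \<and> (N v = 0 \<longleftrightarrow> v = 0\<^sub>v n)) \<and>
     (\<forall>c. \<forall>v\<in>carrier_vec n. N (c \<cdot>\<^sub>v v) = \<bar>c\<bar> * N v) \<and>
     (\<forall>v\<in>carrier_vec n. \<forall>w\<in>carrier_vec n. N (v + w) \<le> N v + N w)"


subsection \<open>Linear control systems with piecewise constant controls\<close>

text \<open>
  \<open>u\<close> is constant on each component of \<open>{0..T} - P\<close>; its values at the switching times \<open>P\<close> are
  arbitrary.
\<close>

definition pw_const_control :: "nat \<Rightarrow> real \<Rightarrow> (real \<Rightarrow> real vec) \<Rightarrow> bool" where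
  "pw_const_control m T u \<longleftrightarrow>
     (\<forall>t\<in>{0..T}. u t \<in> carrier_vec m) \<and>
     (\<exists>P. finite P \<and> (\<forall>s t. 0 \<le> s \<and> s \<le> t \<and> t \<le> T \<and> {s..t} \<inter> P = {} \<longrightarrow> u s = u t))"

text \<open>
  \<open>x' = A x + B u\<close> on \<open>{0..T}\<close> with state dimension \<open>d\<close>. At a jump of \<open>u\<close> the solution is only
  continuous, hence the exceptional set \<open>P\<close>.
\<close>

definition lin_solution ::
  "nat \<Rightarrow> real mat \<Rightarrow> real mat \<Rightarrow> real \<Rightarrow> (real \<Rightarrow> real vec) \<Rightarrow> (real \<Rightarrow> real vec) \<Rightarrow> bool" where
  "lin_solution d A B T u x \<longleftrightarrow>
     (\<forall>t\<in>{0..T}. x t \<in> carrier_vec d) \<and>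
     (\<forall>i<d. continuous_on {0..T} (\<lambda>t. x t $ i)) \<and>
     (\<exists>P. finite P \<and> (\<forall>t\<in>{0..T} - P. \<forall>i<d.
        ((\<lambda>s. x s $ i) has_real_derivative (A *\<^sub>v x t + B *\<^sub>v u t) $ i) (at t within {0..T})))"

definition controllable :: "nat \<Rightarrow> nat \<Rightarrow> real mat \<Rightarrow> real mat \<Rightarrow> bool" where
  "controllable d m A B \<longleftrightarrow>
     (\<forall>x0\<in>carrier_vec d. \<forall>xF\<in>carrier_vec d.
        \<exists>T>0. \<exists>u x. pw_const_control m T u \<and> lin_solution d A B T u x \<and> x 0 = x0 \<and> x T = xF)"

text \<open>
  The supremum is taken in the extended reals, where the supremum over the empty set is \<open>-\<infinity>\<close>; so
  no separate convention is needed for \<open>K = {}\<close>.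
\<close>

definition unif_ensemble_controllable ::
  "(real vec \<Rightarrow> real) \<Rightarrow> real set \<Rightarrow> nat \<Rightarrow> nat \<Rightarrow> (real \<Rightarrow> real mat) \<Rightarrow> (real \<Rightarrow> real mat) \<Rightarrow> bool" where
  "unif_ensemble_controllable N K n m A B \<longleftrightarrow>
     (\<forall>\<epsilon>>0. \<forall>X0 XF. cont_vec_fun K n X0 \<and> cont_vec_fun K n XF \<longrightarrow>
        (\<exists>T>0. \<exists>u X. pw_const_control m T u \<and>
           (\<forall>t\<in>{0..T}. cont_vec_fun K n (X t)) \<and>
           (\<forall>\<beta>\<in>K. lin_solution n (A \<beta>) (B \<beta>) T u (\<lambda>t. X t \<beta>)) \<and>
           (\<forall>\<beta>\<in>K. X 0 \<beta> = X0 \<beta>) \<and>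
           (SUP \<beta>\<in>K. ereal (N (X T \<beta> - XF \<beta>))) < ereal \<epsilon>))"


subsection \<open>The system matrices\<close>

definition A_mat ::
  "nat \<Rightarrow> nat \<Rightarrow> (nat \<Rightarrow> real \<Rightarrow> real) \<Rightarrow> (nat \<Rightarrow> real \<Rightarrow> real) \<Rightarrow> (nat \<Rightarrow> real \<Rightarrow> real) \<Rightarrow> real \<Rightarrow> real mat" where
  "A_mat r l lam alpha omega \<beta> = diag_block_mat
     (map (\<lambda>j. mat_of_rows_list 1 [[lam j \<beta>]]) [0..<r] @
      map (\<lambda>j. mat_of_rows_list 2 [[alpha j \<beta>, - omega j \<beta>], [omega j \<beta>, alpha j \<beta>]]) [0..<l])"

definition A_star ::
  "nat \<Rightarrow> nat \<Rightarrow> (nat \<Rightarrow> real \<Rightarrow> real) \<Rightarrow> (nat \<Rightarrow> real \<Rightarrow> real) \<Rightarrow> (nat \<Rightarrow> real \<Rightarrow> real) \<Rightarrow> real \<Rightarrow> real mat" where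
  "A_star r l lam alpha omega \<beta> = diag_block_mat
     (map (\<lambda>j. mat_of_rows_list 1 [[lam j \<beta>]]) [0..<r] @
      map (\<lambda>j. mat_of_rows_list 2 [[alpha j \<beta>, omega j \<beta>], [- omega j \<beta>, alpha j \<beta>]]) [0..<l])"

text \<open>
  The real span of the functions \<open>A\<^sup>k b\<^sub>j\<close>: finite linear combinations over sets \<open>S\<close> of index pairs
  \<open>(j, k)\<close>, with equality of functions understood on \<open>K\<close>.
\<close>

definition krylov_span :: "real set \<Rightarrow> nat \<Rightarrow> nat \<Rightarrow> (real \<Rightarrow> real mat) \<Rightarrow> (real \<Rightarrow> real mat) \<Rightarrow> (real \<Rightarrow> real vec) set" where
  "krylov_span K n m A B =
     {f. \<exists>S c. finite S \<and> S \<subseteq> {..<m} \<times> UNIV \<and>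
        (\<forall>\<beta>\<in>K. f \<beta> = vec n (\<lambda>i. \<Sum>(j, k)\<in>S. c j k * ((A \<beta> ^\<^sub>m k *\<^sub>v col (B \<beta>) j) $ i)))}"

definition eig_plus :: "(nat \<Rightarrow> real \<Rightarrow> real) \<Rightarrow> (nat \<Rightarrow> real \<Rightarrow> real) \<Rightarrow> nat \<Rightarrow> real \<Rightarrow> complex" where
  "eig_plus alpha omega j \<beta> = of_real (alpha j \<beta>) + \<i> * of_real (omega j \<beta>)"

definition eig_minus :: "(nat \<Rightarrow> real \<Rightarrow> real) \<Rightarrow> (nat \<Rightarrow> real \<Rightarrow> real) \<Rightarrow> nat \<Rightarrow> real \<Rightarrow> complex" where
  "eig_minus alpha omega j \<beta> = of_real (alpha j \<beta>) - \<i> * of_real (omega j \<beta>)"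

definition eig_set ::
  "real set \<Rightarrow> nat \<Rightarrow> nat \<Rightarrow> (nat \<Rightarrow> real \<Rightarrow> real) \<Rightarrow> (nat \<Rightarrow> real \<Rightarrow> real) \<Rightarrow> (nat \<Rightarrow> real \<Rightarrow> real) \<Rightarrow> complex set" where
  "eig_set K r l lam alpha omega =
     (\<Union>j<r. (\<lambda>\<beta>. complex_of_real (lam j \<beta>)) ` K) \<union>
     (\<Union>j<l. eig_plus alpha omega j ` K) \<union>
     (\<Union>j<l. eig_minus alpha omega j ` K)"

definition gamma_inv ::
  "real set \<Rightarrow> nat \<Rightarrow> nat \<Rightarrow> (nat \<Rightarrow> real \<Rightarrow> real) \<Rightarrow> (nat \<Rightarrow> real \<Rightarrow> real) \<Rightarrow> (nat \<Rightarrow> real \<Rightarrow> real) \<Rightarrow>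
   complex \<Rightarrow> real set" where
  "gamma_inv K r l lam alpha omega \<eta> =
     (\<Union>j<r. {\<beta>\<in>K. complex_of_real (lam j \<beta>) = \<eta>}) \<union>
     (\<Union>j<l. {\<beta>\<in>K. eig_plus alpha omega j \<beta> = \<eta>}) \<union>
     (\<Union>j<l. {\<beta>\<in>K. eig_minus alpha omega j \<beta> = \<eta>})"

text \<open>
  For finite \<open>S\<close> the points \<open>\<beta>\<^sub>1, \<dots>, \<beta>\<^sub>p\<close> are listed in increasing order, in both definitions. The
  number \<open>m\<close> of columns in \<open>stack_mat\<close> is needed only for the empty matrix terminating the fold.
\<close>

definition diag_mat_at :: "(real \<Rightarrow> real mat) \<Rightarrow> real set \<Rightarrow> real mat" where
  "diag_mat_at M S = diag_block_mat (map M (sorted_list_of_set S))"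

definition stack_mat :: "nat \<Rightarrow> (real \<Rightarrow> real mat) \<Rightarrow> real set \<Rightarrow> real mat" where
  "stack_mat m M S = foldr (\<lambda>\<beta> C. M \<beta> @\<^sub>r C) (sorted_list_of_set S) (0\<^sub>m 0 m)"

end

theory Submission
  imports Defs "HOL-Analysis.Weierstrass_Theorems" "HOL-Analysis.Continuous_Extension"
    "HOL-Analysis.Complex_Transcendental" "HOL-Analysis.Henstock_Kurzweil_Integration"
begin

text \<open>
  In the complex coordinates \<open>x\<^sub>j\<close> (\<open>j < r\<close>) and \<open>x + \<i> y\<close> (one for each block \<open>G\<^sub>j\<close>) the matrix \<open>A\<close>
  acts by multiplication with \<open>\<lambda>\<^sub>j\<close> and \<open>\<alpha>\<^sub>j + \<i> \<omega>\<^sub>j\<close>, and \<open>A\<^sup>*\<close> by the conjugates. So the ensemble is a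
  family of scalar equations \<open>x' = \<mu>(p) x + \<Sum>\<^sub>i b\<^sub>i(p) u\<^sub>i\<close> over the compact set of pairs \<open>p = (\<beta>, j)\<close>, and
  \<open>\<L>\<close> is a module over the real polynomials in \<open>Re \<mu>\<close> and \<open>(Im \<mu>)\<^sup>2\<close>.

  If all the systems over the fibres are controllable, every target agrees with some element of \<open>\<L>\<close>
  on each fibre of \<open>{\<mu>, cnj \<mu>}\<close>, hence is close to it near that fibre. Gluing with a partition of
  unity, whose members are approximated by polynomials (Stone-Weierstrass), shows that \<open>\<L>\<close> is dense.
  The states reachable from \<open>0\<close> contain \<open>b\<^sub>i \<integral>\<^sub>0\<^sup>t e\<^sup>s\<^sup>\<mu> ds\<close> for all \<open>t \<le> 1\<close>, and the Taylor
  coefficients at \<open>t = 0\<close> of this function are multiples of \<open>\<mu>\<^sup>k b\<^sub>i\<close>; so the reachable states are dense too.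

  Conversely, a functional supported on a finite set of points that annihilates \<open>\<L>\<close> vanishes on every
  state reachable from \<open>0\<close>, so approximate controllability forces \<open>\<L>\<close> to take all values there.
\<close>

text \<open>Controls and coefficients are real, so \<L> stays a real subspace even in complex
  coordinates, and duality has to use real parts of complex pairings. The real functions Re \<mu>
  and (Im \<mu>)^2 cannot tell \<mu> from its conjugate; this dictates the fibres, and the branches
  \<alpha> - \<i> \<omega> in \<open>gamma_inv\<close> guarantee that it contains every point of
  such a fibre. Since all functions are finite-to-one, these point sets are finite, and there the
  values of \<L> form a finite-dimensional, hence closed, subspace: approximate and exact
  interpolation coincide. Both directions therefore pass through the values of \<L> on finite sets,
  which do not depend on time. The horizons supplied by a hypothesis are forgotten at this point,
  and every control that is constructed lives on [0,1]. Initial states enter only through the free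
  motion, which is subtracted from the target beforehand.\<close>

unbundle no vec_syntax
hide_type (open) Finite_Cartesian_Product.vec
hide_const (open) Finite_Cartesian_Product.vec

subsection \<open>Real spans of complex functions\<close>

text \<open>Coefficients are real because the inputs are. Elements are functions on the whole type,
  so each statement about them names the set on which values are compared; the inductive form allows
  rule induction instead of handling index sets.\<close>

inductive_set real_span :: "('a \<Rightarrow> complex) set \<Rightarrow> ('a \<Rightarrow> complex) set" for G where
  real_span_zero: "(\<lambda>_. 0) \<in> real_span G"
| real_span_step: "f \<in> real_span G \<Longrightarrow> g \<in> G \<Longrightarrow> (\<lambda>x. f x + complex_of_real c * g x) \<in> real_span G"

lemma real_span_base: "g \<in> G \<Longrightarrow> g \<in> real_span G"
  using real_span_step[OF real_span_zero, of g G 1] by simp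

lemma real_span_add:
  assumes "g \<in> real_span G" "f \<in> real_span G"
  shows "(\<lambda>x. f x + g x) \<in> real_span G"
  using assms(1)
proof induction
  case real_span_zero
  then show ?case using assms(2) by simp
next
  case (real_span_step g h c)
  then show ?case using real_span.real_span_step[OF real_span_step(3,2), of c] by (simp add: add.assoc)
qed

lemma real_span_scale:
  assumes "f \<in> real_span G"
  shows "(\<lambda>x. complex_of_real c * f x) \<in> real_span G"
  using assms
proof induction
  case real_span_zero
  then show ?case using real_span.real_span_zero by simp
next
  case (real_span_step g h d)
  then show ?case using real_span.real_span_step[OF real_span_step(3,2), of "c * d"]
    by (simp add: algebra_simps)
qed

lemma real_span_diff:
  assumes "f \<in> real_span G" "g \<in> real_span G"
  shows "(\<lambda>x. f x - g x) \<in> real_span G"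
  using real_span_add[OF real_span_scale[OF assms(2), of "-1"] assms(1)] by simp

lemma real_span_sum:
  assumes "finite I" "\<And>i. i \<in> I \<Longrightarrow> f i \<in> real_span G"
  shows "(\<lambda>x. \<Sum>i\<in>I. complex_of_real (c i) * f i x) \<in> real_span G"
  using assms
proof (induction I)
  case empty
  then show ?case by (simp add: real_span_zero)
next
  case (insert i I)
  then show ?case using real_span_add[OF _ real_span_scale[of "f i" G "c i"]] by simp
qed

text \<open>Multiplication by \<open>p\<close> is linear, so it suffices to realise it on
  generators. Agreement is asked on \<open>X\<close> only, because membership in \<L> is itself an
  equality on \<open>K\<close>.\<close>

lemma real_span_map:
  assumes "f \<in> real_span G"
    and "\<And>g. g \<in> G \<Longrightarrow> \<exists>h\<in>real_span H. \<forall>x\<in>X. h x = p x * g x"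
  shows "\<exists>h\<in>real_span H. \<forall>x\<in>X. h x = p x * f x"
  using assms(1)
proof induction
  case real_span_zero
  then show ?case using real_span.real_span_zero[of H] by (intro bexI[of _ "\<lambda>_. 0"]) auto
next
  case (real_span_step f g c)
  obtain h1 where h1: "h1 \<in> real_span H" "\<forall>x\<in>X. h1 x = p x * f x" using real_span_step by blast
  obtain h2 where h2: "h2 \<in> real_span H" "\<forall>x\<in>X. h2 x = p x * g x" using assms(2) real_span_step by blast
  show ?case
    by (rule bexI[of _ "\<lambda>x. h1 x + complex_of_real c * h2 x"])
       (use h1 h2 real_span_add[OF real_span_scale[OF h2(1)] h1(1)] in \<open>auto simp: algebra_simps\<close>)
qed

text \<open>Gaussian elimination, one point at a time: either some member of \<open>W\<close> is
  nonzero at the new point and serves as pivot, or evaluation at that point annihilates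
  \<open>W\<close>. Being nonempty and closed under \<open>f + c * g\<close>, \<open>W\<close> is a
  linear subspace, so this is Hahn-Banach separation in finite dimension.\<close>

lemma finite_separation_real:
  fixes W :: "('a \<Rightarrow> real) set"
  assumes "finite J"
    and "\<And>f g c. f \<in> W \<Longrightarrow> g \<in> W \<Longrightarrow> (\<lambda>x. f x + c * g x) \<in> W"
    and "W \<noteq> {}"
  shows "(\<exists>f\<in>W. \<forall>x\<in>J. f x = v x) \<or> (\<exists>w. (\<forall>f\<in>W. (\<Sum>x\<in>J. w x * f x) = 0) \<and> (\<Sum>x\<in>J. w x * v x) \<noteq> 0)"
  using assms
proof (induction J arbitrary: W v)
  case empty
  then show ?case by auto
next
  case (insert a J)
  show ?case
  proof (cases "\<exists>e\<in>W. e a \<noteq> 0")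
    case True
    then obtain e where e: "e \<in> W" "e a \<noteq> 0" by auto
    \<comment> \<open>Subtracting a multiple of the pivot \<open>e\<close> kills the value at
      \<open>a\<close> without leaving \<open>W\<close>.\<close>
    define proj where "proj f = (\<lambda>x. f x + (- f a / e a) * e x)" for f
    have proj_a: "proj f a = 0" for f using e by (simp add: proj_def)
    have projW: "proj f \<in> W" if "f \<in> W" for f
      unfolding proj_def using insert.prems(1)[OF that e(1)] .
    define W0 where "W0 = {f\<in>W. f a = 0}"
    have "W0 \<noteq> {}" using projW[OF e(1)] proj_a by (auto simp: W0_def)
    moreover have "(\<lambda>x. f x + c * g x) \<in> W0" if "f \<in> W0" "g \<in> W0" for f g c
      using that insert.prems(1) by (auto simp: W0_def)
    ultimately consider (1) f where "f \<in> W0" "\<forall>x\<in>J. f x = proj v x"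
      | (2) w where "\<forall>f\<in>W0. (\<Sum>x\<in>J. w x * f x) = 0" "(\<Sum>x\<in>J. w x * proj v x) \<noteq> 0"
      using insert.IH[of W0 "proj v"] by blast
    then show ?thesis
    proof cases
      case 1
      have "\<forall>x\<in>insert a J. f x + (v a / e a) * e x = v x"
        using 1 e by (auto simp: proj_def W0_def)
      moreover have "(\<lambda>x. f x + (v a / e a) * e x) \<in> W"
        using insert.prems(1)[OF _ e(1), of f "v a / e a"] 1 by (simp add: W0_def)
      ultimately show ?thesis by (intro disjI1 bexI)
    next
      case 2
      \<comment> \<open>The weight at \<open>a\<close> makes \<open>w'\<close> annihilate the pivot
        \<open>e\<close>; hence pairing \<open>f\<close> with \<open>w'\<close> is the same as
        pairing \<open>proj f\<close> with \<open>w\<close>.\<close>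
      define w' where "w' = w(a := - (\<Sum>x\<in>J. w x * e x) / e a)"
      have eq: "(\<Sum>x\<in>insert a J. w' x * f x) = (\<Sum>x\<in>J. w x * proj f x)" for f
      proof -
        have "(\<Sum>x\<in>J. w' x * f x) = (\<Sum>x\<in>J. w x * f x)"
          using insert.hyps by (intro sum.cong) (auto simp: w'_def)
        moreover have "(\<Sum>x\<in>J. w x * proj f x) = (\<Sum>x\<in>J. w x * f x) + (- f a / e a) * (\<Sum>x\<in>J. w x * e x)"
          unfolding proj_def sum_distrib_left sum.distrib[symmetric]
          by (intro sum.cong) (auto simp: algebra_simps)
        ultimately show ?thesis using insert.hyps by (simp add: w'_def)
      qed
      have "proj f \<in> W0" if "f \<in> W" for f using projW[OF that] proj_a by (auto simp: W0_def)
      then have "\<forall>f\<in>W. (\<Sum>x\<in>insert a J. w' x * f x) = 0" using 2(1) eq by metis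
      moreover have "(\<Sum>x\<in>insert a J. w' x * v x) \<noteq> 0" using 2(2) unfolding eq .
      ultimately show ?thesis by (intro disjI2 exI conjI)
    qed
  next
    case False
    show ?thesis
    proof (cases "v a = 0")
      case True
      consider (1) f where "f \<in> W" "\<forall>x\<in>J. f x = v x"
        | (2) w where "\<forall>f\<in>W. (\<Sum>x\<in>J. w x * f x) = 0" "(\<Sum>x\<in>J. w x * v x) \<noteq> 0"
        using insert.IH[OF insert.prems, of v] by blast
      then show ?thesis
      proof cases
        case 1
        then show ?thesis using True False by auto
      next
        case 2
        then show ?thesis using True False insert.hyps
          by (intro disjI2 exI[of _ w]) auto
      qed
    next
      case False2: False
      \<comment> \<open>All of \<open>W\<close> vanishes at \<open>a\<close> while \<open>v\<close>
        does not: evaluation at \<open>a\<close> is the separating functional.\<close>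
      have "(\<Sum>x\<in>insert a J. of_bool (x = a) * f x) = f a" for f :: "'a \<Rightarrow> real"
        using insert.hyps by (simp add: sum.neutral)
      then show ?thesis using False False2
        by (intro disjI2 exI[of _ "\<lambda>x. of_bool (x = a)"]) auto
    qed
  qed
qed

text \<open>Splitting values into real and imaginary parts doubles the index set; the real weights
  \<open>p\<close>, \<open>q\<close> at a point recombine to the complex weight p - \<i> q, since Re
  ((p - \<i> q) z) = p Re z + q Im z. The real part cannot be dropped: it is what separates \<i>
  from the real multiples of 1.\<close>

lemma finite_separation:
  fixes G :: "('a \<Rightarrow> complex) set"
  assumes "finite J" and "\<not> (\<exists>f\<in>real_span G. \<forall>x\<in>J. f x = v x)"
  obtains w where "\<And>f. f \<in> real_span G \<Longrightarrow> Re (\<Sum>x\<in>J. w x * f x) = 0"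
    and "Re (\<Sum>x\<in>J. w x * v x) \<noteq> 0"
proof -
  define flat where "flat f = (\<lambda>(x, c). if c then Re (f x) else Im (f x))" for f :: "'a \<Rightarrow> complex"
  have lin: "(\<lambda>x. f x + c * g x) \<in> flat ` real_span G"
    if f: "f \<in> flat ` real_span G" and g: "g \<in> flat ` real_span G" for f g c
  proof -
    obtain f' g' where fg: "f' \<in> real_span G" "g' \<in> real_span G" "f = flat f'" "g = flat g'"
      using f g by (elim imageE) blast
    have "(\<lambda>x. f x + c * g x) = flat (\<lambda>x. f' x + complex_of_real c * g' x)"
      by (auto simp: fg flat_def)
    then show ?thesis using real_span_add[OF real_span_scale[OF fg(2)] fg(1)] by blast
  qed
  have not_W: "\<not> (\<exists>f\<in>flat ` real_span G. \<forall>x\<in>J \<times> UNIV. f x = flat v x)"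
    using assms(2) by (auto simp: flat_def complex_eq_iff UNIV_bool)
  have fin: "finite (J \<times> (UNIV :: bool set))" and ne: "flat ` real_span G \<noteq> {}"
    using assms(1) real_span_zero[of G] by auto
  have "\<exists>w. (\<forall>f\<in>flat ` real_span G. (\<Sum>x\<in>J \<times> UNIV. w x * f x) = 0)
      \<and> (\<Sum>x\<in>J \<times> UNIV. w x * flat v x) \<noteq> 0"
    using finite_separation_real[OF fin lin ne, of "flat v"]
    by (rule disjE) (simp_all only: not_W simp_thms)
  then obtain w where w: "\<forall>f\<in>flat ` real_span G. (\<Sum>x\<in>J \<times> UNIV. w x * f x) = 0"
      "(\<Sum>x\<in>J \<times> UNIV. w x * flat v x) \<noteq> 0"
    by (elim exE conjE)
  have eq: "(\<Sum>x\<in>J \<times> UNIV. w x * flat f x) = Re (\<Sum>x\<in>J. Complex (w (x, True)) (- w (x, False)) * f x)" for f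
  proof -
    have "(\<Sum>x\<in>J \<times> UNIV. w x * flat f x) = (\<Sum>x\<in>J. \<Sum>c\<in>UNIV. w (x, c) * flat f (x, c))"
      unfolding sum.cartesian_product by (simp add: case_prod_unfold)
    also have "\<dots> = Re (\<Sum>x\<in>J. Complex (w (x, True)) (- w (x, False)) * f x)"
      unfolding Re_sum by (intro sum.cong refl) (simp add: UNIV_bool flat_def)
    finally show ?thesis .
  qed
  show ?thesis
  proof (rule that[of "\<lambda>x. Complex (w (x, True)) (- w (x, False))"])
    show "Re (\<Sum>x\<in>J. Complex (w (x, True)) (- w (x, False)) * f x) = 0" if "f \<in> real_span G" for f
      using bspec[OF w(1) imageI[OF that]] unfolding eq .
    show "Re (\<Sum>x\<in>J. Complex (w (x, True)) (- w (x, False)) * v x) \<noteq> 0"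
      using w(2) unfolding eq .
  qed
qed

subsection \<open>Density from fibrewise interpolation\<close>

text \<open>Polynomial functions are generated by constants and bounded linear functionals; on the
  complex plane every such functional is a real combination of \<open>Re\<close> and
  \<open>Im\<close>, so two base cases replace all of them.\<close>

lemma real_polynomial_complex_induct [consumes 1, case_names Re Im const add mult]:
  fixes p :: "complex \<Rightarrow> real"
  assumes "real_polynomial_function p"
    and "P Re" "P Im" "\<And>c. P (\<lambda>_. c)"
    and "\<And>f g. P f \<Longrightarrow> P g \<Longrightarrow> P (\<lambda>x. f x + g x)"
    and "\<And>f g. P f \<Longrightarrow> P g \<Longrightarrow> P (\<lambda>x. f x * g x)"
  shows "P p"
  using assms(1)
proof induction
  case (linear f)
  interpret bounded_linear f by fact
  have "f z = Re z * f 1 + Im z * f \<i>" for z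
  proof -
    have "f z = f (Re z *\<^sub>R 1 + Im z *\<^sub>R \<i>)" by (rule arg_cong[of _ _ f]) (simp add: complex_eq_iff)
    then show ?thesis by (simp add: add scaleR)
  qed
  then have "f = (\<lambda>z. Re z * f 1 + Im z * f \<i>)" by blast
  moreover have "P (\<lambda>z. Re z * f 1 + Im z * f \<i>)"
    by (intro assms(2-6))
  ultimately show ?case by simp
qed (use assms(4-6) in blast)+

text \<open>A Stone-Weierstrass theorem for modules in the style of Nachbin: approximation by a
  module over an algebra of real functions is a local question on the fibres of that algebra. The
  hypotheses \<open>mu_inv\<close> and \<open>cnj_inv\<close> provide the module structure,
  \<open>fiber\<close> the solution on each fibre.\<close>

lemma dense_of_fiberwise:
  fixes \<mu> F :: "'a::topological_space \<Rightarrow> complex"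
  assumes cpt: "compact \<Omega>"
    and cont_mu: "continuous_on \<Omega> \<mu>" and cont_G: "\<And>g. g \<in> G \<Longrightarrow> continuous_on \<Omega> g"
    and cont_F: "continuous_on \<Omega> F"
    and mu_inv: "\<And>g. g \<in> G \<Longrightarrow> \<exists>h\<in>real_span G. \<forall>x\<in>\<Omega>. h x = \<mu> x * g x"
    and cnj_inv: "\<And>g. g \<in> G \<Longrightarrow> \<exists>h\<in>real_span G. \<forall>x\<in>\<Omega>. h x = cnj (\<mu> x) * g x"
    and fiber: "\<And>y. y \<in> \<Omega> \<Longrightarrow>
      \<exists>h\<in>real_span G. \<forall>x\<in>\<Omega>. \<mu> x = \<mu> y \<or> \<mu> x = cnj (\<mu> y) \<longrightarrow> h x = F x"
    and "0 < \<epsilon>"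
  shows "\<exists>h\<in>real_span G. \<forall>x\<in>\<Omega>. cmod (h x - F x) < \<epsilon>"
proof -
  \<comment> \<open>\<open>\<rho>\<close> has the fibres \<open>{\<mu>, cnj \<mu>}\<close>, and multiplication by \<open>Re \<rho>\<close> and \<open>Im \<rho>\<close> preserves the real span,
    because \<open>(Im \<mu>)\<^sup>2 = - ((\<mu> - cnj \<mu>) / 2)\<^sup>2\<close>; multiplication by \<open>Im \<mu>\<close> alone need not.\<close>
  define \<rho> where "\<rho> x = Complex (Re (\<mu> x)) ((Im (\<mu> x))\<^sup>2)" for x
  define Z where "Z = \<rho> ` \<Omega>"
  have cont_rho: "continuous_on \<Omega> \<rho>"
    unfolding \<rho>_def by (intro continuous_intros cont_mu)
  have cpt_Z: "compact Z" unfolding Z_def by (rule compact_continuous_image[OF cont_rho cpt])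
  have cont_span: "continuous_on \<Omega> h" if "h \<in> real_span G" for h
    using that
  proof induction
    case real_span_zero
    then show ?case by (rule continuous_on_const)
  next
    case (real_span_step f g c)
    then show ?case by (intro continuous_on_add continuous_on_mult continuous_on_const cont_G[of g])
  qed
  have module: "\<exists>h\<in>real_span G. \<forall>x\<in>\<Omega>. h x = complex_of_real (p (\<rho> x)) * f x"
    if "real_polynomial_function p" "f \<in> real_span G" for p f
    using that
  proof (induction arbitrary: f rule: real_polynomial_complex_induct)
    case Re
    obtain h where h: "h \<in> real_span G" "\<forall>x\<in>\<Omega>. h x = \<mu> x * f x"
      using real_span_map[OF Re mu_inv] by blast
    obtain k where k: "k \<in> real_span G" "\<forall>x\<in>\<Omega>. k x = cnj (\<mu> x) * f x"
      using real_span_map[OF Re cnj_inv] by blast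
    have "(\<lambda>x. complex_of_real (1/2) * (h x + k x)) \<in> real_span G"
      by (intro real_span_scale real_span_add h k)
    moreover have "\<forall>x\<in>\<Omega>. complex_of_real (1/2) * (h x + k x) = complex_of_real (Re (\<rho> x)) * f x"
      using h(2) k(2) by (auto simp: \<rho>_def complex_eq_iff)
    ultimately show ?case by (intro bexI)
  next
    case Im
    have step: "\<exists>h\<in>real_span G. \<forall>x\<in>\<Omega>. h x = \<i> * complex_of_real (Im (\<mu> x)) * f x"
      if f: "f \<in> real_span G" for f
    proof -
      obtain h where h: "h \<in> real_span G" "\<forall>x\<in>\<Omega>. h x = \<mu> x * f x"
        using real_span_map[OF f mu_inv] by blast
      obtain k where k: "k \<in> real_span G" "\<forall>x\<in>\<Omega>. k x = cnj (\<mu> x) * f x"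
        using real_span_map[OF f cnj_inv] by blast
      have "(\<lambda>x. complex_of_real (1/2) * (h x - k x)) \<in> real_span G"
        by (intro real_span_scale real_span_diff h k)
      moreover have "\<forall>x\<in>\<Omega>. complex_of_real (1/2) * (h x - k x) = \<i> * complex_of_real (Im (\<mu> x)) * f x"
        using h(2) k(2) by (auto simp: complex_eq_iff)
      ultimately show ?thesis by (intro bexI)
    qed
    obtain h where h: "h \<in> real_span G" "\<forall>x\<in>\<Omega>. h x = \<i> * complex_of_real (Im (\<mu> x)) * f x"
      using step[OF Im] by blast
    obtain k where k: "k \<in> real_span G" "\<forall>x\<in>\<Omega>. k x = \<i> * complex_of_real (Im (\<mu> x)) * h x"
      using step[OF h(1)] by blast
    have "(\<lambda>x. complex_of_real (-1) * k x) \<in> real_span G"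
      by (intro real_span_scale k)
    moreover have "\<forall>x\<in>\<Omega>. complex_of_real (-1) * k x = complex_of_real (Im (\<rho> x)) * f x"
      using h(2) k(2) by (auto simp: \<rho>_def complex_eq_iff power2_eq_square)
    ultimately show ?case by (intro bexI)
  next
    case (const c)
    show ?case by (intro bexI[OF _ real_span_scale[OF const, of c]]) simp
  next
    case (add p q)
    obtain h where h: "h \<in> real_span G" "\<forall>x\<in>\<Omega>. h x = complex_of_real (p (\<rho> x)) * f x"
      using add by blast
    obtain k where k: "k \<in> real_span G" "\<forall>x\<in>\<Omega>. k x = complex_of_real (q (\<rho> x)) * f x"
      using add by blast
    show ?case using h k real_span_add[OF k(1) h(1)]
      by (intro bexI[of _ "\<lambda>x. h x + k x"]) (auto simp: algebra_simps)
  next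
    case (mult p q)
    obtain h where h: "h \<in> real_span G" "\<forall>x\<in>\<Omega>. h x = complex_of_real (q (\<rho> x)) * f x"
      using mult by blast
    obtain k where k: "k \<in> real_span G" "\<forall>x\<in>\<Omega>. k x = complex_of_real (p (\<rho> x)) * h x"
      using mult(1)[OF h(1)] by blast
    have "\<forall>x\<in>\<Omega>. k x = complex_of_real (p (\<rho> x) * q (\<rho> x)) * f x"
      using h(2) k(2) by simp
    then show ?case using k(1) by (intro bexI)
  qed
  have local: "\<exists>h U. h \<in> real_span G \<and> open U \<and> z \<in> U \<and> (\<forall>x\<in>\<Omega>. \<rho> x \<in> U \<longrightarrow> cmod (h x - F x) < \<epsilon> / 2)"
    if "z \<in> Z" for z
  proof -
    obtain y where y: "y \<in> \<Omega>" "z = \<rho> y" using \<open>z \<in> Z\<close> by (auto simp: Z_def)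
    obtain h where h: "h \<in> real_span G" "\<forall>x\<in>\<Omega>. \<mu> x = \<mu> y \<or> \<mu> x = cnj (\<mu> y) \<longrightarrow> h x = F x"
      using fiber[OF y(1)] by blast
    \<comment> \<open>A tube argument: the points where \<open>h\<close> is too far from
      \<open>F\<close> form a compact set, so their image under \<rho> is closed. It misses
      \<open>z\<close>, since \<open>h\<close> equals \<open>F\<close> on the whole fibre over
      \<open>z\<close>, and its complement is the required neighbourhood.\<close>
    define C where "C = {x\<in>\<Omega>. \<epsilon> / 2 \<le> cmod (h x - F x)}"
    have "continuous_on \<Omega> (\<lambda>x. cmod (h x - F x))"
      by (intro continuous_intros cont_span h(1) cont_F)
    then have "closedin (top_of_set \<Omega>) (\<Omega> \<inter> (\<lambda>x. cmod (h x - F x)) -` {\<epsilon> / 2..})"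
      by (rule continuous_closedin_preimage) simp
    moreover have "\<Omega> \<inter> (\<lambda>x. cmod (h x - F x)) -` {\<epsilon> / 2..} = C" by (auto simp: C_def)
    ultimately have "compact C" using closedin_compact[OF cpt] by metis
    then have "compact (\<rho> ` C)"
      using cont_rho by (intro compact_continuous_image) (auto simp: C_def intro: continuous_on_subset)
    then have "open (- (\<rho> ` C))" by (simp add: compact_imp_closed open_Compl)
    moreover have "z \<notin> \<rho> ` C"
    proof
      assume "z \<in> \<rho> ` C"
      then obtain x where x: "x \<in> C" "\<rho> x = \<rho> y" using y by auto
      have "Re (\<mu> x) = Re (\<mu> y)" "(Im (\<mu> x))\<^sup>2 = (Im (\<mu> y))\<^sup>2"
        using x(2) by (auto simp: \<rho>_def)
      then have "\<mu> x = \<mu> y \<or> \<mu> x = cnj (\<mu> y)"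
        by (auto simp: power2_eq_iff complex_eq_iff)
      then show False using h(2) x(1) \<open>0 < \<epsilon>\<close> by (auto simp: C_def)
    qed
    ultimately show ?thesis using h(1)
      by (intro exI[of _ h] exI[of _ "- (\<rho> ` C)"]) (force simp: C_def)
  qed
  then have "\<forall>z\<in>Z. \<exists>h U. h \<in> real_span G \<and> open U \<and> z \<in> U \<and>
      (\<forall>x\<in>\<Omega>. \<rho> x \<in> U \<longrightarrow> cmod (h x - F x) < \<epsilon> / 2)"
    by (intro ballI)
  from bchoice[OF this] obtain H where "\<forall>z\<in>Z. \<exists>U. H z \<in> real_span G \<and> open U \<and> z \<in> U \<and>
      (\<forall>x\<in>\<Omega>. \<rho> x \<in> U \<longrightarrow> cmod (H z x - F x) < \<epsilon> / 2)" ..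
  from bchoice[OF this] obtain U where U: "\<forall>z\<in>Z. H z \<in> real_span G \<and> open (U z) \<and> z \<in> U z \<and>
      (\<forall>x\<in>\<Omega>. \<rho> x \<in> U z \<longrightarrow> cmod (H z x - F x) < \<epsilon> / 2)" ..
  have HU: "\<And>z. z \<in> Z \<Longrightarrow> H z \<in> real_span G" "\<And>z. z \<in> Z \<Longrightarrow> open (U z)"
      "\<And>z. z \<in> Z \<Longrightarrow> z \<in> U z" "\<And>z x. z \<in> Z \<Longrightarrow> x \<in> \<Omega> \<Longrightarrow> \<rho> x \<in> U z \<Longrightarrow> cmod (H z x - F x) < \<epsilon> / 2"
    using U by simp_all
  have cover: "Z \<subseteq> (\<Union>z\<in>Z. U z)" using HU(3) by (intro subsetI UN_I)
  obtain Z' where Z': "Z' \<subseteq> Z" "finite Z'" "Z \<subseteq> (\<Union>z\<in>Z'. U z)"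
    by (rule compactE_image[OF cpt_Z HU(2) cover])
  \<comment> \<open>The partition of unity is indexed by the open sets themselves; several centres
    may share one set, so \<open>c\<close> later selects one centre for each set.\<close>
  define CC where "CC = U ` Z'"
  have finCC: "finite CC" using Z' by (simp add: CC_def)
  obtain \<phi> :: "complex set \<Rightarrow> complex \<Rightarrow> real" where
      phi_cont: "\<And>V. V \<in> CC \<Longrightarrow> continuous_on Z (\<phi> V)" and
      phi_nonneg: "\<And>V x. V \<in> CC \<Longrightarrow> x \<in> Z \<Longrightarrow> 0 \<le> \<phi> V x" and
      phi_supp: "\<And>x V. V \<in> CC \<Longrightarrow> x \<in> Z \<Longrightarrow> x \<notin> V \<Longrightarrow> \<phi> V x = 0" and
      phi_sum: "\<And>x. x \<in> Z \<Longrightarrow> supp_sum (\<lambda>V. \<phi> V x) CC = 1"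
  proof (rule subordinate_partition_of_unity[of Z CC])
    show "Z \<subseteq> \<Union>CC" using Z' by (auto simp: CC_def)
    show "open T" if "T \<in> CC" for T using that HU Z' by (auto simp: CC_def)
    show "\<exists>V. open V \<and> x \<in> V \<and> finite {U \<in> CC. U \<inter> V \<noteq> {}}" if "x \<in> Z" for x
      using finCC by (intro exI[of _ UNIV]) auto
  qed blast
  have phi_sum': "(\<Sum>V\<in>CC. \<phi> V x) = 1" if "x \<in> Z" for x
  proof -
    have "supp_sum (\<lambda>V. \<phi> V x) CC = (\<Sum>V\<in>CC. \<phi> V x)"
      unfolding supp_sum_def support_on_def by (rule sum.mono_neutral_left) (use finCC in auto)
    then show ?thesis using phi_sum[OF that] by simp
  qed
  have "\<forall>V\<in>CC. \<exists>z\<in>Z'. U z = V" by (auto simp: CC_def)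
  then obtain c where c: "\<And>V. V \<in> CC \<Longrightarrow> c V \<in> Z'" "\<And>V. V \<in> CC \<Longrightarrow> U (c V) = V" by metis
  define h where "h V = H (c V)" for V
  have h_span: "h V \<in> real_span G" if "V \<in> CC" for V
    using HU(1) c Z' that unfolding h_def by blast
  have h_close: "cmod (h V x - F x) < \<epsilon> / 2" if "V \<in> CC" "x \<in> \<Omega>" "\<rho> x \<in> V" for V x
    using HU(4)[of "c V" x] c[OF that(1)] Z' that unfolding h_def by auto
  have "\<exists>M. \<forall>x\<in>\<Omega>. cmod (h V x) \<le> M" if "V \<in> CC" for V
    using compact_imp_bounded[OF compact_continuous_image[OF cont_span[OF h_span[OF that]] cpt]]
    by (auto simp: bounded_iff)
  then obtain M where M: "\<And>V x. V \<in> CC \<Longrightarrow> x \<in> \<Omega> \<Longrightarrow> cmod (h V x) \<le> M V" by metis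
  \<comment> \<open>Replacing each partition function by a polynomial costs at most \<delta> times a
    bound for the local solution; the sum of these costs stays below \<epsilon> / 2. The added 1
    keeps the denominator positive.\<close>
  define \<delta> where "\<delta> = \<epsilon> / 2 / (1 + (\<Sum>V\<in>CC. \<bar>M V\<bar>))"
  have den: "0 < 1 + (\<Sum>V\<in>CC. \<bar>M V\<bar>)" by (smt (verit) sum_nonneg abs_ge_zero)
  then have "0 < \<delta>" using \<open>0 < \<epsilon>\<close> by (simp add: \<delta>_def)
  have "\<exists>p. real_polynomial_function p \<and> (\<forall>z\<in>Z. \<bar>\<phi> V z - p z\<bar> < \<delta>)" if V: "V \<in> CC" for V
    by (rule Stone_Weierstrass_real_polynomial_function[OF cpt_Z phi_cont[OF V] \<open>0 < \<delta>\<close>]) (intro exI conjI ballI)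
  then have "\<forall>V\<in>CC. \<exists>p. real_polynomial_function p \<and> (\<forall>z\<in>Z. \<bar>\<phi> V z - p z\<bar> < \<delta>)"
    by (intro ballI)
  from bchoice[OF this] obtain p where p: "\<And>V. V \<in> CC \<Longrightarrow> real_polynomial_function (p V)"
      "\<And>V z. V \<in> CC \<Longrightarrow> z \<in> Z \<Longrightarrow> \<bar>\<phi> V z - p V z\<bar> < \<delta>" by metis
  have "\<forall>V\<in>CC. \<exists>k. k \<in> real_span G \<and> (\<forall>x\<in>\<Omega>. k x = complex_of_real (p V (\<rho> x)) * h V x)"
    using module[OF p(1) h_span, unfolded Bex_def] by (intro ballI)
  from bchoice[OF this] obtain k where k: "\<And>V. V \<in> CC \<Longrightarrow> k V \<in> real_span G"
      "\<And>V x. V \<in> CC \<Longrightarrow> x \<in> \<Omega> \<Longrightarrow> k V x = complex_of_real (p V (\<rho> x)) * h V x"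
    by metis
  have "(\<lambda>x. \<Sum>V\<in>CC. k V x) \<in> real_span G"
    using real_span_sum[of CC k G "\<lambda>_. 1", OF finCC k(1)] by simp
  moreover have "cmod ((\<Sum>V\<in>CC. k V x) - F x) < \<epsilon>" if x: "x \<in> \<Omega>" for x
  proof -
    have z: "\<rho> x \<in> Z" using x by (simp add: Z_def)
    let ?\<phi> = "\<lambda>V. complex_of_real (\<phi> V (\<rho> x))"
    have "F x = (\<Sum>V\<in>CC. ?\<phi> V) * F x"
      using phi_sum'[OF z] by (metis mult_1 of_real_1 of_real_sum)
    then have "(\<Sum>V\<in>CC. k V x) - F x = (\<Sum>V\<in>CC. k V x - ?\<phi> V * F x)"
      by (simp add: sum_subtractf sum_distrib_right)
    \<comment> \<open>The first sum is the error of the polynomial approximation; the second is a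
      weighted average, with total weight 1, of the errors of the local solutions.\<close>
    also have "\<dots> = (\<Sum>V\<in>CC. (complex_of_real (p V (\<rho> x)) - ?\<phi> V) * h V x) + (\<Sum>V\<in>CC. ?\<phi> V * (h V x - F x))"
      unfolding sum.distrib[symmetric] using k(2) x by (intro sum.cong) (auto simp: algebra_simps)
    finally have "cmod ((\<Sum>V\<in>CC. k V x) - F x) \<le>
        cmod (\<Sum>V\<in>CC. (complex_of_real (p V (\<rho> x)) - ?\<phi> V) * h V x) + cmod (\<Sum>V\<in>CC. ?\<phi> V * (h V x - F x))"
      by (simp only: norm_triangle_ineq)
    moreover have "cmod (\<Sum>V\<in>CC. ?\<phi> V * (h V x - F x)) \<le> (\<Sum>V\<in>CC. \<phi> V (\<rho> x) * (\<epsilon> / 2))"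
    proof (rule sum_norm_le)
      fix V assume V: "V \<in> CC"
      show "cmod (?\<phi> V * (h V x - F x)) \<le> \<phi> V (\<rho> x) * (\<epsilon> / 2)"
      \<comment> \<open>The local solution \<open>h V\<close> is close to \<open>F\<close> only over
        \<open>V\<close>; elsewhere its weight is zero.\<close>
      proof (cases "\<rho> x \<in> V")
        case True
        then show ?thesis using h_close[OF V x] phi_nonneg[OF V z]
          unfolding norm_mult norm_of_real by (simp add: mult_left_mono del: times_divide_eq_right)
      qed (use phi_supp[OF V z] in auto)
    qed
    moreover have "(\<Sum>V\<in>CC. \<phi> V (\<rho> x) * (\<epsilon> / 2)) = \<epsilon> / 2"
      unfolding sum_distrib_right[symmetric] phi_sum'[OF z] by simp
    moreover have "cmod (\<Sum>V\<in>CC. (complex_of_real (p V (\<rho> x)) - ?\<phi> V) * h V x) \<le> (\<Sum>V\<in>CC. \<delta> * \<bar>M V\<bar>)"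
    proof (rule sum_norm_le)
      fix V assume V: "V \<in> CC"
      have "cmod (complex_of_real (p V (\<rho> x)) - ?\<phi> V) \<le> \<delta>"
        using p(2)[OF V z] unfolding of_real_diff[symmetric] norm_of_real by linarith
      moreover have "cmod (h V x) \<le> \<bar>M V\<bar>" using M[OF V x] by linarith
      ultimately show "cmod ((complex_of_real (p V (\<rho> x)) - ?\<phi> V) * h V x) \<le> \<delta> * \<bar>M V\<bar>"
        unfolding norm_mult using \<open>0 < \<delta>\<close> by (intro mult_mono) auto
    qed
    moreover have "(\<Sum>V\<in>CC. \<delta> * \<bar>M V\<bar>) < \<epsilon> / 2"
      unfolding sum_distrib_left[symmetric] \<delta>_def using \<open>0 < \<epsilon>\<close> den
      by (simp add: divide_less_eq)
    ultimately show ?thesis by linarith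
  qed
  ultimately show ?thesis by (intro bexI) auto
qed

subsection \<open>Scalar control systems\<close>

text \<open>\<open>step_resp t z\<close> is \<open>\<integral>\<^sub>0\<^sup>t e\<^sup>s\<^sup>z ds\<close>.\<close>

definition step_resp :: "real \<Rightarrow> complex \<Rightarrow> complex" where
  "step_resp t z = (if z = 0 then complex_of_real t else (exp (complex_of_real t * z) - 1) / z)"

lemma step_resp_0 [simp]: "step_resp 0 z = 0"
  by (simp add: step_resp_def)

lemma mult_step_resp: "z * step_resp t z = exp (complex_of_real t * z) - 1"
  by (simp add: step_resp_def)

text \<open>Serves the first \<open>r\<close> modal coordinates, which must remain real along a
  trajectory.\<close>

lemma step_resp_in_Reals: "z \<in> \<real> \<Longrightarrow> step_resp t z \<in> \<real>"
proof -
  assume "z \<in> \<real>"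
  then obtain a where a: "z = complex_of_real a" by (auto elim: Reals_cases)
  have "step_resp t z = complex_of_real (if a = 0 then t else (exp (t * a) - 1) / a)"
    by (simp add: a step_resp_def exp_of_real flip: of_real_mult)
  then show ?thesis by simp
qed

lemma has_vector_derivative_exp_mult:
  "((\<lambda>t. exp (complex_of_real t * z)) has_vector_derivative z * exp (complex_of_real t * z)) (at t within S)"
  by (rule has_vector_derivative_real_field) (auto intro!: derivative_eq_intros)

lemma has_vector_derivative_step_resp:
  "((\<lambda>t. step_resp t z) has_vector_derivative (z * step_resp t z + 1)) (at t within S)"
proof (cases "z = 0")
  case True
  then show ?thesis
    using has_vector_derivative_real_field[OF DERIV_ident, of t S] by (simp add: step_resp_def)
next
  case False
  have "((\<lambda>t. (exp (complex_of_real t * z) - 1) / z) has_vector_derivative exp (complex_of_real t * z)) (at t within S)"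
    using False by (intro has_vector_derivative_real_field) (auto intro!: derivative_eq_intros)
  then show ?thesis using False by (simp add: mult_step_resp step_resp_def)
qed

text \<open>The singularity at 0 is removable: the quotient is the difference quotient of
  \<open>exp (t * z)\<close>, whose derivative at 0 is \<open>t\<close>. States thus depend
  continuously on the parameter even where an eigenvalue vanishes.\<close>

lemma continuous_on_step_resp: "continuous_on UNIV (step_resp t)"
proof -
  have "isCont (step_resp t) z" for z
  proof (cases "z = 0")
    case True
    have "((\<lambda>z. exp (complex_of_real t * z)) has_field_derivative complex_of_real t) (at 0)"
      by (auto intro!: derivative_eq_intros)
    then have "(\<lambda>z. (exp (complex_of_real t * z) - 1) / z) \<midarrow>0\<rightarrow> complex_of_real t"
      by (simp add: DERIV_def)
    then have "step_resp t \<midarrow>0\<rightarrow> complex_of_real t"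
      by (rule Lim_transform_eventually) (auto simp: eventually_at_filter step_resp_def)
    then show ?thesis using True by (simp add: isCont_def step_resp_def)
  next
    case False
    have "isCont (\<lambda>z. (exp (complex_of_real t * z) - 1) / z) z"
      using False by (intro continuous_intros)
    moreover have "\<forall>\<^sub>F w in nhds z. step_resp t w = (exp (complex_of_real t * w) - 1) / w"
      using t1_space_nhds[OF False] by (rule eventually_mono) (auto simp: step_resp_def)
    ultimately show ?thesis by (subst isCont_cong)
  qed
  then show ?thesis by (simp add: continuous_at_imp_continuous_on)
qed

text \<open>Multiplication by \<open>z\<close> turns the remainder into that of the exponential
  series, and the resulting bound contains a factor \<open>cmod z\<close> that can be cancelled when
  \<open>z\<close> is nonzero. What matters later is the power \<open>t ^ Suc k\<close>: it is one
  order higher than the last term subtracted.\<close>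

lemma step_resp_taylor:
  assumes "0 \<le> t" "t \<le> 1" "cmod z \<le> M"
  shows "cmod (step_resp t z - (\<Sum>i<k. complex_of_real (t ^ Suc i / fact (Suc i)) * z ^ i)) \<le> exp M * t ^ Suc k * M ^ k"
proof (cases "z = 0")
  case True
  have M: "0 \<le> M" using assms(3) norm_ge_zero[of z] by linarith
  show ?thesis
  proof (cases k)
    case 0
    have "1 * t \<le> exp M * t" using M assms(1) by (intro mult_right_mono) auto
    then show ?thesis using True assms 0 by (simp add: step_resp_def)
  next
    \<comment> \<open>At \<open>z = 0\<close> only the term with \<open>i = 0\<close> survives, and
      it equals \<open>t\<close>, the value of the step response.\<close>
    case (Suc k')
    have "(\<Sum>i<k. complex_of_real (t ^ Suc i / fact (Suc i)) * z ^ i) = complex_of_real t"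
      unfolding Suc sum.lessThan_Suc_shift using True by simp
    then show ?thesis using True M assms(1) by (simp add: step_resp_def)
  qed
next
  case False
  let ?w = "complex_of_real t * z"
  have M: "0 \<le> M" using assms(3) norm_ge_zero[of z] by linarith
  have w: "cmod ?w \<le> M"
    using mult_mono[OF assms(2,3)] assms(1) by (simp add: norm_mult)
  let ?r = "step_resp t z - (\<Sum>i<k. complex_of_real (t ^ Suc i / fact (Suc i)) * z ^ i)"
  have "z * ?r = exp ?w - 1 - (\<Sum>i<k. ?w ^ Suc i / fact (Suc i))"
    unfolding right_diff_distrib mult_step_resp sum_distrib_left
    by (intro arg_cong2[of _ _ _ _ "(-)"] refl sum.cong) (simp add: power_mult_distrib)
  also have "\<dots> = exp ?w - (\<Sum>i\<le>k. ?w ^ i / fact i)"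
    unfolding lessThan_Suc_atMost[symmetric] sum.lessThan_Suc_shift by simp
  finally have "cmod z * cmod ?r = cmod (exp ?w - (\<Sum>i\<le>k. ?w ^ i / fact i))"
    by (metis norm_mult)
  also have "\<dots> \<le> exp (cmod ?w) * cmod ?w ^ Suc k / fact k"
    by (rule Taylor_exp_field)
  also have "\<dots> \<le> exp (cmod ?w) * cmod ?w ^ Suc k"
    using divide_left_mono[of 1 "fact k" "exp (cmod ?w) * cmod ?w ^ Suc k"] fact_ge_1[of k, where 'a = real]
    by (simp del: power_Suc)
  also have "\<dots> \<le> exp M * cmod ?w ^ Suc k"
    using w by (intro mult_right_mono) auto
  also have "\<dots> = cmod z * (exp M * t ^ Suc k * cmod z ^ k)"
    using assms(1) by (simp add: norm_mult power_mult_distrib)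
  finally have "cmod ?r \<le> exp M * t ^ Suc k * cmod z ^ k"
    using False by (simp add: mult_le_cancel_left_pos)
  also have "\<dots> \<le> exp M * t ^ Suc k * M ^ k"
    using assms by (intro mult_left_mono power_mono) auto
  finally show ?thesis .
qed

text \<open>The functions \<open>A ^ k b_j\<close> in modal coordinates, where powers of the matrix
  become powers of the eigenvalue.\<close>

definition krylov_gens :: "('a \<Rightarrow> complex) \<Rightarrow> ('a \<Rightarrow> nat \<Rightarrow> complex) \<Rightarrow> nat \<Rightarrow> ('a \<Rightarrow> complex) set" where
  "krylov_gens \<mu> b m = {\<lambda>x. \<mu> x ^ k * b x j | j k. j < m}"

text \<open>The states at time 1, starting from 0, under a unit input in channel \<open>j\<close>
  held during the last \<open>s\<close> units of time. All share the horizon 1, so sums of them are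
  again reachable at time 1.\<close>

definition step_gens :: "('a \<Rightarrow> complex) \<Rightarrow> ('a \<Rightarrow> nat \<Rightarrow> complex) \<Rightarrow> nat \<Rightarrow> ('a \<Rightarrow> complex) set" where
  "step_gens \<mu> b m = {\<lambda>x. b x j * step_resp s (\<mu> x) | j s. j < m \<and> 0 \<le> s \<and> s \<le> 1}"

text \<open>
  Subtracting the Taylor terms of order below \<open>k\<close>, which are approximable by induction, and rescaling
  extracts \<open>\<mu>\<^sup>k b\<^sub>j\<close> from \<open>b\<^sub>j step_resp t \<mu>\<close> as \<open>t \<rightarrow> 0\<close>.
\<close>

lemma krylov_gen_approx:
  assumes "j < m" and M: "0 \<le> M" "\<And>x. x \<in> X \<Longrightarrow> cmod (\<mu> x) \<le> M"
    and L: "0 \<le> L" "\<And>x. x \<in> X \<Longrightarrow> cmod (b x j) \<le> L"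
    and "0 < \<epsilon>"
  shows "\<exists>h\<in>real_span (step_gens \<mu> b m). \<forall>x\<in>X. cmod (h x - \<mu> x ^ k * b x j) < \<epsilon>"
  using \<open>0 < \<epsilon>\<close>
proof (induction k arbitrary: \<epsilon> rule: less_induct)
  case (less k)
  \<comment> \<open>After multiplication by \<open>C\<close> below, the Taylor remainder of order
    \<open>t ^ (k + 2)\<close> is bounded by exactly \<open>D * t\<close>.\<close>
  define D where "D = fact (Suc k) * L * exp M * M ^ Suc k"
  have D: "0 \<le> D" using M(1) L(1) by (simp add: D_def)
  define t where "t = min 1 (\<epsilon> / (2 * (D + 1)))"
  have t: "0 < t" "t \<le> 1" "D * t < \<epsilon> / 2"
  proof -
    show "0 < t" "t \<le> 1" using D less.prems by (auto simp: t_def)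
    have "D * t \<le> D * (\<epsilon> / (2 * (D + 1)))" using D by (intro mult_left_mono) (auto simp: t_def)
    also have "\<dots> < \<epsilon> / 2" using D less.prems by (simp add: field_simps)
    finally show "D * t < \<epsilon> / 2" .
  qed
  \<comment> \<open>The reciprocal of the coefficient of the \<open>k\<close>-th power of \<mu> in
    the expansion of the step response.\<close>
  define C where "C = fact (Suc k) / t ^ Suc k"
  have C: "0 < C" using t by (simp add: C_def)
  \<comment> \<open>The tolerance for the lower powers is fixed only after \<open>t\<close>, because
    their errors are magnified by \<open>C\<close>, which grows as \<open>t\<close> shrinks. Their
    coefficients \<open>?c i\<close> are at most 1, so the total is at most
    \<open>C * k * \<delta>\<close>.\<close>
  define \<delta> where "\<delta> = \<epsilon> / (2 * C * (real k + 1))"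
  have "0 < \<delta>" using C less.prems by (simp add: \<delta>_def)
  then have "\<forall>i\<in>{..<k}. \<exists>h. h \<in> real_span (step_gens \<mu> b m) \<and> (\<forall>x\<in>X. cmod (h x - \<mu> x ^ i * b x j) < \<delta>)"
    using less.IH[unfolded Bex_def] by simp
  from bchoice[OF this] obtain h where
    h: "\<And>i. i < k \<Longrightarrow> h i \<in> real_span (step_gens \<mu> b m)"
       "\<And>i x. i < k \<Longrightarrow> x \<in> X \<Longrightarrow> cmod (h i x - \<mu> x ^ i * b x j) < \<delta>"
    by (metis lessThan_iff)
  let ?c = "\<lambda>i. t ^ Suc i / fact (Suc i)"
  define g where "g = (\<lambda>x. complex_of_real C * (b x j * step_resp t (\<mu> x) - (\<Sum>i<k. complex_of_real (?c i) * h i x)))"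
  have "(\<lambda>x. b x j * step_resp t (\<mu> x)) \<in> step_gens \<mu> b m"
    unfolding step_gens_def mem_Collect_eq using t \<open>j < m\<close>
    by (intro exI[of _ j] exI[of _ t]) simp
  then have "g \<in> real_span (step_gens \<mu> b m)"
    unfolding g_def
    by (intro real_span_scale real_span_diff[OF real_span_base real_span_sum])
      (use h(1) in \<open>simp_all only: finite_lessThan lessThan_iff\<close>)
  moreover have "cmod (g x - \<mu> x ^ k * b x j) < \<epsilon>" if x: "x \<in> X" for x
  proof -
    let ?R = "step_resp t (\<mu> x) - (\<Sum>i<Suc k. complex_of_real (?c i) * \<mu> x ^ i)"
    let ?S = "\<Sum>i<k. complex_of_real (?c i) * (h i x - \<mu> x ^ i * b x j)"
    have one: "complex_of_real C * complex_of_real (?c k) = 1"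
      unfolding of_real_mult[symmetric] C_def using t by simp
    have "?S = (\<Sum>i<k. complex_of_real (?c i) * h i x) - (\<Sum>i<k. complex_of_real (?c i) * \<mu> x ^ i) * b x j"
      unfolding sum_distrib_right sum_subtractf[symmetric] by (intro sum.cong refl) (simp add: right_diff_distrib)
    \<comment> \<open>Here \<open>z\<close> stands for the \<open>k\<close>-th power of \<mu> and
      \<open>d\<close> for \<open>?c k\<close>. As \<open>C\<close> inverts \<open>?c k\<close>,
      subtracting \<open>z * b'\<close> amounts to subtracting one more Taylor term, and the
      remainder gains an order in \<open>t\<close>.\<close>
    moreover have "c * (b' * r - A) - z * b' = c * (b' * (r - (B + d * z))) - c * (A - B * b')"
      if "c * d = 1" for c b' r A z B d :: complex
    proof -
      have "c * (b' * r - A) - (c * d) * (z * b') = c * (b' * (r - (B + d * z))) - c * (A - B * b')"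
        by (simp add: algebra_simps)
      then show ?thesis using that by simp
    qed
    ultimately have "g x - \<mu> x ^ k * b x j = complex_of_real C * (b x j * ?R) - complex_of_real C * ?S"
      unfolding g_def sum.lessThan_Suc using one by presburger
    then have "cmod (g x - \<mu> x ^ k * b x j) \<le> C * (cmod (b x j) * cmod ?R) + C * cmod ?S"
      using norm_triangle_ineq4[of "complex_of_real C * (b x j * ?R)" "complex_of_real C * ?S"] C
      by (simp add: norm_mult)
    moreover have "C * (cmod (b x j) * cmod ?R) \<le> C * (L * (exp M * t ^ Suc (Suc k) * M ^ Suc k))"
      using step_resp_taylor[of t "\<mu> x" M "Suc k"] t M(2)[OF x] L C x
      by (intro mult_left_mono mult_mono) auto
    moreover have "C * (L * (exp M * t ^ Suc (Suc k) * M ^ Suc k)) = D * t" using t by (simp add: C_def D_def field_simps)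
    moreover have "cmod ?S \<le> (\<Sum>i<k. \<delta>)"
    proof (rule sum_norm_le)
      fix i assume i: "i \<in> {..<k}"
      have "?c i \<le> 1"
        using order.trans[OF power_le_one[of t "Suc i"] fact_ge_1] t
        by (simp add: divide_le_eq del: fact_Suc power_Suc)
      moreover have "cmod (complex_of_real (?c i)) = ?c i"
        unfolding norm_of_real using t by simp
      ultimately show "cmod (complex_of_real (?c i) * (h i x - \<mu> x ^ i * b x j)) \<le> \<delta>"
        using h(2)[of i x] i x unfolding norm_mult
        by (metis lessThan_iff less_eq_real_def mult_left_le_one_le norm_ge_zero order.trans)
    qed
    then have "C * cmod ?S \<le> C * (\<Sum>i<k. \<delta>)" using C by (intro mult_left_mono) auto
    moreover have "C * (\<Sum>i<k. \<delta>) < \<epsilon> / 2"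
    proof -
      have "C * (\<Sum>i<k. \<delta>) = real k * (C * \<delta>)" by simp
      also have "\<dots> = real k * (\<epsilon> / (2 * (real k + 1)))" using C by (simp add: \<delta>_def)
      also have "\<dots> < \<epsilon> / 2" using less.prems by (simp add: field_simps)
      finally show ?thesis .
    qed
    ultimately show ?thesis using t(3) by linarith
  qed
  ultimately show ?case by (intro bexI[of _ g]) auto
qed

lemma real_span_approx:
  assumes "f \<in> real_span G" "0 < \<epsilon>"
    and "\<And>g \<delta>. g \<in> G \<Longrightarrow> 0 < \<delta> \<Longrightarrow> \<exists>h\<in>real_span H. \<forall>x\<in>X. cmod (h x - g x) < (\<delta>::real)"
  shows "\<exists>h\<in>real_span H. \<forall>x\<in>X. cmod (h x - f x) < \<epsilon>"
  using assms(1,2)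
proof (induction arbitrary: \<epsilon>)
  case real_span_zero
  show ?case by (rule bexI[OF _ real_span.real_span_zero]) (use real_span_zero in simp)
next
  case (real_span_step f g c)
  have "0 < \<epsilon> / 2" using real_span_step.prems by simp
  from real_span_step.IH[OF this] obtain h1 where
    h1: "h1 \<in> real_span H" "\<forall>x\<in>X. cmod (h1 x - f x) < \<epsilon> / 2" ..
  \<comment> \<open>The generator is scaled by \<open>c\<close>, so its tolerance is divided by the
    size of \<open>c\<close>; adding 1 covers \<open>c = 0\<close>.\<close>
  have "0 < \<epsilon> / (2 * (\<bar>c\<bar> + 1))" using real_span_step.prems by simp
  from assms(3)[OF real_span_step.hyps(2) this] obtain h2 where
    h2: "h2 \<in> real_span H" "\<forall>x\<in>X. cmod (h2 x - g x) < \<epsilon> / (2 * (\<bar>c\<bar> + 1))" ..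
  have "cmod (h1 x + complex_of_real c * h2 x - (f x + complex_of_real c * g x)) < \<epsilon>" if "x \<in> X" for x
  proof -
    have "cmod (h1 x + complex_of_real c * h2 x - (f x + complex_of_real c * g x))
        \<le> cmod (h1 x - f x) + \<bar>c\<bar> * cmod (h2 x - g x)"
      using norm_triangle_ineq[of "h1 x - f x" "complex_of_real c * (h2 x - g x)"]
      unfolding norm_mult norm_of_real by (simp add: algebra_simps)
    moreover have "\<bar>c\<bar> * cmod (h2 x - g x) \<le> \<bar>c\<bar> * (\<epsilon> / (2 * (\<bar>c\<bar> + 1)))"
      using h2(2) that by (intro mult_left_mono) auto
    moreover have "\<bar>c\<bar> * (\<epsilon> / (2 * (\<bar>c\<bar> + 1))) \<le> \<epsilon> / 2"
      using real_span_step.prems by (simp add: field_simps)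
    ultimately show ?thesis using bspec[OF h1(2) that] by linarith
  qed
  then show ?case
    by (intro bexI[OF _ real_span_add[OF real_span_scale[OF h2(1), of c] h1(1)]] ballI)
qed

lemma krylov_approx:
  assumes "f \<in> real_span (krylov_gens \<mu> b m)" "0 < \<epsilon>"
    and "bounded (\<mu> ` X)" "\<And>j. j < m \<Longrightarrow> bounded ((\<lambda>x. b x j) ` X)"
  shows "\<exists>h\<in>real_span (step_gens \<mu> b m). \<forall>x\<in>X. cmod (h x - f x) < \<epsilon>"
proof (rule real_span_approx[OF assms(1,2)])
  fix g \<delta> assume "g \<in> krylov_gens \<mu> b m" "0 < (\<delta>::real)"
  then obtain j k where g: "g = (\<lambda>x. \<mu> x ^ k * b x j)" "j < m" by (auto simp: krylov_gens_def)
  obtain M where M: "0 < M" "\<And>x. x \<in> X \<Longrightarrow> cmod (\<mu> x) \<le> M"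
    using assms(3) by (auto simp: bounded_pos)
  obtain L where L: "0 < L" "\<And>x. x \<in> X \<Longrightarrow> cmod (b x j) \<le> L"
    using assms(4)[OF g(2)] by (auto simp: bounded_pos)
  show "\<exists>h\<in>real_span (step_gens \<mu> b m). \<forall>x\<in>X. cmod (h x - g x) < \<delta>"
    unfolding g(1)
    by (rule krylov_gen_approx[where X = X and \<mu> = \<mu> and b = b and j = j, OF g(2) less_imp_le[OF M(1)] M(2) less_imp_le[OF L(1)] L(2) \<open>0 < \<delta>\<close>])
qed

text \<open>One modal coordinate of \<open>lin_solution\<close>, with inputs read off by channel.
  Each coordinate may have its own exceptional set; finitely many are united when vectors are
  reassembled.\<close>

definition scalar_solution ::
  "nat \<Rightarrow> real \<Rightarrow> complex \<Rightarrow> (nat \<Rightarrow> complex) \<Rightarrow> (real \<Rightarrow> nat \<Rightarrow> real) \<Rightarrow> (real \<Rightarrow> complex) \<Rightarrow> bool" where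
  "scalar_solution m T z c u y \<longleftrightarrow> continuous_on {0..T} y \<and>
     (\<exists>P. finite P \<and> (\<forall>t\<in>{0..T} - P.
        (y has_vector_derivative (z * y t + (\<Sum>j<m. c j * complex_of_real (u t j)))) (at t within {0..T})))"

lemma scalar_solution_add:
  assumes "scalar_solution m T z c u y" "scalar_solution m T z c u' y'"
  shows "scalar_solution m T z c (\<lambda>t j. u t j + u' t j) (\<lambda>t. y t + y' t)"
proof -
  obtain P where P: "finite P" "\<forall>t\<in>{0..T} - P.
      (y has_vector_derivative (z * y t + (\<Sum>j<m. c j * complex_of_real (u t j)))) (at t within {0..T})"
    using assms(1) unfolding scalar_solution_def by blast
  obtain P' where P': "finite P'" "\<forall>t\<in>{0..T} - P'.
      (y' has_vector_derivative (z * y' t + (\<Sum>j<m. c j * complex_of_real (u' t j)))) (at t within {0..T})"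
    using assms(2) unfolding scalar_solution_def by blast
  have "((\<lambda>t. y t + y' t) has_vector_derivative
      (z * (y t + y' t) + (\<Sum>j<m. c j * complex_of_real (u t j + u' t j)))) (at t within {0..T})"
    if "t \<in> {0..T} - (P \<union> P')" for t
  proof -
    have "((\<lambda>t. y t + y' t) has_vector_derivative
      (z * y t + (\<Sum>j<m. c j * complex_of_real (u t j))) + (z * y' t + (\<Sum>j<m. c j * complex_of_real (u' t j))))
      (at t within {0..T})"
      using P(2) P'(2) that by (intro has_vector_derivative_add) auto
    then show ?thesis by (simp add: algebra_simps sum.distrib)
  qed
  moreover have "continuous_on {0..T} (\<lambda>t. y t + y' t)"
    using assms by (intro continuous_intros) (auto simp: scalar_solution_def)
  ultimately show ?thesis
    unfolding scalar_solution_def using P(1) P'(1) by (intro conjI exI[of _ "P \<union> P'"]) auto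
qed

lemma scalar_solution_free:
  "scalar_solution m T z c (\<lambda>_ _. 0) (\<lambda>t. exp (complex_of_real t * z) * a)"
  unfolding scalar_solution_def
proof (intro conjI exI[of _ "{}"] ballI)
  show "continuous_on {0..T} (\<lambda>t. exp (complex_of_real t * z) * a)" by (intro continuous_intros)
  show "((\<lambda>t. exp (complex_of_real t * z) * a) has_vector_derivative
      z * (exp (complex_of_real t * z) * a) + (\<Sum>j<m. c j * complex_of_real 0)) (at t within {0..T})" for t
    using has_vector_derivative_mult_left[OF has_vector_derivative_exp_mult[of z t "{0..T}"], of a]
    by (simp add: mult.assoc)
qed simp

text \<open>The input is delayed until time \<open>1 - s\<close> instead of being stopped early.
  Then the state at time 1 is \<open>step_resp s\<close> without any subsequent free motion,
  whatever \<open>s\<close> is. The truncation \<open>max 0\<close> keeps the state at rest before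
  the switch, and \<open>1 - s\<close> is the exceptional time.\<close>

lemma scalar_solution_step:
  assumes "j < m" "0 \<le> s" "s \<le> 1"
  shows "scalar_solution m 1 z c (\<lambda>t i. if i = j \<and> 1 - s < t then a else 0)
           (\<lambda>t. complex_of_real a * (c j * step_resp (max 0 (t - (1 - s))) z))"
  unfolding scalar_solution_def
proof (intro conjI exI[of _ "{1 - s}"] ballI)
  have "continuous_on UNIV (\<lambda>t. step_resp t z)"
    by (rule continuous_on_vector_derivative[OF has_vector_derivative_step_resp])
  moreover have "continuous_on {0..1} (\<lambda>t. max 0 (t - (1 - s)))" by (intro continuous_intros)
  ultimately have "continuous_on {0..1} (\<lambda>t. step_resp (max 0 (t - (1 - s))) z)"
    by (rule continuous_on_compose2) simp
  then show "continuous_on {0..1} (\<lambda>t. complex_of_real a * (c j * step_resp (max 0 (t - (1 - s))) z))"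
    by (intro continuous_on_mult continuous_on_const)
  fix t assume t: "t \<in> {0..1} - {1 - s}"
  let ?y = "\<lambda>t. complex_of_real a * (c j * step_resp (max 0 (t - (1 - s))) z)"
  have "(?y has_vector_derivative z * ?y t + (\<Sum>i<m. c i * complex_of_real (if i = j \<and> 1 - s < t then a else 0))) (at t)"
  proof (cases "t < 1 - s")
    case True
    have "((\<lambda>_. 0) has_vector_derivative 0) (at t)" by (rule has_vector_derivative_const)
    then have "(?y has_vector_derivative 0) (at t)"
      by (rule has_vector_derivative_transform_within_open[of _ _ _ "{..<1 - s}"]) (use True in \<open>auto simp: max_def\<close>)
    then show ?thesis using True by (simp add: max_def)
  next
    case False
    then have t': "1 - s < t" using t by auto
    have "((\<lambda>t. t - (1 - s)) has_vector_derivative 1) (at t)"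
      unfolding has_real_derivative_iff_has_vector_derivative[symmetric]
      by (auto intro!: derivative_eq_intros)
    from vector_diff_chain_at[OF this has_vector_derivative_step_resp]
    have "((\<lambda>t. step_resp (t - (1 - s)) z) has_vector_derivative (z * step_resp (t - (1 - s)) z + 1)) (at t)"
      by (simp add: o_def)
    then have "((\<lambda>t. complex_of_real a * (c j * step_resp (t - (1 - s)) z)) has_vector_derivative
        complex_of_real a * (c j * (z * step_resp (t - (1 - s)) z + 1))) (at t)"
      by (intro has_vector_derivative_mult_right)
    then have "(?y has_vector_derivative complex_of_real a * (c j * (z * step_resp (t - (1 - s)) z + 1))) (at t)"
      by (rule has_vector_derivative_transform_within_open[of _ _ _ "{1 - s<..}"]) (use t' in \<open>auto simp: max_def\<close>)
    moreover have "(\<Sum>i<m. c i * complex_of_real (if i = j \<and> 1 - s < t then a else 0)) = c j * complex_of_real a"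
      using \<open>j < m\<close> t' by (simp add: if_distrib[of complex_of_real] if_distrib[of "(*) _"] sum.delta cong: if_cong)
    ultimately show ?thesis using t' by (simp add: max_def algebra_simps)
  qed
  then show "(?y has_vector_derivative z * ?y t + (\<Sum>i<m. c i * complex_of_real (if i = j \<and> 1 - s < t then a else 0)))
      (at t within {0..1})"
    by (rule has_vector_derivative_at_within)
qed simp

text \<open>Superposition of delayed steps along the span induction. One input serves all points
  \<open>x\<close>. The last two clauses are carried along because the assembled ensemble state has
  to be continuous on \<open>K\<close> at every time and real in its first \<open>r\<close>
  coordinates.\<close>

lemma steps_reachable:
  fixes \<mu> :: "'a::topological_space \<Rightarrow> complex"
  assumes "f \<in> real_span (step_gens \<mu> b m)"
  shows "\<exists>u y. (\<exists>P. finite P \<and> (\<forall>s t. 0 \<le> s \<and> s \<le> t \<and> t \<le> 1 \<and> {s..t} \<inter> P = {} \<longrightarrow> u s = u t)) \<and>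
     (\<forall>x. scalar_solution m 1 (\<mu> x) (b x) u (y x) \<and> y x 0 = 0 \<and> y x 1 = f x) \<and>
     (\<forall>X t. continuous_on X \<mu> \<and> (\<forall>j<m. continuous_on X (\<lambda>x. b x j)) \<longrightarrow> continuous_on X (\<lambda>x. y x t)) \<and>
     (\<forall>x t. \<mu> x \<in> \<real> \<and> (\<forall>j<m. b x j \<in> \<real>) \<longrightarrow> y x t \<in> \<real>)"
  using assms
proof induction
  case real_span_zero
  have "scalar_solution m 1 z c (\<lambda>_ _. 0) (\<lambda>_. 0)" for z c
    using scalar_solution_free[of m 1 z c 0] by simp
  then show ?case
    by (intro exI[of _ "\<lambda>_ _. 0"] conjI exI[of _ "\<lambda>_ _. 0"] exI[of _ "{}"]) auto
next
  case (real_span_step f g a)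
  obtain j s where g: "g = (\<lambda>x. b x j * step_resp s (\<mu> x))" and js: "j < m" "0 \<le> s" "s \<le> 1"
    using real_span_step.hyps(2) unfolding step_gens_def by blast
  from real_span_step.IH obtain u y where
    P0: "\<exists>P. finite P \<and> (\<forall>s t. 0 \<le> s \<and> s \<le> t \<and> t \<le> 1 \<and> {s..t} \<inter> P = {} \<longrightarrow> u s = u t)" and
    y: "\<forall>x. scalar_solution m 1 (\<mu> x) (b x) u (y x) \<and> y x 0 = 0 \<and> y x 1 = f x" and
    cont: "\<forall>X t. continuous_on X \<mu> \<and> (\<forall>j<m. continuous_on X (\<lambda>x. b x j)) \<longrightarrow> continuous_on X (\<lambda>x. y x t)" and
    re: "\<forall>x t. \<mu> x \<in> \<real> \<and> (\<forall>j<m. b x j \<in> \<real>) \<longrightarrow> y x t \<in> \<real>"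
    by (elim exE) (erule conjE, erule conjE, erule conjE, rule that)
  from P0 obtain P where
    P: "finite P" "\<And>s t. 0 \<le> s \<Longrightarrow> s \<le> t \<Longrightarrow> t \<le> 1 \<Longrightarrow> {s..t} \<inter> P = {} \<Longrightarrow> u s = u t"
    by metis
  let ?v = "\<lambda>t i. if i = j \<and> 1 - s < t then a else 0"
  let ?u = "\<lambda>t i. u t i + ?v t i"
  let ?w = "\<lambda>x t. complex_of_real a * (b x j * step_resp (max 0 (t - (1 - s))) (\<mu> x))"
  let ?y = "\<lambda>x t. y x t + ?w x t"
  have "?u s' = ?u t'" if "0 \<le> s'" "s' \<le> t'" "t' \<le> 1" "{s'..t'} \<inter> insert (1 - s) P = {}" for s' t'
  proof -
    have "u s' = u t'" using that by (intro P(2)) auto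
    \<comment> \<open>An interval avoiding the switching time lies on one side of it, so the added
      step is constant there.\<close>
    moreover have "1 - s \<notin> {s'..t'}" using that by auto
    then have "?v s' = ?v t'" using that(2) by (auto intro!: ext)
    ultimately show ?thesis by metis
  qed
  then have 1: "\<exists>P. finite P \<and> (\<forall>s t. 0 \<le> s \<and> s \<le> t \<and> t \<le> 1 \<and> {s..t} \<inter> P = {} \<longrightarrow> ?u s = ?u t)"
    using P(1) by (intro exI[of _ "insert (1 - s) P"]) blast
  have 2: "scalar_solution m 1 (\<mu> x) (b x) ?u (?y x)" for x
    by (rule scalar_solution_add[OF y[rule_format, THEN conjunct1] scalar_solution_step[OF js]])
  have 3: "?y x 0 = 0" "?y x 1 = f x + complex_of_real a * g x" for x
    using js by (simp_all add: y g)
  have 4: "continuous_on X (\<lambda>x. ?y x t)" if "continuous_on X \<mu>" "\<forall>j<m. continuous_on X (\<lambda>x. b x j)" for X t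
  proof -
    have "continuous_on X (\<lambda>x. step_resp (max 0 (t - (1 - s))) (\<mu> x))"
      by (rule continuous_on_compose2[OF continuous_on_step_resp that(1)]) simp
    moreover have "continuous_on X (\<lambda>x. y x t)" using cont that by blast
    ultimately show ?thesis using that(2) js
      by (intro continuous_on_add continuous_on_mult continuous_on_const) auto
  qed
  have 5: "?y x t \<in> \<real>" if "\<mu> x \<in> \<real>" "\<forall>j<m. b x j \<in> \<real>" for x t
    using re that js step_resp_in_Reals by (intro Reals_add Reals_mult) auto
  show ?case
    by (intro exI[of _ ?u] exI[of _ ?y] conjI allI impI 1 2 3 4 5) blast+
qed

text \<open>By variation of constants a state reached from 0 is a superposition of the functions
  \<open>exp (\<tau> * \<mu>) * b_j\<close> with real weights, and each of these is a limit of real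
  combinations of Krylov generators. The proof differentiates the pairing instead of
  integrating.\<close>

lemma annihilator_solution:
  assumes "finite J" "0 \<le> T"
    and ann: "\<And>j k. j < m \<Longrightarrow> Re (\<Sum>x\<in>J. w x * (\<mu> x ^ k * b x j)) = 0"
    and sol: "\<And>x. x \<in> J \<Longrightarrow> scalar_solution m T (\<mu> x) (b x) u (y x)"
    and init: "\<And>x. x \<in> J \<Longrightarrow> y x 0 = 0"
  shows "Re (\<Sum>x\<in>J. w x * y x T) = 0"
proof -
  \<comment> \<open>The exponential series is annihilated term by term; this needs \<tau> real, as
    only real factors pass through \<open>Re\<close>.\<close>
  have ann_exp: "Re (\<Sum>x\<in>J. w x * (exp (complex_of_real \<tau> * \<mu> x) * b x j)) = 0" if "j < m" for \<tau> j
  proof -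
    have "(\<lambda>k. Re (\<Sum>x\<in>J. w x * ((complex_of_real \<tau> * \<mu> x) ^ k /\<^sub>R fact k * b x j))) sums
        Re (\<Sum>x\<in>J. w x * (exp (complex_of_real \<tau> * \<mu> x) * b x j))"
      by (intro sums_Re sums_sum sums_mult sums_mult2 exp_converges)
    moreover have "Re (\<Sum>x\<in>J. w x * ((complex_of_real \<tau> * \<mu> x) ^ k /\<^sub>R fact k * b x j)) = 0" for k
    proof -
      have "(\<Sum>x\<in>J. w x * ((complex_of_real \<tau> * \<mu> x) ^ k /\<^sub>R fact k * b x j))
          = complex_of_real (\<tau> ^ k / fact k) * (\<Sum>x\<in>J. w x * (\<mu> x ^ k * b x j))"
        unfolding sum_distrib_left
        by (intro sum.cong refl) (simp add: power_mult_distrib scaleR_conv_of_real field_simps)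
      moreover have "Re (complex_of_real r * z) = r * Re z" for r z by simp
      ultimately show ?thesis using ann[OF that, of k] by (simp only: mult_zero_right)
    qed
    ultimately have "(\<lambda>_. 0) sums Re (\<Sum>x\<in>J. w x * (exp (complex_of_real \<tau> * \<mu> x) * b x j))"
      by (simp only:)
    from sums_unique2[OF this sums_zero] show ?thesis .
  qed
  have "\<forall>x\<in>J. \<exists>P. finite P \<and> (\<forall>t\<in>{0..T} - P. (y x has_vector_derivative
      (\<mu> x * y x t + (\<Sum>j<m. b x j * complex_of_real (u t j)))) (at t within {0..T}))"
    using sol unfolding scalar_solution_def by blast
  from bchoice[OF this] obtain P where P: "\<And>x. x \<in> J \<Longrightarrow> finite (P x)"
      "\<And>x t. x \<in> J \<Longrightarrow> t \<in> {0..T} - P x \<Longrightarrow> (y x has_vector_derivative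
        (\<mu> x * y x t + (\<Sum>j<m. b x j * complex_of_real (u t j)))) (at t within {0..T})" by metis
  \<comment> \<open>\<open>g\<close> is constant: the free dynamics cancel and the inputs are annihilated by \<open>w\<close>.\<close>
  define g where "g = (\<lambda>s. Re (\<Sum>x\<in>J. w x * (exp (complex_of_real (T - s) * \<mu> x) * y x s)))"
  have "g T = g 0"
  proof (rule has_derivative_zero_unique_strong_interval[of "\<Union>x\<in>J. P x" 0 T g])
    show "finite (\<Union>x\<in>J. P x)" using P(1) assms(1) by auto
    show "continuous_on {0..T} g"
      unfolding g_def using sol[unfolded scalar_solution_def]
      by (intro continuous_intros) blast
    fix s assume s: "s \<in> {0..T} - (\<Union>x\<in>J. P x)"
    have der: "((\<lambda>s. exp (complex_of_real (T - s) * \<mu> x) * y x s) has_vector_derivative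
        (\<Sum>j<m. exp (complex_of_real (T - s) * \<mu> x) * b x j * complex_of_real (u s j))) (at s within {0..T})"
      if x: "x \<in> J" for x
    proof -
      have exp_der: "((\<lambda>s. exp (complex_of_real (T - s) * \<mu> x)) has_vector_derivative
          - (\<mu> x * exp (complex_of_real (T - s) * \<mu> x))) (at s within {0..T})"
        unfolding of_real_diff
        by (rule has_vector_derivative_real_field[where f = "\<lambda>z. exp ((complex_of_real T - z) * \<mu> x)"])
          (auto intro!: derivative_eq_intros)
      have y_der: "(y x has_vector_derivative
          (\<mu> x * y x s + (\<Sum>j<m. b x j * complex_of_real (u s j)))) (at s within {0..T})"
        using s x by (intro P(2)) auto
      have "e * (\<mu> x * y x s + (\<Sum>j<m. b x j * complex_of_real (u s j))) + - (\<mu> x * e) * y x s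
          = (\<Sum>j<m. e * b x j * complex_of_real (u s j))" for e
        by (simp add: distrib_left sum_distrib_left mult_ac)
      with has_vector_derivative_mult[OF exp_der y_der] show ?thesis by (simp only:)
    qed
    have "(g has_vector_derivative Re (\<Sum>x\<in>J. w x *
        (\<Sum>j<m. exp (complex_of_real (T - s) * \<mu> x) * b x j * complex_of_real (u s j)))) (at s within {0..T})"
      unfolding g_def
      by (intro bounded_linear.has_vector_derivative[OF bounded_linear_Re] has_vector_derivative_sum
          has_vector_derivative_mult_right der)
    moreover have "(\<Sum>x\<in>J. w x * (\<Sum>j<m. exp (complex_of_real (T - s) * \<mu> x) * b x j * complex_of_real (u s j)))
        = (\<Sum>j<m. complex_of_real (u s j) * (\<Sum>x\<in>J. w x * (exp (complex_of_real (T - s) * \<mu> x) * b x j)))"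
      unfolding sum_distrib_left by (subst sum.swap) (simp add: mult_ac)
    moreover have "Re (\<Sum>j<m. complex_of_real (u s j) *
        (\<Sum>x\<in>J. w x * (exp (complex_of_real (T - s) * \<mu> x) * b x j))) = 0"
      unfolding Re_sum[of _ "{..<m}"]
    proof (intro sum.neutral ballI)
      fix j assume "j \<in> {..<m}"
      moreover have "Re (complex_of_real r * z) = r * Re z" for r z by simp
      ultimately show "Re (complex_of_real (u s j) *
          (\<Sum>x\<in>J. w x * (exp (complex_of_real (T - s) * \<mu> x) * b x j))) = 0"
        using ann_exp[of j "T - s"] by (simp only: lessThan_iff mult_zero_right)
    qed
    ultimately have "(g has_vector_derivative 0) (at s within {0..T})" by (simp only:)
    then show "(g has_derivative (\<lambda>h. 0)) (at s within {0..T})"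
      by (simp add: has_vector_derivative_def)
  qed (use assms(2) in auto)
  then show ?thesis using init by (simp add: g_def)
qed

subsection \<open>Norms on coordinate space\<close>

text \<open>Expand in unit vectors and use the triangle inequality coordinate by coordinate. The
  summand 1 in \<open>C\<close> makes it positive even in dimension 0.\<close>

lemma norm_on_upper:
  assumes "norm_on n N"
  shows "\<exists>C>0. \<forall>v\<in>carrier_vec n. N v \<le> C * (\<Sum>i<n. \<bar>v $ i\<bar>)"
proof -
  have N0: "N (0\<^sub>v n) = 0" and Nscale: "\<And>c v. v \<in> carrier_vec n \<Longrightarrow> N (c \<cdot>\<^sub>v v) = \<bar>c\<bar> * N v"
    and Nadd: "\<And>v w. v \<in> carrier_vec n \<Longrightarrow> w \<in> carrier_vec n \<Longrightarrow> N (v + w) \<le> N v + N w"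
    and Npos: "\<And>v. v \<in> carrier_vec n \<Longrightarrow> 0 \<le> N v"
    using assms unfolding norm_on_def by auto
  define C where "C = 1 + (\<Sum>i<n. N (unit_vec n i))"
  have unit_le: "N (unit_vec n i) \<le> C" if "i < n" for i
    using member_le_sum[of i "{..<n}" "\<lambda>i. N (unit_vec n i)"] that Npos by (auto simp: C_def)
  have "N v \<le> C * (\<Sum>i<n. \<bar>v $ i\<bar>)" if v: "v \<in> carrier_vec n" for v
  proof -
    have "N (vec n (\<lambda>i. if i < k then v $ i else 0)) \<le> C * (\<Sum>i<k. \<bar>v $ i\<bar>)" if "k \<le> n" for k
      using that
    proof (induction k)
      case 0
      have "vec n (\<lambda>i. if i < 0 then v $ i else 0) = 0\<^sub>v n" by (intro eq_vecI) auto
      then show ?case using N0 by simp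
    next
      case (Suc k)
      have "vec n (\<lambda>i. if i < Suc k then v $ i else 0)
          = vec n (\<lambda>i. if i < k then v $ i else 0) + (v $ k) \<cdot>\<^sub>v unit_vec n k"
        using Suc.prems by (intro eq_vecI) (auto simp: less_Suc_eq)
      then have "N (vec n (\<lambda>i. if i < Suc k then v $ i else 0))
          \<le> N (vec n (\<lambda>i. if i < k then v $ i else 0)) + \<bar>v $ k\<bar> * N (unit_vec n k)"
        using Nadd[of "vec n (\<lambda>i. if i < k then v $ i else 0)" "(v $ k) \<cdot>\<^sub>v unit_vec n k"]
          Nscale[of "unit_vec n k" "v $ k"] by simp
      also have "\<dots> \<le> C * (\<Sum>i<k. \<bar>v $ i\<bar>) + \<bar>v $ k\<bar> * C"
        using Suc.IH Suc.prems unit_le[of k] by (intro add_mono mult_left_mono) auto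
      finally show ?case by (simp add: algebra_simps)
    qed
    from this[of n] have "N (vec n (\<lambda>i. if i < n then v $ i else 0)) \<le> C * (\<Sum>i<n. \<bar>v $ i\<bar>)" by simp
    moreover have "vec n (\<lambda>i. if i < n then v $ i else 0) = v" using v by (intro eq_vecI) auto
    ultimately show ?thesis by simp
  qed
  moreover have "0 < C" unfolding C_def using Npos by (smt (verit) sum_nonneg unit_vec_carrier)
  ultimately show ?thesis by blast
qed

text \<open>Equivalence of norms by compactness: \<open>N\<close> is continuous by
  \<open>norm_on_upper\<close>, hence attains a positive minimum on the unit sphere of the l1 norm,
  and homogeneity extends the bound.\<close>

lemma norm_on_lower:
  assumes "norm_on n N"
  shows "\<exists>C>0. \<forall>v\<in>carrier_vec n. \<forall>i<n. \<bar>v $ i\<bar> \<le> C * N v"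
proof -
  have N0: "\<And>v. v \<in> carrier_vec n \<Longrightarrow> N v = 0 \<longleftrightarrow> v = 0\<^sub>v n"
    and Nscale: "\<And>c v. v \<in> carrier_vec n \<Longrightarrow> N (c \<cdot>\<^sub>v v) = \<bar>c\<bar> * N v"
    and Nadd: "\<And>v w. v \<in> carrier_vec n \<Longrightarrow> w \<in> carrier_vec n \<Longrightarrow> N (v + w) \<le> N v + N w"
    and Npos: "\<And>v. v \<in> carrier_vec n \<Longrightarrow> 0 \<le> N v"
    using assms unfolding norm_on_def by auto
  obtain C where C: "0 < C" "\<And>v. v \<in> carrier_vec n \<Longrightarrow> N v \<le> C * (\<Sum>i<n. \<bar>v $ i\<bar>)"
    using norm_on_upper[OF assms] by blast
  \<comment> \<open>The norm is moved to functions on \<open>nat\<close>, a type that has the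
    product topology.\<close>
  define F where "F f = N (vec n f)" for f
  have lip: "F f \<le> F g + C * (\<Sum>i<n. \<bar>f i - g i\<bar>)" for f g
  proof -
    have "vec n f = vec n g + vec n (\<lambda>i. f i - g i)" by (intro eq_vecI) auto
    then have "F f \<le> F g + N (vec n (\<lambda>i. f i - g i))"
      unfolding F_def using Nadd[of "vec n g" "vec n (\<lambda>i. f i - g i)"] by simp
    moreover have "N (vec n (\<lambda>i. f i - g i)) \<le> C * (\<Sum>i<n. \<bar>f i - g i\<bar>)"
      using C(2)[of "vec n (\<lambda>i. f i - g i)"] by simp
    ultimately show ?thesis by linarith
  qed
  have cont_coord: "continuous_on UNIV (\<lambda>f :: nat \<Rightarrow> real. f i)" for i
    by (rule continuous_on_product_coordinates)
  have cont_F: "continuous_on UNIV F"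
    unfolding continuous_on_def
  proof
    fix g :: "nat \<Rightarrow> real"
    have tend: "((\<lambda>f. C * (\<Sum>i<n. \<bar>f i - g i\<bar>)) \<longlongrightarrow> C * (\<Sum>i<n. \<bar>g i - g i\<bar>)) (at g within UNIV)"
      using cont_coord by (intro tendsto_intros) (auto simp: continuous_on_def)
    have "((\<lambda>f. F f - F g) \<longlongrightarrow> 0) (at g within UNIV)"
    proof (rule Lim_null_comparison)
      have "norm (F f - F g) \<le> C * (\<Sum>i<n. \<bar>f i - g i\<bar>)" for f
        using lip[of f g] lip[of g f] by (simp add: abs_minus_commute)
      then show "\<forall>\<^sub>F f in at g within UNIV. norm (F f - F g) \<le> C * (\<Sum>i<n. \<bar>f i - g i\<bar>)" by simp
    qed (use tend in simp)
    then show "(F \<longlongrightarrow> F g) (at g within UNIV)" by (simp add: Lim_null[symmetric] LIM_zero_iff)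
  qed
  \<comment> \<open>Coordinates from \<open>n\<close> on are pinned to 0, so this product of compact
    factors is a compact copy of the cube.\<close>
  define Q where "Q = PiE UNIV (\<lambda>i. if i < n then {-1..1 :: real} else {0})"
  have "compactin (product_topology (\<lambda>i. euclidean) UNIV) Q"
    unfolding Q_def compactin_PiE by auto
  then have "compact Q" unfolding euclidean_product_topology by simp
  define S where "S = Q \<inter> (\<lambda>f. \<Sum>i<n. \<bar>f i\<bar>) -` {1}"
  have "closed ((\<lambda>f :: nat \<Rightarrow> real. \<Sum>i<n. \<bar>f i\<bar>) -` {1})"
    by (intro closed_vimage[OF closed_singleton] continuous_on_sum continuous_on_rabs cont_coord)
  then have "compact S" unfolding S_def using \<open>compact Q\<close> by (rule compact_Int_closed[rotated])
  have S_mem: "(\<lambda>i. if i < n then v $ i / (\<Sum>i<n. \<bar>v $ i\<bar>) else 0) \<in> S"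
    if "(\<Sum>i<n. \<bar>v $ i\<bar>) > 0" for v :: "real vec"
  proof -
    let ?s = "\<Sum>i<n. \<bar>v $ i\<bar>"
    have "\<bar>v $ i\<bar> \<le> ?s" if "i < n" for i
      using member_le_sum[of i "{..<n}" "\<lambda>i. \<bar>v $ i\<bar>"] that by auto
    then have "\<bar>v $ i / ?s\<bar> \<le> 1" if "i < n" for i using that \<open>?s > 0\<close> by (simp add: abs_divide)
    then have "- 1 \<le> v $ i / ?s \<and> v $ i / ?s \<le> 1" if "i < n" for i using that abs_le_D1 abs_le_D2 by (smt (verit))
    moreover have "(\<Sum>i<n. \<bar>v $ i / ?s\<bar>) = 1"
      using that by (simp add: abs_divide sum_divide_distrib[symmetric])
    ultimately show ?thesis by (auto simp: S_def Q_def)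
  qed
  show ?thesis
  proof (cases "S = {}")
    \<comment> \<open>With an empty sphere no vector has positive l1 norm, so all coordinates are
      zero.\<close>
    case True
    have "\<bar>v $ i\<bar> \<le> 1 * N v" if "v \<in> carrier_vec n" "i < n" for v i
    proof -
      have "\<not> (\<Sum>i<n. \<bar>v $ i\<bar>) > 0" using S_mem True by blast
      moreover have "\<bar>v $ i\<bar> \<le> (\<Sum>i<n. \<bar>v $ i\<bar>)"
        using member_le_sum[of i "{..<n}" "\<lambda>i. \<bar>v $ i\<bar>"] that by auto
      ultimately show ?thesis using Npos[OF that(1)] by linarith
    qed
    then show ?thesis by (intro exI[of _ 1]) auto
  next
    case False
    obtain f0 where f0: "f0 \<in> S" "\<And>f. f \<in> S \<Longrightarrow> F f0 \<le> F f"
      using continuous_attains_inf[OF \<open>compact S\<close> False continuous_on_subset[OF cont_F]] by blast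
    have "F f0 \<noteq> 0"
    proof
      assume "F f0 = 0"
      then have "vec n f0 = 0\<^sub>v n" unfolding F_def using N0[of "vec n f0"] by simp
      then have "\<And>i. i < n \<Longrightarrow> f0 i = 0" by (metis index_vec index_zero_vec(1))
      then show False using f0(1) by (simp add: S_def)
    qed
    then have pos: "0 < F f0" unfolding F_def using Npos[of "vec n f0"] by simp
    have "\<bar>v $ i\<bar> \<le> (1 / F f0) * N v" if v: "v \<in> carrier_vec n" and i: "i < n" for v i
    proof -
      let ?s = "\<Sum>i<n. \<bar>v $ i\<bar>"
      have le: "\<bar>v $ i\<bar> \<le> ?s" using member_le_sum[of i "{..<n}" "\<lambda>i. \<bar>v $ i\<bar>"] i by auto
      show ?thesis
      proof (cases "?s > 0")
        case True
        have "vec n (\<lambda>i. if i < n then v $ i / ?s else 0) = (1 / ?s) \<cdot>\<^sub>v v"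
          using v by (intro eq_vecI) auto
        then have "F f0 \<le> \<bar>1 / ?s\<bar> * N v"
          using f0(2)[OF S_mem[OF True]] Nscale[OF v, of "1 / ?s"] unfolding F_def by simp
        then have "F f0 * ?s \<le> N v" using True by (simp add: field_simps)
        then have "?s \<le> N v / F f0" using pos by (simp add: field_simps)
        then show ?thesis using le by simp
      next
        case False
        then have "\<bar>v $ i\<bar> \<le> 0" using le by linarith
        moreover have "0 \<le> (1 / F f0) * N v" using pos Npos[OF v] by simp
        ultimately show ?thesis by linarith
      qed
    qed
    then show ?thesis using pos by (intro exI[of _ "1 / F f0"]) auto
  qed
qed

subsection \<open>Modal coordinates\<close>

text \<open>Blocks of one common size \<open>s\<close> make the position \<open>p * s + i\<close>
  explicit. It is applied with \<open>s = 1\<close> and \<open>s = 2\<close> to the two kinds of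
  modal blocks, and with \<open>s = n\<close> to the stacked system.\<close>

lemma index_diag_block_mult_vec:
  assumes "\<And>x. x \<in> set xs \<Longrightarrow> M x \<in> carrier_mat s s" "v \<in> carrier_vec (length xs * s)"
    and "p < length xs" "i < s"
  shows "(diag_block_mat (map M xs) *\<^sub>v v) $ (p * s + i) = (M (xs ! p) *\<^sub>v vec s (\<lambda>i. v $ (p * s + i))) $ i"
  using assms
proof (induction xs arbitrary: v p)
  case Nil
  then show ?case by simp
next
  case (Cons x xs)
  let ?D = "diag_block_mat (map M xs)"
  have dims: "M x \<in> carrier_mat s s" using Cons.prems by auto
  have "map dim_row (map M xs) = map (\<lambda>_. s) xs" "map dim_col (map M xs) = map (\<lambda>_. s) xs"
    using Cons.prems(1) by auto
  then have D: "?D \<in> carrier_mat (length xs * s) (length xs * s)"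
    unfolding carrier_mat_def by (simp add: dim_diag_block_mat sum_list_triv o_def del: map_map)
  define v1 where "v1 = vec s (\<lambda>i. v $ i)"
  define v2 where "v2 = vec (length xs * s) (\<lambda>i. v $ (s + i))"
  have v: "v = v1 @\<^sub>v v2" using Cons.prems(2) by (intro eq_vecI) (auto simp: v1_def v2_def)
  have split: "diag_block_mat (map M (x # xs)) *\<^sub>v v = M x *\<^sub>v v1 @\<^sub>v ?D *\<^sub>v v2"
    using mult_mat_vec_split[OF dims D, of v1 v2] dims D unfolding v by (simp add: Let_def v1_def v2_def)
  have dim: "dim_vec (M x *\<^sub>v v1) = s" "dim_vec (?D *\<^sub>v v2) = length xs * s" using dims D by auto
  show ?case
  proof (cases p)
    case 0
    then show ?thesis unfolding split using Cons.prems(4) dim by (simp add: v1_def)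
  next
    case (Suc p')
    have p': "p' < length xs" using Suc Cons.prems by simp
    have lt: "p' * s + j < length xs * s" if "j < s" for j
    proof -
      have "p' * s + j < Suc p' * s" using that by simp
      also have "\<dots> \<le> length xs * s" using p' by (intro mult_le_mono1) simp
      finally show ?thesis .
    qed
    have "(?D *\<^sub>v v2) $ (p' * s + i) = (M (xs ! p') *\<^sub>v vec s (\<lambda>i. v2 $ (p' * s + i))) $ i"
      using Cons.prems p' by (intro Cons.IH) (auto simp: v2_def)
    moreover have "vec s (\<lambda>i. v2 $ (p' * s + i)) = vec s (\<lambda>i. v $ (p * s + i))"
      using lt by (intro eq_vecI) (auto simp: v2_def Suc add.assoc)
    moreover have "(M x *\<^sub>v v1 @\<^sub>v ?D *\<^sub>v v2) $ (p * s + i) = (?D *\<^sub>v v2) $ (p' * s + i)"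
      using lt[OF Cons.prems(4)] dim by (subst index_append_vec) (auto simp: Suc)
    ultimately show ?thesis unfolding split by (simp add: Suc)
  qed
qed

lemma foldr_append_rows:
  assumes "\<And>x. x \<in> set xs \<Longrightarrow> M x \<in> carrier_mat s m" "u \<in> carrier_vec m"
  shows "foldr (\<lambda>x C. M x @\<^sub>r C) xs (0\<^sub>m 0 m) \<in> carrier_mat (length xs * s) m"
    and "\<lbrakk>p < length xs; i < s\<rbrakk> \<Longrightarrow>
      (foldr (\<lambda>x C. M x @\<^sub>r C) xs (0\<^sub>m 0 m) *\<^sub>v u) $ (p * s + i) = (M (xs ! p) *\<^sub>v u) $ i"
proof -
  have carrier: "foldr (\<lambda>x C. M x @\<^sub>r C) ys (0\<^sub>m 0 m) \<in> carrier_mat (length ys * s) m"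
    if "set ys \<subseteq> set xs" for ys
    using that assms(1) by (induction ys) (auto intro!: carrier_append_rows)
  show "foldr (\<lambda>x C. M x @\<^sub>r C) xs (0\<^sub>m 0 m) \<in> carrier_mat (length xs * s) m"
    by (rule carrier) simp
  have "(foldr (\<lambda>x C. M x @\<^sub>r C) ys (0\<^sub>m 0 m) *\<^sub>v u) $ (p * s + i) = (M (ys ! p) *\<^sub>v u) $ i"
    if "set ys \<subseteq> set xs" "p < length ys" "i < s" for ys p i
    using that
  proof (induction ys arbitrary: p)
    case (Cons y ys)
    let ?C = "foldr (\<lambda>x C. M x @\<^sub>r C) ys (0\<^sub>m 0 m)"
    have My: "M y \<in> carrier_mat s m" using assms(1) Cons.prems by auto
    have C: "?C \<in> carrier_mat (length ys * s) m" using Cons.prems by (intro carrier) auto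
    have split: "foldr (\<lambda>x C. M x @\<^sub>r C) (y # ys) (0\<^sub>m 0 m) *\<^sub>v u = M y *\<^sub>v u @\<^sub>v ?C *\<^sub>v u"
      using mat_mult_append[OF My C assms(2)] by simp
    have dim: "dim_vec (M y *\<^sub>v u) = s" "dim_vec (?C *\<^sub>v u) = length ys * s" using My C by auto
    show ?case
    proof (cases p)
      case 0
      then show ?thesis unfolding split using Cons.prems dim by simp
    next
      case (Suc p')
      have "p' * s + i < Suc p' * s" using Cons.prems by simp
      also have "\<dots> \<le> length ys * s" using Suc Cons.prems by (intro mult_le_mono1) simp
      finally have "(M y *\<^sub>v u @\<^sub>v ?C *\<^sub>v u) $ (p * s + i) = (?C *\<^sub>v u) $ (p' * s + i)"
        using dim by (subst index_append_vec) (auto simp: Suc)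
      also have "\<dots> = (M (ys ! p') *\<^sub>v u) $ i" using Cons.prems Suc by (intro Cons.IH) auto
      finally show ?thesis unfolding split by (simp add: Suc)
    qed
  qed simp
  then show "\<lbrakk>p < length xs; i < s\<rbrakk> \<Longrightarrow>
      (foldr (\<lambda>x C. M x @\<^sub>r C) xs (0\<^sub>m 0 m) *\<^sub>v u) $ (p * s + i) = (M (xs ! p) *\<^sub>v u) $ i"
    by simp
qed

text \<open>The common shape of \<open>A_mat\<close> and \<open>A_star\<close>: they differ only in
  which off-diagonal entry, \<open>b\<close> or \<open>c\<close>, carries the minus sign.\<close>

lemma block_form_mult_vec:
  fixes a b c d :: "nat \<Rightarrow> real" and r l :: nat
  defines "M \<equiv> diag_block_mat
     (map (\<lambda>j. mat_of_rows_list 1 [[d j]]) [0..<r] @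
      map (\<lambda>j. mat_of_rows_list 2 [[a j, b j], [c j, a j]]) [0..<l])"
  assumes v: "v \<in> carrier_vec (r + 2 * l)"
  shows "M \<in> carrier_mat (r + 2 * l) (r + 2 * l)"
    and "j < r \<Longrightarrow> (M *\<^sub>v v) $ j = d j * v $ j"
    and "j < l \<Longrightarrow> (M *\<^sub>v v) $ (r + 2 * j) = a j * v $ (r + 2 * j) + b j * v $ (r + 2 * j + 1)"
    and "j < l \<Longrightarrow> (M *\<^sub>v v) $ (r + 2 * j + 1) = c j * v $ (r + 2 * j) + a j * v $ (r + 2 * j + 1)"
proof -
  let ?M1 = "\<lambda>j. mat_of_rows_list 1 [[d j]]"
  let ?M2 = "\<lambda>j. mat_of_rows_list 2 [[a j, b j], [c j, a j]]"
  define D1 where "D1 = diag_block_mat (map ?M1 [0..<r])"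
  define D2 where "D2 = diag_block_mat (map ?M2 [0..<l])"
  have M1: "?M1 j \<in> carrier_mat 1 1" and M2: "?M2 j \<in> carrier_mat 2 2" for j
    by (rule carrier_matI; simp add: mat_of_rows_list_def)+
  have D1: "D1 \<in> carrier_mat r r" unfolding D1_def carrier_mat_def
    by (simp add: dim_diag_block_mat o_def mat_of_rows_list_def sum_list_triv)
  have D2: "D2 \<in> carrier_mat (2 * l) (2 * l)" unfolding D2_def carrier_mat_def
    by (simp add: dim_diag_block_mat o_def mat_of_rows_list_def sum_list_triv)
  have M: "M = four_block_mat D1 (0\<^sub>m r (2 * l)) (0\<^sub>m (2 * l) r) D2"
    unfolding M_def diag_block_mat_append D1_def[symmetric] D2_def[symmetric] Let_def using D1 D2 by simp
  show "M \<in> carrier_mat (r + 2 * l) (r + 2 * l)" unfolding M using D1 D2 by simp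
  define v1 where "v1 = vec r (\<lambda>i. v $ i)"
  define v2 where "v2 = vec (2 * l) (\<lambda>i. v $ (r + i))"
  have "v = v1 @\<^sub>v v2" using v by (intro eq_vecI) (auto simp: v1_def v2_def)
  then have Mv: "M *\<^sub>v v = D1 *\<^sub>v v1 @\<^sub>v D2 *\<^sub>v v2"
    unfolding M using mult_mat_vec_split[OF D1 D2, of v1 v2] by (simp add: v1_def v2_def)
  have dim: "dim_vec (D1 *\<^sub>v v1) = r" "dim_vec (D2 *\<^sub>v v2) = 2 * l" using D1 D2 by auto
  show "(M *\<^sub>v v) $ j = d j * v $ j" if j: "j < r"
  proof -
    have "(M *\<^sub>v v) $ j = (D1 *\<^sub>v v1) $ (j * 1 + 0)" unfolding Mv using j dim by simp
    also have "\<dots> = (?M1 ([0..<r] ! j) *\<^sub>v vec 1 (\<lambda>i. v1 $ (j * 1 + i))) $ 0"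
      unfolding D1_def using j M1 by (intro index_diag_block_mult_vec) (auto simp: v1_def)
    also have "\<dots> = d j * v $ j" using j by (simp add: mat_of_rows_list_def scalar_prod_def v1_def)
    finally show ?thesis .
  qed
  have blk: "(M *\<^sub>v v) $ (r + 2 * j + i)
      = (?M2 j *\<^sub>v vec 2 (\<lambda>i. v $ (r + 2 * j + i))) $ i" if j: "j < l" and i: "i < 2" for i
  proof -
    have "(M *\<^sub>v v) $ (r + 2 * j + i) = (D2 *\<^sub>v v2) $ (j * 2 + i)"
      unfolding Mv using j i dim by (subst index_append_vec) (auto simp: mult.commute)
    also have "\<dots> = (?M2 ([0..<l] ! j) *\<^sub>v vec 2 (\<lambda>i. v2 $ (j * 2 + i))) $ i"
      unfolding D2_def using j i M2 by (intro index_diag_block_mult_vec) (auto simp: v2_def)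
    also have "vec 2 (\<lambda>i. v2 $ (j * 2 + i)) = vec 2 (\<lambda>i. v $ (r + 2 * j + i))"
      using j by (intro eq_vecI) (auto simp: v2_def ac_simps)
    finally show ?thesis using j by simp
  qed
  show "(M *\<^sub>v v) $ (r + 2 * j) = a j * v $ (r + 2 * j) + b j * v $ (r + 2 * j + 1)" if "j < l"
    using blk[OF that, of 0] by (simp add: mat_of_rows_list_def scalar_prod_def numeral_2_eq_2)
  show "(M *\<^sub>v v) $ (r + 2 * j + 1) = c j * v $ (r + 2 * j) + a j * v $ (r + 2 * j + 1)" if "j < l"
    using blk[OF that, of 1] by (simp add: mat_of_rows_list_def scalar_prod_def numeral_2_eq_2)
qed

text \<open>Indices below \<open>r\<close> are the real modes, the next \<open>l\<close> the blocks,
  each represented by \<alpha> + \<i> \<omega> alone: for a real state the coordinate of the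
  conjugate eigenvalue is the conjugate of this one.\<close>

definition modal_eig ::
  "nat \<Rightarrow> (nat \<Rightarrow> real \<Rightarrow> real) \<Rightarrow> (nat \<Rightarrow> real \<Rightarrow> real) \<Rightarrow> (nat \<Rightarrow> real \<Rightarrow> real) \<Rightarrow> real \<times> nat \<Rightarrow> complex" where
  "modal_eig r lam alpha omega =
     (\<lambda>(\<beta>, j). if j < r then complex_of_real (lam j \<beta>) else eig_plus alpha omega (j - r) \<beta>)"

definition to_modal :: "nat \<Rightarrow> real vec \<Rightarrow> nat \<Rightarrow> complex" where
  "to_modal r v j = (if j < r then complex_of_real (v $ j)
     else Complex (v $ (r + 2 * (j - r))) (v $ (r + 2 * (j - r) + 1)))"

text \<open>For the first \<open>r\<close> coordinates the imaginary part is discarded, so this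
  inverts \<open>to_modal\<close> only on families that are real there; hence the reality
  obligations in the steering arguments.\<close>

definition of_modal :: "nat \<Rightarrow> nat \<Rightarrow> (nat \<Rightarrow> complex) \<Rightarrow> real vec" where
  "of_modal r n c = vec n (\<lambda>i. if i < r then Re (c i)
     else if even (i - r) then Re (c (r + (i - r) div 2)) else Im (c (r + (i - r) div 2)))"

lemma of_modal_carrier [simp]: "of_modal r n c \<in> carrier_vec n"
  by (simp add: of_modal_def)

lemma to_modal_of_modal:
  assumes "j < r + l" "j < r \<Longrightarrow> c j \<in> \<real>"
  shows "to_modal r (of_modal r (r + 2 * l) c) j = c j"
proof (cases "j < r")
  case True
  then show ?thesis using assms(2) by (simp add: to_modal_def of_modal_def)
next
  case False
  then have "j - r < l" "r + (j - r) = j" using assms(1) by auto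
  then show ?thesis using False by (simp add: to_modal_def of_modal_def)
qed

lemma of_modal_to_modal:
  assumes "v \<in> carrier_vec (r + 2 * l)"
  shows "of_modal r (r + 2 * l) (to_modal r v) = v"
proof (rule eq_vecI)
  fix i assume "i < dim_vec v"
  then have i: "i < r + 2 * l" using assms by simp
  show "of_modal r (r + 2 * l) (to_modal r v) $ i = v $ i"
  proof (cases "i < r")
    case True
    then show ?thesis using i by (simp add: to_modal_def of_modal_def)
  next
    case False
    then have "i = r + (i - r)" by simp
    moreover have "i - r = 2 * ((i - r) div 2) + (if even (i - r) then 0 else 1)"
      by (metis add.right_neutral dvd_mult_div_cancel odd_two_times_div_two_succ)
    ultimately have "even (i - r) \<Longrightarrow> r + 2 * ((i - r) div 2) = i"
      "odd (i - r) \<Longrightarrow> Suc (r + 2 * ((i - r) div 2)) = i" by presburger+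
    then show ?thesis using i False by (simp add: to_modal_def of_modal_def)
  qed
qed (use assms in \<open>simp add: of_modal_def\<close>)

lemma of_modal_cong: "(\<And>j. j < r + l \<Longrightarrow> c j = d j) \<Longrightarrow> of_modal r (r + 2 * l) c = of_modal r (r + 2 * l) d"
  unfolding of_modal_def by (intro eq_vecI) auto

lemma to_modal_inject:
  assumes "v \<in> carrier_vec (r + 2 * l)" "w \<in> carrier_vec (r + 2 * l)"
    and "\<And>j. j < r + l \<Longrightarrow> to_modal r v j = to_modal r w j"
  shows "v = w"
  using of_modal_cong[of r l "to_modal r v" "to_modal r w"] of_modal_to_modal assms by metis

lemma to_modal_in_Reals: "j < r \<Longrightarrow> to_modal r v j \<in> \<real>"
  by (simp add: to_modal_def)

lemma modal_eig_in_Reals: "j < r \<Longrightarrow> modal_eig r lam alpha omega (\<beta>, j) \<in> \<real>"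
  by (simp add: modal_eig_def)

lemma to_modal_add:
  assumes "v \<in> carrier_vec (r + 2 * l)" "w \<in> carrier_vec (r + 2 * l)" "j < r + l"
  shows "to_modal r (v + w) j = to_modal r v j + to_modal r w j"
  using assms by (auto simp: to_modal_def complex_eq_iff)

lemma to_modal_diff:
  assumes "v \<in> carrier_vec (r + 2 * l)" "w \<in> carrier_vec (r + 2 * l)" "j < r + l"
  shows "to_modal r (v - w) j = to_modal r v j - to_modal r w j"
  using assms by (auto simp: to_modal_def complex_eq_iff)

lemma to_modal_sum:
  assumes "j < r + l"
  shows "to_modal r (vec (r + 2 * l) (\<lambda>i. \<Sum>s\<in>S. c s * v s $ i)) j
    = (\<Sum>s\<in>S. complex_of_real (c s) * to_modal r (v s) j)"
  using assms by (auto simp: to_modal_def complex_eq_iff)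

lemma cmod_to_modal_le:
  assumes "j < r + l" "\<And>i. i < r + 2 * l \<Longrightarrow> \<bar>v $ i\<bar> \<le> e"
  shows "cmod (to_modal r v j) \<le> 2 * e"
proof (cases "j < r")
  case True
  then show ?thesis using assms(2)[of j] by (simp add: to_modal_def)
next
  case False
  then have "\<bar>v $ (r + 2 * (j - r))\<bar> \<le> e" "\<bar>v $ (r + 2 * (j - r) + 1)\<bar> \<le> e"
    using assms(1) by (auto intro!: assms(2))
  then show ?thesis using False cmod_le[of "to_modal r v j"] by (simp add: to_modal_def)
qed

lemma abs_of_modal_le:
  assumes "\<And>j. j < r + l \<Longrightarrow> cmod (c j) \<le> e" "i < r + 2 * l"
  shows "\<bar>of_modal r (r + 2 * l) c $ i\<bar> \<le> e"
proof -
  have "\<bar>Re (c j)\<bar> \<le> e" "\<bar>Im (c j)\<bar> \<le> e" if "j < r + l" for j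
    using assms(1)[OF that] abs_Re_le_cmod[of "c j"] abs_Im_le_cmod[of "c j"] by linarith+
  then show ?thesis using assms(2) by (auto simp: of_modal_def)
qed

section \<open>Diagonal action of the system matrices in modal coordinates\<close>

lemma A_mat_carrier: "A_mat r l lam alpha omega \<beta> \<in> carrier_mat (r + 2 * l) (r + 2 * l)"
  unfolding A_mat_def by (rule block_form_mult_vec(1)[OF zero_carrier_vec])

lemma to_modal_A_mat:
  assumes "v \<in> carrier_vec (r + 2 * l)" "j < r + l"
  shows "to_modal r (A_mat r l lam alpha omega \<beta> *\<^sub>v v) j = modal_eig r lam alpha omega (\<beta>, j) * to_modal r v j"
proof (cases "j < r")
  case True
  then show ?thesis unfolding A_mat_def to_modal_def modal_eig_def
    using block_form_mult_vec(2)[OF assms(1), of j] by simp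
next
  case False
  then have "j - r < l" using assms(2) by simp
  then show ?thesis unfolding A_mat_def to_modal_def modal_eig_def
    using False block_form_mult_vec(3,4)[OF assms(1), of "j - r"]
    by (simp add: complex_eq_iff eig_plus_def)
qed

lemma to_modal_A_star:
  assumes "v \<in> carrier_vec (r + 2 * l)" "j < r + l"
  shows "to_modal r (A_star r l lam alpha omega \<beta> *\<^sub>v v) j = cnj (modal_eig r lam alpha omega (\<beta>, j)) * to_modal r v j"
proof (cases "j < r")
  case True
  then show ?thesis unfolding A_star_def to_modal_def modal_eig_def
    using block_form_mult_vec(2)[OF assms(1), of j] by simp
next
  case False
  then have "j - r < l" using assms(2) by simp
  then show ?thesis unfolding A_star_def to_modal_def modal_eig_def
    using False block_form_mult_vec(3,4)[OF assms(1), of "j - r"]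
    by (simp add: complex_eq_iff eig_plus_def)
qed

lemma to_modal_A_mat_pow:
  assumes "v \<in> carrier_vec (r + 2 * l)" "j < r + l"
  shows "to_modal r (A_mat r l lam alpha omega \<beta> ^\<^sub>m k *\<^sub>v v) j = modal_eig r lam alpha omega (\<beta>, j) ^ k * to_modal r v j"
  using assms(1)
proof (induction k arbitrary: v)
  case 0
  then show ?case using A_mat_carrier[of r l lam alpha omega \<beta>] by simp
next
  case (Suc k)
  let ?A = "A_mat r l lam alpha omega \<beta>"
  have A: "?A \<in> carrier_mat (r + 2 * l) (r + 2 * l)" by (rule A_mat_carrier)
  have "?A ^\<^sub>m Suc k *\<^sub>v v = ?A ^\<^sub>m k *\<^sub>v (?A *\<^sub>v v)"
    using assoc_mult_mat_vec[OF pow_carrier_mat[OF A] A Suc.prems] by simp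
  moreover have "?A *\<^sub>v v \<in> carrier_vec (r + 2 * l)" using A Suc.prems by simp
  ultimately show ?case using Suc.IH[of "?A *\<^sub>v v"] to_modal_A_mat[OF Suc.prems assms(2)]
    by simp
qed

lemma to_modal_mult_mat_vec:
  assumes "M \<in> carrier_mat (r + 2 * l) m" "u \<in> carrier_vec m" "j < r + l"
  shows "to_modal r (M *\<^sub>v u) j = (\<Sum>i<m. to_modal r (col M i) j * complex_of_real (u $ i))"
proof -
  have "M *\<^sub>v u = vec (r + 2 * l) (\<lambda>k. \<Sum>i<m. u $ i * col M i $ k)"
    using assms by (intro eq_vecI) (auto simp: scalar_prod_def lessThan_atLeast0 intro!: sum.cong)
  then show ?thesis using to_modal_sum[OF assms(3), where c = "\<lambda>i. u $ i" and v = "\<lambda>i. col M i" and S = "{..<m}"]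
    by (simp add: mult.commute)
qed

lemma has_vector_derivative_Complex_iff:
  "(f has_vector_derivative d) F \<longleftrightarrow>
     ((\<lambda>t. Re (f t)) has_vector_derivative Re d) F \<and> ((\<lambda>t. Im (f t)) has_vector_derivative Im d) F"
proof
  assume "(f has_vector_derivative d) F"
  then show "((\<lambda>t. Re (f t)) has_vector_derivative Re d) F \<and> ((\<lambda>t. Im (f t)) has_vector_derivative Im d) F"
    using bounded_linear.has_vector_derivative bounded_linear_Re bounded_linear_Im by blast
next
  assume *: "((\<lambda>t. Re (f t)) has_vector_derivative Re d) F \<and> ((\<lambda>t. Im (f t)) has_vector_derivative Im d) F"
  then have "((\<lambda>t. complex_of_real (Re (f t)) + \<i> * complex_of_real (Im (f t))) has_vector_derivative
      complex_of_real (Re d) + \<i> * complex_of_real (Im d)) F"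
    by (intro has_vector_derivative_add has_vector_derivative_mult_right
        bounded_linear.has_vector_derivative[OF bounded_linear_of_real]) auto
  then show "(f has_vector_derivative d) F" by (simp add: complex_eq[symmetric])
qed

text \<open>The change of coordinates is a fixed real-linear bijection, so derivatives and
  continuity transfer both ways. The left side has one exceptional set for all coordinates, the
  right side one for each; finitely many coordinates make the union harmless.\<close>

lemma lin_solution_modal:
  assumes M: "M \<in> carrier_mat (r + 2 * l) m" and u: "\<And>t. t \<in> {0..T} \<Longrightarrow> u t \<in> carrier_vec m"
  shows "lin_solution (r + 2 * l) (A_mat r l lam alpha omega \<beta>) M T u x \<longleftrightarrow>
    (\<forall>t\<in>{0..T}. x t \<in> carrier_vec (r + 2 * l)) \<and>
    (\<forall>j<r + l. scalar_solution m T (modal_eig r lam alpha omega (\<beta>, j)) (\<lambda>i. to_modal r (col M i) j)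
       (\<lambda>t i. u t $ i) (\<lambda>t. to_modal r (x t) j))"
    (is "?L \<longleftrightarrow> ?C \<and> ?R")
proof -
  let ?n = "r + 2 * l"
  let ?A = "A_mat r l lam alpha omega \<beta>"
  let ?f = "\<lambda>t. ?A *\<^sub>v x t + M *\<^sub>v u t"
  let ?g = "\<lambda>j t. modal_eig r lam alpha omega (\<beta>, j) * to_modal r (x t) j
      + (\<Sum>i<m. to_modal r (col M i) j * complex_of_real (u t $ i))"
  have rhs: "to_modal r (?f t) j = ?g j t" if "x t \<in> carrier_vec ?n" "t \<in> {0..T}" "j < r + l" for t j
  proof -
    have "?A *\<^sub>v x t \<in> carrier_vec ?n" "M *\<^sub>v u t \<in> carrier_vec ?n"
      using mult_mat_vec_carrier[OF A_mat_carrier that(1)] mult_mat_vec_carrier[OF M u[OF that(2)]] by auto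
    then show ?thesis
      using to_modal_add[OF _ _ that(3)] to_modal_A_mat[OF that(1,3)]
        to_modal_mult_mat_vec[OF M u[OF that(2)] that(3)] by simp
  qed
  have f_carrier: "?f t \<in> carrier_vec ?n" if "x t \<in> carrier_vec ?n" "t \<in> {0..T}" for t
    using mult_mat_vec_carrier[OF A_mat_carrier that(1)] mult_mat_vec_carrier[OF M u[OF that(2)]] by auto
  show ?thesis
  proof
    assume L: ?L
    then have C: ?C unfolding lin_solution_def by blast
    from L obtain P where cont: "\<And>i. i < ?n \<Longrightarrow> continuous_on {0..T} (\<lambda>t. x t $ i)" and P: "finite P"
      and der: "\<And>t i. t \<in> {0..T} - P \<Longrightarrow> i < ?n \<Longrightarrow>
        ((\<lambda>s. x s $ i) has_real_derivative ?f t $ i) (at t within {0..T})"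
      unfolding lin_solution_def by blast
    have "scalar_solution m T (modal_eig r lam alpha omega (\<beta>, j)) (\<lambda>i. to_modal r (col M i) j)
       (\<lambda>t i. u t $ i) (\<lambda>t. to_modal r (x t) j)" if j: "j < r + l" for j
      unfolding scalar_solution_def
    proof (intro conjI exI[of _ P] P ballI)
      show "continuous_on {0..T} (\<lambda>t. to_modal r (x t) j)"
      proof (cases "j < r")
        case True
        then show ?thesis unfolding to_modal_def if_P[OF True] by (intro continuous_on_of_real cont) simp
      next
        case False
        then have "r + 2 * (j - r) + 1 < ?n" using j by linarith
        then show ?thesis unfolding to_modal_def if_not_P[OF False] Complex_eq
          by (intro continuous_on_add continuous_on_mult continuous_on_const continuous_on_of_real cont) simp_all
      qed
      fix t assume t: "t \<in> {0..T} - P"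
      have "((\<lambda>t. to_modal r (x t) j) has_vector_derivative to_modal r (?f t) j) (at t within {0..T})"
        unfolding has_vector_derivative_Complex_iff has_real_derivative_iff_has_vector_derivative[symmetric]
        using der[OF t] j by (auto simp: to_modal_def)
      then show "((\<lambda>t. to_modal r (x t) j) has_vector_derivative ?g j t) (at t within {0..T})"
        using rhs[of t j] C t j by simp
    qed
    then show "?C \<and> ?R" using C by blast
  next
    assume CR: "?C \<and> ?R"
    then have C: "\<And>t. t \<in> {0..T} \<Longrightarrow> x t \<in> carrier_vec ?n" by blast
    have "\<forall>j\<in>{..<r + l}. \<exists>P. finite P \<and> (\<forall>t\<in>{0..T} - P.
        ((\<lambda>t. to_modal r (x t) j) has_vector_derivative ?g j t) (at t within {0..T}))"
      using CR unfolding scalar_solution_def by blast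
    from bchoice[OF this] obtain P where P_all: "\<forall>j\<in>{..<r + l}. finite (P j) \<and> (\<forall>t\<in>{0..T} - P j.
        ((\<lambda>t. to_modal r (x t) j) has_vector_derivative ?g j t) (at t within {0..T}))" ..
    have P: "\<And>j. j < r + l \<Longrightarrow> finite (P j)"
      and der: "\<And>j t. j < r + l \<Longrightarrow> t \<in> {0..T} - P j \<Longrightarrow>
        ((\<lambda>t. to_modal r (x t) j) has_vector_derivative ?g j t) (at t within {0..T})"
      using P_all by (simp_all only: lessThan_iff)
    have cont: "continuous_on {0..T} (\<lambda>t. to_modal r (x t) j)" if "j < r + l" for j
      using CR that unfolding scalar_solution_def by blast
    \<comment> \<open>The choice between \<open>Re\<close> and \<open>Im\<close> depends on the
      index alone, not on the vector, so it can be made once for a whole trajectory.\<close>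
    have coord: "\<exists>j<r + l. (\<forall>v\<in>carrier_vec ?n. v $ i = Re (to_modal r v j)) \<or>
        (\<forall>v\<in>carrier_vec ?n. v $ i = Im (to_modal r v j))" if i: "i < ?n" for i
    proof -
      define j where "j = (if i < r then i else r + (i - r) div 2)"
      have "v $ i = (if i < r \<or> even (i - r) then Re (to_modal r v j) else Im (to_modal r v j))"
        if "v \<in> carrier_vec ?n" for v
      proof -
        have "v $ i = of_modal r ?n (to_modal r v) $ i" using of_modal_to_modal[OF that] by simp
        then show ?thesis using i by (auto simp: of_modal_def j_def)
      qed
      moreover have "j < r + l" using i by (auto simp: j_def)
      ultimately show ?thesis by (cases "i < r \<or> even (i - r)") auto
    qed
    show ?L
      unfolding lin_solution_def
    proof (intro conjI allI impI exI[of _ "\<Union>j<r + l. P j"] ballI)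
      show "x t \<in> carrier_vec ?n" if "t \<in> {0..T}" for t using C that .
      show "finite (\<Union>j<r + l. P j)" using P by auto
      show "continuous_on {0..T} (\<lambda>t. x t $ i)" if i: "i < ?n" for i
      proof -
        obtain j where j: "j < r + l" "(\<forall>v\<in>carrier_vec ?n. v $ i = Re (to_modal r v j)) \<or>
          (\<forall>v\<in>carrier_vec ?n. v $ i = Im (to_modal r v j))" using coord[OF i] by blast
        have "continuous_on {0..T} (\<lambda>t. Re (to_modal r (x t) j))"
          and "continuous_on {0..T} (\<lambda>t. Im (to_modal r (x t) j))"
          using cont[OF j(1)] by (auto intro!: continuous_intros)
        from j(2) show ?thesis
        proof
          assume "\<forall>v\<in>carrier_vec ?n. v $ i = Re (to_modal r v j)"
          then show ?thesis using C \<open>continuous_on {0..T} (\<lambda>t. Re (to_modal r (x t) j))\<close>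
            by (subst continuous_on_cong[OF refl]) auto
        next
          assume "\<forall>v\<in>carrier_vec ?n. v $ i = Im (to_modal r v j)"
          then show ?thesis using C \<open>continuous_on {0..T} (\<lambda>t. Im (to_modal r (x t) j))\<close>
            by (subst continuous_on_cong[OF refl]) auto
        qed
      qed
      show "((\<lambda>s. x s $ i) has_real_derivative ?f t $ i) (at t within {0..T})"
        if t: "t \<in> {0..T} - (\<Union>j<r + l. P j)" and i: "i < ?n" for t i
      proof -
        obtain j where j: "j < r + l" "(\<forall>v\<in>carrier_vec ?n. v $ i = Re (to_modal r v j)) \<or>
          (\<forall>v\<in>carrier_vec ?n. v $ i = Im (to_modal r v j))" using coord[OF i] by blast
        have t': "t \<in> {0..T}" "t \<in> {0..T} - P j" using t j(1) by auto
        have d: "((\<lambda>t. to_modal r (x t) j) has_vector_derivative to_modal r (?f t) j) (at t within {0..T})"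
          using der[OF j(1) t'(2)] rhs[OF C[OF t'(1)] t'(1) j(1)] by simp
        have fc: "?f t \<in> carrier_vec ?n" using f_carrier[OF C[OF t'(1)] t'(1)] .
        from j(2) have "((\<lambda>s. x s $ i) has_vector_derivative ?f t $ i) (at t within {0..T})"
        proof
          assume *: "\<forall>v\<in>carrier_vec ?n. v $ i = Re (to_modal r v j)"
          have "((\<lambda>t. Re (to_modal r (x t) j)) has_vector_derivative ?f t $ i) (at t within {0..T})"
            using d fc * unfolding has_vector_derivative_Complex_iff by metis
          then show ?thesis by (rule has_vector_derivative_transform[rotated 2]) (use * C t' in auto)
        next
          assume *: "\<forall>v\<in>carrier_vec ?n. v $ i = Im (to_modal r v j)"
          have "((\<lambda>t. Im (to_modal r (x t) j)) has_vector_derivative ?f t $ i) (at t within {0..T})"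
            using d fc * unfolding has_vector_derivative_Complex_iff by metis
          then show ?thesis by (rule has_vector_derivative_transform[rotated 2]) (use * C t' in auto)
        qed
        then show ?thesis by (simp add: has_real_derivative_iff_has_vector_derivative)
      qed
    qed
  qed
qed

subsection \<open>Stacked systems\<close>

text \<open>Everything in \<open>lin_solution\<close> is taken within [0,T]. This is used for
  trajectories rebuilt from blocks, whose dimensions are known only on that interval.\<close>

lemma lin_solution_cong:
  assumes "\<And>t. t \<in> {0..T} \<Longrightarrow> x t = y t" "lin_solution d A B T u x"
  shows "lin_solution d A B T u y"
proof -
  obtain P where P: "finite P" "\<And>t i. t \<in> {0..T} - P \<Longrightarrow> i < d \<Longrightarrow>
      ((\<lambda>s. x s $ i) has_real_derivative (A *\<^sub>v x t + B *\<^sub>v u t) $ i) (at t within {0..T})"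
    using assms(2) unfolding lin_solution_def by blast
  have "((\<lambda>s. y s $ i) has_real_derivative (A *\<^sub>v y t + B *\<^sub>v u t) $ i) (at t within {0..T})"
    if t: "t \<in> {0..T} - P" and i: "i < d" for t i
  proof -
    have "((\<lambda>s. x s $ i) has_vector_derivative (A *\<^sub>v y t + B *\<^sub>v u t) $ i) (at t within {0..T})"
      using P(2)[OF t i] assms(1)[of t] t by (simp add: has_real_derivative_iff_has_vector_derivative)
    then have "((\<lambda>s. y s $ i) has_vector_derivative (A *\<^sub>v y t + B *\<^sub>v u t) $ i) (at t within {0..T})"
      by (rule has_vector_derivative_transform[rotated 2]) (use assms(1) t in auto)
    then show ?thesis by (simp add: has_real_derivative_iff_has_vector_derivative)
  qed
  moreover have "continuous_on {0..T} (\<lambda>t. y t $ i)" if "i < d" for i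
  proof -
    have "continuous_on {0..T} (\<lambda>t. x t $ i)" using assms(2) that unfolding lin_solution_def by blast
    then show ?thesis by (rule continuous_on_eq) (simp add: assms(1))
  qed
  moreover have "y t \<in> carrier_vec d" if "t \<in> {0..T}" for t
    using assms that unfolding lin_solution_def by metis
  ultimately show ?thesis unfolding lin_solution_def using P(1) by blast
qed

text \<open>A block diagonal matrix decouples the points, and stacking the input matrices means that
  one input drives all of them. Positions \<open>q\<close> correspond to pairs of a block
  \<open>q div n\<close> and an offset \<open>q mod n\<close>.\<close>

lemma lin_solution_stack:
  fixes A B :: "real \<Rightarrow> real mat" and S :: "real set"
  defines "bs \<equiv> sorted_list_of_set S"
  assumes "finite S" and A: "\<And>\<beta>. \<beta> \<in> S \<Longrightarrow> A \<beta> \<in> carrier_mat n n"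
    and B: "\<And>\<beta>. \<beta> \<in> S \<Longrightarrow> B \<beta> \<in> carrier_mat n m"
    and u: "\<And>t. t \<in> {0..T} \<Longrightarrow> u t \<in> carrier_vec m"
  shows "lin_solution (n * card S) (diag_mat_at A S) (stack_mat m B S) T u x \<longleftrightarrow>
    (\<forall>t\<in>{0..T}. x t \<in> carrier_vec (n * card S)) \<and>
    (\<forall>p<card S. lin_solution n (A (bs ! p)) (B (bs ! p)) T u (\<lambda>t. vec n (\<lambda>i. x t $ (p * n + i))))"
proof -
  let ?D = "diag_mat_at A S" and ?V = "stack_mat m B S"
  let ?blk = "\<lambda>x p. vec n (\<lambda>i. x $ (p * n + i)) :: real vec"
  have len: "length bs = card S" unfolding bs_def by simp
  have set_bs: "set bs = S" unfolding bs_def using \<open>finite S\<close> by simp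
  have mem: "bs ! p \<in> S" if "p < card S" for p using that len set_bs by (metis nth_mem)
  have V: "?V \<in> carrier_mat (n * card S) m"
    using foldr_append_rows(1)[of bs B n m "0\<^sub>v m"] B set_bs len
    unfolding stack_mat_def bs_def[symmetric] by (simp add: mult.commute)
  have entry: "(?D *\<^sub>v x t + ?V *\<^sub>v u t) $ (p * n + i)
      = (A (bs ! p) *\<^sub>v ?blk (x t) p + B (bs ! p) *\<^sub>v u t) $ i"
    if "x t \<in> carrier_vec (n * card S)" "t \<in> {0..T}" "p < card S" "i < n" for t p i
  proof -
    have "p * n + i < Suc p * n" using that by simp
    also have "\<dots> \<le> card S * n" using that by (intro mult_le_mono1) simp
    finally have lt: "p * n + i < n * card S" by (simp add: mult.commute)
    have "(?D *\<^sub>v x t) $ (p * n + i) = (A (bs ! p) *\<^sub>v ?blk (x t) p) $ i"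
      unfolding diag_mat_at_def bs_def[symmetric]
      using that A set_bs len by (intro index_diag_block_mult_vec) (auto simp: mult.commute)
    moreover have "(?V *\<^sub>v u t) $ (p * n + i) = (B (bs ! p) *\<^sub>v u t) $ i"
      unfolding stack_mat_def bs_def[symmetric]
      using that B set_bs len u by (intro foldr_append_rows(2)) auto
    ultimately show ?thesis
      using lt V B[OF mem[OF that(3)]] that(4) by simp
  qed
  have split: "q div n < card S \<and> q mod n < n \<and> q div n * n + q mod n = q" if "q < n * card S" for q
  proof -
    have "0 < n" using that by (cases n) auto
    then show ?thesis using that by (simp add: less_mult_imp_div_less mult.commute)
  qed
  have join: "p * n + i < n * card S" if "p < card S" "i < n" for p i
  proof -
    have "p * n + i < Suc p * n" using that by simp
    also have "\<dots> \<le> card S * n" using that by (intro mult_le_mono1) simp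
    finally show ?thesis by (simp add: mult.commute)
  qed
  show ?thesis (is "?L \<longleftrightarrow> ?C \<and> ?R")
  proof
    assume L: ?L
    then have C: ?C unfolding lin_solution_def by blast
    from L obtain P where P: "finite P" and cont: "\<And>q. q < n * card S \<Longrightarrow> continuous_on {0..T} (\<lambda>t. x t $ q)"
      and der: "\<And>t q. t \<in> {0..T} - P \<Longrightarrow> q < n * card S \<Longrightarrow>
        ((\<lambda>s. x s $ q) has_real_derivative (?D *\<^sub>v x t + ?V *\<^sub>v u t) $ q) (at t within {0..T})"
      unfolding lin_solution_def by blast
    have "lin_solution n (A (bs ! p)) (B (bs ! p)) T u (\<lambda>t. ?blk (x t) p)" if p: "p < card S" for p
      unfolding lin_solution_def
    proof (intro conjI allI impI ballI exI[of _ P] P)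
      show "continuous_on {0..T} (\<lambda>t. ?blk (x t) p $ i)" if "i < n" for i
        using cont[OF join[OF p that]] that by simp
      show "((\<lambda>s. ?blk (x s) p $ i) has_real_derivative
          (A (bs ! p) *\<^sub>v ?blk (x t) p + B (bs ! p) *\<^sub>v u t) $ i) (at t within {0..T})"
        if "t \<in> {0..T} - P" "i < n" for t i
        using der[OF that(1) join[OF p that(2)]] entry[of t p i] C p that by simp
    qed simp
    then show "?C \<and> ?R" using C by blast
  next
    assume CR: "?C \<and> ?R"
    then have C: "\<And>t. t \<in> {0..T} \<Longrightarrow> x t \<in> carrier_vec (n * card S)" by blast
    have "\<forall>p\<in>{..<card S}. \<exists>P. finite P \<and> (\<forall>t\<in>{0..T} - P. \<forall>i<n. ((\<lambda>s. ?blk (x s) p $ i) has_real_derivative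
          (A (bs ! p) *\<^sub>v ?blk (x t) p + B (bs ! p) *\<^sub>v u t) $ i) (at t within {0..T}))"
      using CR unfolding lin_solution_def by blast
    from bchoice[OF this] obtain P where P: "\<forall>p\<in>{..<card S}. finite (P p) \<and>
        (\<forall>t\<in>{0..T} - P p. \<forall>i<n. ((\<lambda>s. ?blk (x s) p $ i) has_real_derivative
          (A (bs ! p) *\<^sub>v ?blk (x t) p + B (bs ! p) *\<^sub>v u t) $ i) (at t within {0..T}))" ..
    have cont: "continuous_on {0..T} (\<lambda>t. ?blk (x t) p $ i)" if "p < card S" "i < n" for p i
      using CR that unfolding lin_solution_def by blast
    show ?L
      unfolding lin_solution_def
    proof (intro conjI allI impI ballI exI[of _ "\<Union>p<card S. P p"] C)
      show "finite (\<Union>p<card S. P p)" using P by auto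
      show "continuous_on {0..T} (\<lambda>t. x t $ q)" if "q < n * card S" for q
        using cont[of "q div n" "q mod n"] split[OF that] by simp
      show "((\<lambda>s. x s $ q) has_real_derivative (?D *\<^sub>v x t + ?V *\<^sub>v u t) $ q) (at t within {0..T})"
        if t: "t \<in> {0..T} - (\<Union>p<card S. P p)" and q: "q < n * card S" for t q
      proof -
        have t': "t \<in> {0..T} - P (q div n)" "t \<in> {0..T}" using t split[OF q] by auto
        have "((\<lambda>s. ?blk (x s) (q div n) $ (q mod n)) has_real_derivative
          (A (bs ! (q div n)) *\<^sub>v ?blk (x t) (q div n) + B (bs ! (q div n)) *\<^sub>v u t) $ (q mod n)) (at t within {0..T})"
          using P t' split[OF q] by blast
        then show ?thesis using entry[OF C[OF t'(2)] t'(2), of "q div n" "q mod n"] split[OF q] by simp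
      qed
    qed
  qed
qed

text \<open>Restates controllability of the stacked system as simultaneous steering of the systems
  at the points of \<open>S\<close> by one input; from here on the enumeration of \<open>S\<close>
  is gone.\<close>

lemma controllable_stack_iff:
  fixes A B :: "real \<Rightarrow> real mat"
  assumes "finite S" and A: "\<And>\<beta>. \<beta> \<in> S \<Longrightarrow> A \<beta> \<in> carrier_mat n n"
    and B: "\<And>\<beta>. \<beta> \<in> S \<Longrightarrow> B \<beta> \<in> carrier_mat n m"
  shows "controllable (n * card S) m (diag_mat_at A S) (stack_mat m B S) \<longleftrightarrow>
    (\<forall>X0 XF. (\<forall>\<beta>\<in>S. X0 \<beta> \<in> carrier_vec n \<and> XF \<beta> \<in> carrier_vec n) \<longrightarrow>
      (\<exists>T>0. \<exists>u X. pw_const_control m T u \<and>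
        (\<forall>\<beta>\<in>S. lin_solution n (A \<beta>) (B \<beta>) T u (X \<beta>) \<and> X \<beta> 0 = X0 \<beta> \<and> X \<beta> T = XF \<beta>)))"
    (is "?L \<longleftrightarrow> ?R")
proof -
  define bs where "bs = sorted_list_of_set S"
  let ?blk = "\<lambda>x p. vec n (\<lambda>i. x $ (p * n + i)) :: real vec"
  have len: "length bs = card S" unfolding bs_def by simp
  have set_bs: "set bs = S" unfolding bs_def using \<open>finite S\<close> by simp
  have dist: "distinct bs" unfolding bs_def by simp
  have mem: "bs ! p \<in> S" if "p < card S" for p using that len set_bs by (metis nth_mem)
  have "\<forall>\<beta>\<in>S. \<exists>p. p < card S \<and> bs ! p = \<beta>" using set_bs len by (metis in_set_conv_nth)
  from bchoice[OF this] obtain idx where idx: "\<And>\<beta>. \<beta> \<in> S \<Longrightarrow> idx \<beta> < card S" "\<And>\<beta>. \<beta> \<in> S \<Longrightarrow> bs ! idx \<beta> = \<beta>"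
    by metis
  have idx_nth: "idx (bs ! p) = p" if "p < card S" for p
    using idx[OF mem[OF that]] that dist len by (metis nth_eq_iff_index_eq)
  define flat where "flat f = vec (n * card S) (\<lambda>q. f (bs ! (q div n)) $ (q mod n))" for f :: "real \<Rightarrow> real vec"
  have join: "p * n + i < n * card S" if "p < card S" "i < n" for p i
  proof -
    have "p * n + i < Suc p * n" using that by simp
    also have "\<dots> \<le> card S * n" using that by (intro mult_le_mono1) simp
    finally show ?thesis by (simp add: mult.commute)
  qed
  have blk_flat: "?blk (flat f) p = f (bs ! p)" if "p < card S" "f (bs ! p) \<in> carrier_vec n" for f p
    using that by (intro eq_vecI) (auto simp: flat_def join)
  have flat_blk: "flat (\<lambda>\<beta>. ?blk x (idx \<beta>)) = x" if "x \<in> carrier_vec (n * card S)" for x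
  proof (rule eq_vecI)
    fix q assume "q < dim_vec x"
    then have q: "q < n * card S" using that by simp
    then have "0 < n" by (metis gr_zeroI mult_zero_left not_less_zero)
    moreover have "q div n < card S" using q by (simp add: less_mult_imp_div_less mult.commute)
    ultimately show "flat (\<lambda>\<beta>. ?blk x (idx \<beta>)) $ q = x $ q" using q by (simp add: flat_def idx_nth)
  qed (use that in \<open>simp add: flat_def\<close>)
  note stack = lin_solution_stack[of S A n B m, OF \<open>finite S\<close> A B, folded bs_def]
  have u_carrier: "u t \<in> carrier_vec m" if "pw_const_control m T u" "t \<in> {0..T}" for u T t
    using that unfolding pw_const_control_def by blast
  show ?thesis
  proof
    assume L: ?L
    show ?R
    proof (intro allI impI)
      fix X0 XF :: "real \<Rightarrow> real vec" assume X: "\<forall>\<beta>\<in>S. X0 \<beta> \<in> carrier_vec n \<and> XF \<beta> \<in> carrier_vec n"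
      have "flat X0 \<in> carrier_vec (n * card S)" "flat XF \<in> carrier_vec (n * card S)" by (simp_all add: flat_def)
      then obtain T u x where T: "T > 0" and u: "pw_const_control m T u"
        and x: "lin_solution (n * card S) (diag_mat_at A S) (stack_mat m B S) T u x" "x 0 = flat X0" "x T = flat XF"
        using L unfolding controllable_def by blast
      have "\<forall>p<card S. lin_solution n (A (bs ! p)) (B (bs ! p)) T u (\<lambda>t. ?blk (x t) p)"
        using x(1) stack[where T = T and u = u and x = x, OF _ _ u_carrier[OF u]] by blast
      note blocks = this[rule_format]
      have "lin_solution n (A \<beta>) (B \<beta>) T u (\<lambda>t. ?blk (x t) (idx \<beta>))" if "\<beta> \<in> S" for \<beta>
        using blocks[OF idx(1)[OF that]] unfolding idx(2)[OF that] .
      moreover have "?blk (x 0) (idx \<beta>) = X0 \<beta>" "?blk (x T) (idx \<beta>) = XF \<beta>" if "\<beta> \<in> S" for \<beta>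
        using blk_flat[of "idx \<beta>" X0] blk_flat[of "idx \<beta>" XF] idx[OF that] X that x by auto
      ultimately show "\<exists>T>0. \<exists>u X. pw_const_control m T u \<and>
        (\<forall>\<beta>\<in>S. lin_solution n (A \<beta>) (B \<beta>) T u (X \<beta>) \<and> X \<beta> 0 = X0 \<beta> \<and> X \<beta> T = XF \<beta>)"
        using T u by (intro exI[of _ T] conjI exI[of _ u] exI[of _ "\<lambda>\<beta> t. ?blk (x t) (idx \<beta>)"]) auto
    qed
  next
    assume R: ?R
    show ?L
      unfolding controllable_def
    proof (intro ballI)
      fix x0 xF :: "real vec" assume x0: "x0 \<in> carrier_vec (n * card S)" and xF: "xF \<in> carrier_vec (n * card S)"
      have "\<forall>\<beta>\<in>S. ?blk x0 (idx \<beta>) \<in> carrier_vec n \<and> ?blk xF (idx \<beta>) \<in> carrier_vec n" by simp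
      from R[THEN spec, THEN spec, THEN mp, OF this]
      obtain T u X where T: "T > 0" and u: "pw_const_control m T u"
        and X_all: "\<forall>\<beta>\<in>S. lin_solution n (A \<beta>) (B \<beta>) T u (X \<beta>) \<and>
          X \<beta> 0 = ?blk x0 (idx \<beta>) \<and> X \<beta> T = ?blk xF (idx \<beta>)"
        by (elim exE conjE) (rule that)
      have X: "\<And>\<beta>. \<beta> \<in> S \<Longrightarrow> lin_solution n (A \<beta>) (B \<beta>) T u (X \<beta>)"
          "\<And>\<beta>. \<beta> \<in> S \<Longrightarrow> X \<beta> 0 = ?blk x0 (idx \<beta>)" "\<And>\<beta>. \<beta> \<in> S \<Longrightarrow> X \<beta> T = ?blk xF (idx \<beta>)"
        using X_all by simp_all
      define x where "x t = flat (\<lambda>\<beta>. X \<beta> t)" for t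
      have X_carrier: "X \<beta> t \<in> carrier_vec n" if "\<beta> \<in> S" "t \<in> {0..T}" for \<beta> t
        using X(1)[OF that(1)] that(2) unfolding lin_solution_def by blast
      have "lin_solution n (A (bs ! p)) (B (bs ! p)) T u (\<lambda>t. ?blk (x t) p)" if p: "p < card S" for p
      proof (rule lin_solution_cong[OF _ X(1)[OF mem[OF p]]])
        show "X (bs ! p) t = ?blk (x t) p" if "t \<in> {0..T}" for t
          unfolding x_def using blk_flat[OF p, of "\<lambda>\<beta>. X \<beta> t"] X_carrier[OF mem[OF p] that] by simp
      qed
      moreover have "x t \<in> carrier_vec (n * card S)" for t by (simp add: x_def flat_def)
      ultimately have sol: "lin_solution (n * card S) (diag_mat_at A S) (stack_mat m B S) T u x"
        using stack[where T = T and u = u, OF _ _ u_carrier[OF u]] by blast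
      have flat_cong: "flat f = flat g" if "\<And>\<beta>. \<beta> \<in> S \<Longrightarrow> f \<beta> = g \<beta>" for f g
        unfolding flat_def
      proof (rule eq_vecI)
        fix q assume "q < dim_vec (vec (n * card S) (\<lambda>q. g (bs ! (q div n)) $ (q mod n)))"
        then have q: "q < n * card S" by simp
        then have "q div n < card S" by (simp add: less_mult_imp_div_less mult.commute)
        then show "vec (n * card S) (\<lambda>q. f (bs ! (q div n)) $ (q mod n)) $ q
            = vec (n * card S) (\<lambda>q. g (bs ! (q div n)) $ (q mod n)) $ q"
          using q that[OF mem] by simp
      qed simp
      have "x 0 = x0" unfolding x_def using flat_cong[OF X(2)] flat_blk[OF x0] by (rule trans)
      moreover have "x T = xF" unfolding x_def using flat_cong[OF X(3)] flat_blk[OF xF] by (rule trans)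
      ultimately show "\<exists>T>0. \<exists>u x. pw_const_control m T u \<and>
          lin_solution (n * card S) (diag_mat_at A S) (stack_mat m B S) T u x \<and> x 0 = x0 \<and> x T = xF"
        using T u sol by blast
    qed
  qed
qed

subsection \<open>The ensemble as a family of scalar systems\<close>

text \<open>The slices over the finitely many indices are closed, so continuity on each of them
  pastes together.\<close>

lemma continuous_on_times_finite:
  fixes K :: "real set" and J :: "nat set"
  assumes "closed K" "finite J" "\<And>j. j \<in> J \<Longrightarrow> continuous_on K (\<lambda>\<beta>. f (\<beta>, j))"
  shows "continuous_on (K \<times> J) f"
proof -
  have "continuous_on (\<Union>j\<in>J. K \<times> {j}) f"
  proof (rule continuous_on_closed_Union[OF assms(2)])
    fix j assume j: "j \<in> J"
    show "closed (K \<times> {j})" using assms(1) by (intro closed_Times closed_singleton)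
    have "continuous_on (K \<times> {j}) (\<lambda>x. f (fst x, j))"
      by (rule continuous_on_compose2[OF assms(3)[OF j] continuous_on_fst[OF continuous_on_id]]) auto
    then show "continuous_on (K \<times> {j}) f" by (rule continuous_on_eq) auto
  qed
  moreover have "(\<Union>j\<in>J. K \<times> {j}) = K \<times> J" by auto
  ultimately show ?thesis by simp
qed

locale modal_ensemble =
  fixes K :: "real set" and r l m :: nat and lam alpha omega :: "nat \<Rightarrow> real \<Rightarrow> real"
    and B :: "real \<Rightarrow> real mat"
  assumes compact_K: "compact K"
    and lam_cont: "\<And>j. j < r \<Longrightarrow> continuous_on K (lam j)"
    and alpha_cont: "\<And>j. j < l \<Longrightarrow> continuous_on K (alpha j)"
    and omega_cont: "\<And>j. j < l \<Longrightarrow> continuous_on K (omega j)"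
    and B_cont: "cont_mat_fun K (r + 2 * l) m B"
begin

abbreviation n :: nat where "n \<equiv> r + 2 * l"
abbreviation A :: "real \<Rightarrow> real mat" where "A \<equiv> A_mat r l lam alpha omega"
abbreviation \<mu> :: "real \<times> nat \<Rightarrow> complex" where "\<mu> \<equiv> modal_eig r lam alpha omega"
abbreviation \<Omega> :: "real set \<Rightarrow> (real \<times> nat) set" where "\<Omega> S \<equiv> S \<times> {..<r + l}"

definition b :: "real \<times> nat \<Rightarrow> nat \<Rightarrow> complex" where
  "b = (\<lambda>(\<beta>, j) i. to_modal r (col (B \<beta>) i) j)"

lemma B_carrier: "\<beta> \<in> K \<Longrightarrow> B \<beta> \<in> carrier_mat n m"
  using B_cont by (simp add: cont_mat_fun_def)

lemma continuous_on_to_modal: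
  assumes "\<And>i. i < n \<Longrightarrow> continuous_on K (\<lambda>\<beta>. f \<beta> $ i)"
  shows "continuous_on (\<Omega> K) (\<lambda>x. to_modal r (f (fst x)) (snd x))"
proof (rule continuous_on_times_finite)
  fix j assume j: "j \<in> {..<r + l}"
  show "continuous_on K (\<lambda>\<beta>. to_modal r (f (fst (\<beta>, j))) (snd (\<beta>, j)))"
  proof (cases "j < r")
    case True
    then show ?thesis unfolding to_modal_def fst_conv snd_conv if_P[OF True]
      by (intro continuous_on_of_real assms) simp
  next
    case False
    then have "r + 2 * (j - r) + 1 < n" using j by auto
    then show ?thesis unfolding to_modal_def fst_conv snd_conv if_not_P[OF False] Complex_eq
      by (intro continuous_on_add continuous_on_mult continuous_on_const continuous_on_of_real assms) simp_all
  qed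
qed (use compact_K in \<open>auto intro: compact_imp_closed\<close>)

lemma continuous_on_mu: "continuous_on (\<Omega> K) \<mu>"
proof (rule continuous_on_times_finite)
  fix j assume j: "j \<in> {..<r + l}"
  show "continuous_on K (\<lambda>\<beta>. \<mu> (\<beta>, j))"
  proof (cases "j < r")
    case True
    then show ?thesis unfolding modal_eig_def prod.case if_P[OF True]
      by (intro continuous_on_of_real lam_cont)
  next
    case False
    then have "j - r < l" using j by auto
    then show ?thesis unfolding modal_eig_def prod.case if_not_P[OF False] eig_plus_def
      by (intro continuous_on_add continuous_on_mult continuous_on_const continuous_on_of_real alpha_cont omega_cont)
  qed
qed (use compact_K in \<open>auto intro: compact_imp_closed\<close>)

lemma continuous_on_b:
  assumes "i < m"
  shows "continuous_on (\<Omega> K) (\<lambda>x. b x i)"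
proof -
  have "continuous_on K (\<lambda>\<beta>. col (B \<beta>) i $ k)" if "k < n" for k
  proof -
    have "continuous_on K (\<lambda>\<beta>. B \<beta> $$ (k, i))" using B_cont assms that by (simp add: cont_mat_fun_def)
    then show ?thesis
    proof (rule continuous_on_eq)
      show "B \<beta> $$ (k, i) = col (B \<beta>) i $ k" if "\<beta> \<in> K" for \<beta>
        using B_carrier[OF that] assms \<open>k < n\<close> by simp
    qed
  qed
  from continuous_on_to_modal[OF this] show ?thesis by (simp add: b_def case_prod_unfold)
qed

lemma cont_vec_fun_of_modal:
  assumes "\<And>j. j < r + l \<Longrightarrow> continuous_on K (\<lambda>\<beta>. c \<beta> j)"
  shows "cont_vec_fun K n (\<lambda>\<beta>. of_modal r n (c \<beta>))"
  unfolding cont_vec_fun_def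
proof (intro conjI ballI allI impI of_modal_carrier)
  fix i assume i: "i < n"
  have *: "continuous_on K (\<lambda>\<beta>. Re (c \<beta> j))" "continuous_on K (\<lambda>\<beta>. Im (c \<beta> j))" if "j < r + l" for j
    using assms[OF that] by (auto intro: continuous_on_Re continuous_on_Im)
  show "continuous_on K (\<lambda>\<beta>. of_modal r n (c \<beta>) $ i)"
  proof (cases "i < r")
    case True
    then show ?thesis using i *(1)[of i] by (simp add: of_modal_def)
  next
    case False
    then have "r + (i - r) div 2 < r + l" using i by auto
    then show ?thesis using False i *[of "r + (i - r) div 2"]
      by (cases "even (i - r)") (simp_all add: of_modal_def)
  qed
qed

lemma continuous_on_slice:
  assumes "continuous_on (\<Omega> K) f" "j < r + l"
  shows "continuous_on K (\<lambda>\<beta>. f (\<beta>, j))"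
  by (rule continuous_on_compose2[OF assms(1)]) (use assms(2) in \<open>auto intro!: continuous_intros\<close>)

lemma bounded_mu_b:
  shows "bounded (\<mu> ` \<Omega> K)" "j < m \<Longrightarrow> bounded ((\<lambda>x. b x j) ` \<Omega> K)"
proof -
  have "compact (\<Omega> K)" using compact_K by (intro compact_Times) (auto intro: finite_imp_compact)
  then show "bounded (\<mu> ` \<Omega> K)" "j < m \<Longrightarrow> bounded ((\<lambda>x. b x j) ` \<Omega> K)"
    by (intro compact_imp_bounded compact_continuous_image continuous_on_mu continuous_on_b; simp)+
qed

lemma lin_solution_iff:
  assumes "\<beta> \<in> K" "pw_const_control m T u"
  shows "lin_solution n (A \<beta>) (B \<beta>) T u x \<longleftrightarrow> (\<forall>t\<in>{0..T}. x t \<in> carrier_vec n) \<and>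
    (\<forall>j<r + l. scalar_solution m T (\<mu> (\<beta>, j)) (b (\<beta>, j)) (\<lambda>t i. u t $ i) (\<lambda>t. to_modal r (x t) j))"
  using lin_solution_modal[OF B_carrier[OF assms(1)], of T u] assms(2)
  by (simp add: b_def pw_const_control_def)

text \<open>Free motion plus the forced motion of \<open>steps_reachable\<close>, converted back to
  real vectors. Continuity in the parameter is conditional on that of \<open>X0\<close>, so that the
  lemma also serves initial data prescribed on a finite set only.\<close>

lemma steer:
  assumes f: "f \<in> real_span (step_gens \<mu> b m)" and X0: "\<And>\<beta>. \<beta> \<in> K \<Longrightarrow> X0 \<beta> \<in> carrier_vec n"
  obtains u X where "pw_const_control m 1 u"
    and "\<And>\<beta>. \<beta> \<in> K \<Longrightarrow> lin_solution n (A \<beta>) (B \<beta>) 1 u (X \<beta>)"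
    and "\<And>\<beta>. \<beta> \<in> K \<Longrightarrow> X \<beta> 0 = X0 \<beta>"
    and "\<And>\<beta> t. X \<beta> t \<in> carrier_vec n"
    and "\<And>\<beta> j. j < r + l \<Longrightarrow> to_modal r (X \<beta> 1) j = exp (\<mu> (\<beta>, j)) * to_modal r (X0 \<beta>) j + f (\<beta>, j)"
    and "\<And>t. cont_vec_fun K n X0 \<Longrightarrow> cont_vec_fun K n (\<lambda>\<beta>. X \<beta> t)"
proof -
  from steps_reachable[OF f] obtain u y where
    P: "\<exists>P. finite P \<and> (\<forall>s t. 0 \<le> s \<and> s \<le> t \<and> t \<le> 1 \<and> {s..t} \<inter> P = {} \<longrightarrow> u s = u t)" and
    y: "\<forall>x. scalar_solution m 1 (\<mu> x) (b x) u (y x) \<and> y x 0 = 0 \<and> y x 1 = f x" and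
    cont: "\<forall>X t. continuous_on X \<mu> \<and> (\<forall>j<m. continuous_on X (\<lambda>x. b x j)) \<longrightarrow> continuous_on X (\<lambda>x. y x t)" and
    re: "\<forall>x t. \<mu> x \<in> \<real> \<and> (\<forall>j<m. b x j \<in> \<real>) \<longrightarrow> y x t \<in> \<real>"
    by (elim exE) (erule conjE, erule conjE, erule conjE, rule that)
  define U where "U t = vec m (u t)" for t
  define c where "c \<beta> t j = exp (complex_of_real t * \<mu> (\<beta>, j)) * to_modal r (X0 \<beta>) j + y (\<beta>, j) t" for \<beta> t j
  define X where "X \<beta> t = of_modal r n (c \<beta> t)" for \<beta> t
  \<comment> \<open>Without this, \<open>of_modal\<close> would lose the imaginary part of a real
    mode.\<close>
  have c_real: "c \<beta> t j \<in> \<real>" if "j < r" for \<beta> t j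
  proof -
    have mu: "\<mu> (\<beta>, j) \<in> \<real>" using modal_eig_in_Reals[OF that] .
    then have "exp (complex_of_real t * \<mu> (\<beta>, j)) \<in> \<real>"
      by (auto elim!: Reals_cases simp: exp_of_real simp flip: of_real_mult)
    moreover have "b (\<beta>, j) i \<in> \<real>" for i using to_modal_in_Reals[OF that] by (simp add: b_def)
    then have "y (\<beta>, j) t \<in> \<real>" using re mu by blast
    ultimately show ?thesis unfolding c_def by (intro Reals_add Reals_mult to_modal_in_Reals[OF that])
  qed
  have X_modal: "to_modal r (X \<beta> t) j = c \<beta> t j" if "j < r + l" for \<beta> t j
    unfolding X_def using to_modal_of_modal[OF that] c_real by blast
  have U: "pw_const_control m 1 U"
  proof -
    from P obtain P' where "finite P'" "\<forall>s t. 0 \<le> s \<and> s \<le> t \<and> t \<le> 1 \<and> {s..t} \<inter> P' = {} \<longrightarrow> u s = u t" by blast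
    then show ?thesis unfolding pw_const_control_def U_def by (intro conjI exI[of _ P']) auto
  qed
  show ?thesis
  proof (rule that[of U X])
    show "pw_const_control m 1 U" by (rule U)
    show X_carrier: "X \<beta> t \<in> carrier_vec n" for \<beta> t by (simp add: X_def)
    show "lin_solution n (A \<beta>) (B \<beta>) 1 U (X \<beta>)" if "\<beta> \<in> K" for \<beta>
      unfolding lin_solution_iff[OF that U]
    proof (intro conjI ballI X_carrier allI impI)
      fix j assume j: "j < r + l"
      have "scalar_solution m 1 (\<mu> (\<beta>, j)) (b (\<beta>, j)) (\<lambda>t i. 0 + u t i)
          (\<lambda>t. exp (complex_of_real t * \<mu> (\<beta>, j)) * to_modal r (X0 \<beta>) j + y (\<beta>, j) t)"
        using y by (intro scalar_solution_add scalar_solution_free) blast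
      then show "scalar_solution m 1 (\<mu> (\<beta>, j)) (b (\<beta>, j)) (\<lambda>t i. U t $ i) (\<lambda>t. to_modal r (X \<beta> t) j)"
        unfolding scalar_solution_def X_modal[OF j] c_def by (simp add: U_def)
    qed
    show "X \<beta> 0 = X0 \<beta>" if "\<beta> \<in> K" for \<beta>
    proof (rule to_modal_inject[OF X_carrier X0[OF that]])
      show "to_modal r (X \<beta> 0) j = to_modal r (X0 \<beta>) j" if "j < r + l" for j
        unfolding X_modal[OF that] c_def using y by simp
    qed
    show "to_modal r (X \<beta> 1) j = exp (\<mu> (\<beta>, j)) * to_modal r (X0 \<beta>) j + f (\<beta>, j)" if "j < r + l" for \<beta> j
      unfolding X_modal[OF that] c_def using y by simp
    show "cont_vec_fun K n (\<lambda>\<beta>. X \<beta> t)" if "cont_vec_fun K n X0" for t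
      unfolding X_def
    proof (rule cont_vec_fun_of_modal)
      fix j assume j: "j < r + l"
      have "continuous_on (\<Omega> K) (\<lambda>x. to_modal r (X0 (fst x)) (snd x))"
        using that by (intro continuous_on_to_modal) (simp add: cont_vec_fun_def)
      from continuous_on_slice[OF this j] have "continuous_on K (\<lambda>\<beta>. to_modal r (X0 \<beta>) j)" by simp
      moreover have "continuous_on (\<Omega> K) (\<lambda>x. y x t)"
        using cont continuous_on_mu continuous_on_b by simp
      from continuous_on_slice[OF this j] have "continuous_on K (\<lambda>\<beta>. y (\<beta>, j) t)" .
      ultimately show "continuous_on K (\<lambda>\<beta>. c \<beta> t j)"
        unfolding c_def using continuous_on_slice[OF continuous_on_mu j]
        by (intro continuous_on_add continuous_on_mult continuous_on_exp continuous_on_const)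
    qed
  qed
qed

section \<open>Density, interpolation and reachability\<close>

lemma unif_of_dense:
  assumes "norm_on n N"
    and dense: "\<And>V e. cont_vec_fun K n V \<Longrightarrow> 0 < e \<Longrightarrow>
      \<exists>h\<in>real_span (krylov_gens \<mu> b m). \<forall>x\<in>\<Omega> K. cmod (h x - to_modal r (V (fst x)) (snd x)) < e"
  shows "unif_ensemble_controllable N K n m A B"
  unfolding unif_ensemble_controllable_def
proof (intro allI impI, elim conjE)
  fix \<epsilon> :: real and X0 XF :: "real \<Rightarrow> real vec"
  assume "0 < \<epsilon>" and X0: "cont_vec_fun K n X0" and XF: "cont_vec_fun K n XF"
  obtain C where C: "0 < C" "\<And>v. v \<in> carrier_vec n \<Longrightarrow> N v \<le> C * (\<Sum>i<n. \<bar>v $ i\<bar>)"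
    using norm_on_upper[OF assms(1)] by blast
  \<comment> \<open>Two approximations of accuracy \<open>e\<close> leave every coordinate within
    \<open>2 * e\<close>; summing \<open>n\<close> of them and multiplying by \<open>C\<close> gives
    at most \<epsilon> / 2.\<close>
  define e where "e = \<epsilon> / (4 * C * (real n + 1))"
  have e: "0 < e" using \<open>0 < \<epsilon>\<close> C by (simp add: e_def)
  \<comment> \<open>The target minus the free motion at time 1, which the forced motion has to
    supply.\<close>
  define c where "c \<beta> j = to_modal r (XF \<beta>) j - exp (\<mu> (\<beta>, j)) * to_modal r (X0 \<beta>) j" for \<beta> j
  define V where "V \<beta> = of_modal r n (c \<beta>)" for \<beta>
  have X0_carrier: "X0 \<beta> \<in> carrier_vec n" and XF_carrier: "XF \<beta> \<in> carrier_vec n" if "\<beta> \<in> K" for \<beta>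
    using X0 XF that by (auto simp: cont_vec_fun_def)
  have cont_modal: "continuous_on K (\<lambda>\<beta>. to_modal r (F \<beta>) j)" if "cont_vec_fun K n F" "j < r + l" for F j
  proof -
    have "continuous_on (\<Omega> K) (\<lambda>x. to_modal r (F (fst x)) (snd x))"
      using that by (intro continuous_on_to_modal) (simp add: cont_vec_fun_def)
    from continuous_on_slice[OF this that(2)] show ?thesis by simp
  qed
  have "cont_vec_fun K n V"
    unfolding V_def
  proof (rule cont_vec_fun_of_modal)
    fix j assume j: "j < r + l"
    show "continuous_on K (\<lambda>\<beta>. c \<beta> j)"
      unfolding c_def using cont_modal[OF X0 j] cont_modal[OF XF j] continuous_on_slice[OF continuous_on_mu j]
      by (intro continuous_on_diff continuous_on_mult continuous_on_exp)
  qed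
  from dense[OF this e] obtain h where h: "h \<in> real_span (krylov_gens \<mu> b m)"
    "\<forall>x\<in>\<Omega> K. cmod (h x - to_modal r (V (fst x)) (snd x)) < e" ..
  from krylov_approx[OF h(1) e bounded_mu_b] obtain f where f: "f \<in> real_span (step_gens \<mu> b m)"
    "\<forall>x\<in>\<Omega> K. cmod (f x - h x) < e" ..
  have V_modal: "to_modal r (V \<beta>) j = c \<beta> j" if "j < r + l" for \<beta> j
  proof -
    have "c \<beta> j \<in> \<real>" if "j < r"
      using to_modal_in_Reals[OF that] modal_eig_in_Reals[OF that] unfolding c_def
      by (intro Reals_diff Reals_mult) (auto simp: exp_of_real elim!: Reals_cases[of "\<mu> _"])
    then show ?thesis unfolding V_def using to_modal_of_modal[OF that] by blast
  qed
  obtain u X where u: "pw_const_control m 1 u"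
    and sol: "\<And>\<beta>. \<beta> \<in> K \<Longrightarrow> lin_solution n (A \<beta>) (B \<beta>) 1 u (X \<beta>)"
    and init: "\<And>\<beta>. \<beta> \<in> K \<Longrightarrow> X \<beta> 0 = X0 \<beta>"
    and X_carrier: "\<And>\<beta> t. X \<beta> t \<in> carrier_vec n"
    and final: "\<And>\<beta> j. j < r + l \<Longrightarrow> to_modal r (X \<beta> 1) j = exp (\<mu> (\<beta>, j)) * to_modal r (X0 \<beta>) j + f (\<beta>, j)"
    and cont_X: "\<And>t. cont_vec_fun K n X0 \<Longrightarrow> cont_vec_fun K n (\<lambda>\<beta>. X \<beta> t)"
    by (rule steer[where ?X0.0 = X0, OF f(1)], erule X0_carrier, rule that)
  have "N (X \<beta> 1 - XF \<beta>) \<le> \<epsilon> / 2" if \<beta>: "\<beta> \<in> K" for \<beta>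
  proof -
    let ?d = "X \<beta> 1 - XF \<beta>"
    have d: "?d \<in> carrier_vec n" using X_carrier XF_carrier[OF \<beta>] by simp
    have "cmod (to_modal r ?d j) \<le> 2 * e" if j: "j < r + l" for j
    proof -
      have "to_modal r ?d j = (f (\<beta>, j) - h (\<beta>, j)) + (h (\<beta>, j) - to_modal r (V \<beta>) j)"
        unfolding to_modal_diff[OF X_carrier XF_carrier[OF \<beta>] j] final[OF j] V_modal[OF j] c_def by simp
      then have "cmod (to_modal r ?d j) \<le> cmod (f (\<beta>, j) - h (\<beta>, j)) + cmod (h (\<beta>, j) - to_modal r (V \<beta>) j)"
        by (simp only: norm_triangle_ineq)
      moreover have "(\<beta>, j) \<in> \<Omega> K" using \<beta> j by simp
      then have "cmod (f (\<beta>, j) - h (\<beta>, j)) < e" "cmod (h (\<beta>, j) - to_modal r (V \<beta>) j) < e"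
        using h(2) f(2) by force+
      ultimately show ?thesis by linarith
    qed
    then have "\<bar>?d $ i\<bar> \<le> 2 * e" if "i < n" for i
      using abs_of_modal_le[of r l "to_modal r ?d" "2 * e" i] that of_modal_to_modal[OF d] by simp
    then have "(\<Sum>i<n. \<bar>?d $ i\<bar>) \<le> real n * (2 * e)"
      using sum_bounded_above[of "{..<n}" "\<lambda>i. \<bar>?d $ i\<bar>" "2 * e"] by simp
    then have "N ?d \<le> C * (real n * (2 * e))"
      using C(2)[OF d] C(1) by (meson mult_left_mono less_imp_le order_trans)
    also have "\<dots> \<le> C * ((real n + 1) * (2 * e))" using C e by (intro mult_left_mono mult_right_mono) auto
    also have "\<dots> = \<epsilon> / 2"
    proof -
      have "C * (k * (2 * (\<epsilon> / (4 * C * k)))) = \<epsilon> / 2" if "0 < k" for k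
        using that C(1) by simp
      from this[of "real n + 1"] show ?thesis unfolding e_def by simp
    qed
    finally show ?thesis .
  qed
  \<comment> \<open>A supremum preserves only non-strict bounds, hence the margin \<epsilon> / 2.
    The bound covers empty \<open>K\<close> as well.\<close>
  then have "(SUP \<beta>\<in>K. ereal (N (X \<beta> 1 - XF \<beta>))) \<le> ereal (\<epsilon> / 2)" by (intro SUP_least) simp
  also have "\<dots> < ereal \<epsilon>" using \<open>0 < \<epsilon>\<close> by simp
  finally show "\<exists>T>0. \<exists>u X. pw_const_control m T u \<and> (\<forall>t\<in>{0..T}. cont_vec_fun K n (X t)) \<and>
      (\<forall>\<beta>\<in>K. lin_solution n (A \<beta>) (B \<beta>) T u (\<lambda>t. X t \<beta>)) \<and> (\<forall>\<beta>\<in>K. X 0 \<beta> = X0 \<beta>) \<and>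
      (SUP \<beta>\<in>K. ereal (N (X T \<beta> - XF \<beta>))) < ereal \<epsilon>"
    using u sol init cont_X[OF X0]
    by (intro exI[of _ 1] conjI exI[of _ u] exI[of _ "\<lambda>t \<beta>. X \<beta> t"]) auto
qed

text \<open>On a finite set the span of the step responses is a finite-dimensional subspace, so
  approximating a target arbitrarily well means hitting it. Closedness is expressed by a functional
  \<open>w\<close>: if the target were missed, \<open>w\<close> would vanish on the span but not on
  the target, contradicting \<open>krylov_approx\<close>.\<close>

lemma exact_of_full:
  assumes "finite S" "S \<subseteq> K"
    and full: "\<And>V. (\<forall>\<beta>\<in>S. V \<beta> \<in> carrier_vec n) \<Longrightarrow>
      \<exists>h\<in>real_span (krylov_gens \<mu> b m). \<forall>x\<in>\<Omega> S. h x = to_modal r (V (fst x)) (snd x)"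
    and X0: "\<And>\<beta>. \<beta> \<in> S \<Longrightarrow> X0 \<beta> \<in> carrier_vec n" and XF: "\<And>\<beta>. \<beta> \<in> S \<Longrightarrow> XF \<beta> \<in> carrier_vec n"
  shows "\<exists>T>0. \<exists>u X. pw_const_control m T u \<and>
    (\<forall>\<beta>\<in>S. lin_solution n (A \<beta>) (B \<beta>) T u (X \<beta>) \<and> X \<beta> 0 = X0 \<beta> \<and> X \<beta> T = XF \<beta>)"
proof -
  define c where "c \<beta> j = to_modal r (XF \<beta>) j - exp (\<mu> (\<beta>, j)) * to_modal r (X0 \<beta>) j" for \<beta> j
  define V where "V \<beta> = of_modal r n (c \<beta>)" for \<beta>
  have V_modal: "to_modal r (V \<beta>) j = c \<beta> j" if "j < r + l" for \<beta> j
  proof -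
    have "c \<beta> j \<in> \<real>" if "j < r"
      using to_modal_in_Reals[OF that] modal_eig_in_Reals[OF that] unfolding c_def
      by (intro Reals_diff Reals_mult) (auto simp: exp_of_real elim!: Reals_cases[of "\<mu> _"])
    then show ?thesis unfolding V_def using to_modal_of_modal[OF that] by blast
  qed
  let ?V = "\<lambda>x. to_modal r (V (fst x)) (snd x)"
  have fin: "finite (\<Omega> S)" using assms(1) by simp
  have "\<forall>\<beta>\<in>S. V \<beta> \<in> carrier_vec n" by (simp add: V_def)
  from full[OF this] obtain h where h: "h \<in> real_span (krylov_gens \<mu> b m)" "\<forall>x\<in>\<Omega> S. h x = ?V x" ..
  have "\<exists>f\<in>real_span (step_gens \<mu> b m). \<forall>x\<in>\<Omega> S. f x = ?V x"
  proof (rule ccontr)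
    assume neg: "\<not> (\<exists>f\<in>real_span (step_gens \<mu> b m). \<forall>x\<in>\<Omega> S. f x = ?V x)"
    obtain w where w: "\<And>f. f \<in> real_span (step_gens \<mu> b m) \<Longrightarrow> Re (\<Sum>x\<in>\<Omega> S. w x * f x) = 0"
      and w_V: "Re (\<Sum>x\<in>\<Omega> S. w x * ?V x) \<noteq> 0"
      using finite_separation[OF fin neg] by blast
    define d where "d = \<bar>Re (\<Sum>x\<in>\<Omega> S. w x * ?V x)\<bar>"
    define W where "W = (\<Sum>x\<in>\<Omega> S. cmod (w x))"
    have "0 < d" using w_V by (simp add: d_def)
    have "0 \<le> W" by (simp add: W_def sum_nonneg)
    define e where "e = d / (W + 1)"
    have e: "0 < e" using \<open>0 < d\<close> \<open>0 \<le> W\<close> by (simp add: e_def)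
    have "bounded (\<mu> ` \<Omega> S)" "\<And>j. j < m \<Longrightarrow> bounded ((\<lambda>x. b x j) ` \<Omega> S)"
      using fin by (auto intro!: finite_imp_bounded)
    from krylov_approx[OF h(1) e this] obtain f where f: "f \<in> real_span (step_gens \<mu> b m)"
      "\<forall>x\<in>\<Omega> S. cmod (f x - h x) < e" ..
    have "(\<Sum>x\<in>\<Omega> S. w x * (f x - ?V x)) = (\<Sum>x\<in>\<Omega> S. w x * f x) - (\<Sum>x\<in>\<Omega> S. w x * ?V x)"
      by (simp only: right_diff_distrib sum_subtractf)
    then have "d = \<bar>Re (\<Sum>x\<in>\<Omega> S. w x * (f x - ?V x))\<bar>" unfolding d_def using w[OF f(1)] by simp
    also have "\<dots> \<le> cmod (\<Sum>x\<in>\<Omega> S. w x * (f x - ?V x))" by (rule abs_Re_le_cmod)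
    also have "\<dots> \<le> (\<Sum>x\<in>\<Omega> S. cmod (w x) * e)"
    proof (rule sum_norm_le)
      fix x assume x: "x \<in> \<Omega> S"
      have "cmod (f x - ?V x) \<le> e" using bspec[OF f(2) x] bspec[OF h(2) x] by simp
      then show "cmod (w x * (f x - ?V x)) \<le> cmod (w x) * e"
        unfolding norm_mult by (intro mult_left_mono) auto
    qed
    also have "\<dots> = W * e" by (simp add: W_def sum_distrib_right)
    also have "\<dots> < d" using \<open>0 < d\<close> \<open>0 \<le> W\<close> by (simp add: e_def field_simps)
    finally show False by simp
  qed
  then obtain f where f: "f \<in> real_span (step_gens \<mu> b m)" "\<forall>x\<in>\<Omega> S. f x = ?V x" ..
  \<comment> \<open>\<open>steer\<close> expects initial states on all of \<open>K\<close>; zero is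
    a placeholder off \<open>S\<close>.\<close>
  define X0' where "X0' \<beta> = (if \<beta> \<in> S then X0 \<beta> else 0\<^sub>v n)" for \<beta>
  have X0': "X0' \<beta> \<in> carrier_vec n" for \<beta> using X0 by (simp add: X0'_def)
  obtain u X where u: "pw_const_control m 1 u"
    and sol: "\<And>\<beta>. \<beta> \<in> K \<Longrightarrow> lin_solution n (A \<beta>) (B \<beta>) 1 u (X \<beta>)"
    and init: "\<And>\<beta>. \<beta> \<in> K \<Longrightarrow> X \<beta> 0 = X0' \<beta>"
    and X_carrier: "\<And>\<beta> t. X \<beta> t \<in> carrier_vec n"
    and final: "\<And>\<beta> j. j < r + l \<Longrightarrow> to_modal r (X \<beta> 1) j = exp (\<mu> (\<beta>, j)) * to_modal r (X0' \<beta>) j + f (\<beta>, j)"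
    by (rule steer[where ?X0.0 = X0', OF f(1) X0']) (rule that)
  have "X \<beta> 1 = XF \<beta>" if \<beta>: "\<beta> \<in> S" for \<beta>
  proof (rule to_modal_inject[OF X_carrier XF[OF \<beta>]])
    fix j assume j: "j < r + l"
    have "f (\<beta>, j) = c \<beta> j" using f(2) V_modal[OF j] \<beta> j by simp
    then show "to_modal r (X \<beta> 1) j = to_modal r (XF \<beta>) j"
      unfolding final[OF j] c_def using \<beta> by (simp add: X0'_def)
  qed
  moreover have "X \<beta> 0 = X0 \<beta>" if "\<beta> \<in> S" for \<beta>
    using init[of \<beta>] that assms(2) by (auto simp: X0'_def)
  ultimately show ?thesis
    using u sol assms(2) by (intro exI[of _ 1] conjI exI[of _ u] exI[of _ X]) auto
qed

text \<open>Stated with approximate reachability, so that both uniform ensemble controllability and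
  exact controllability over a fibre can feed it. The horizon may depend on the accuracy, since
  \<open>annihilator_solution\<close> holds for every \<open>T\<close>.\<close>

lemma full_of_approx:
  assumes "finite S" "S \<subseteq> K" and V: "\<And>\<beta>. \<beta> \<in> S \<Longrightarrow> V \<beta> \<in> carrier_vec n"
    and approx: "\<And>e. 0 < e \<Longrightarrow> \<exists>T>0. \<exists>u X. pw_const_control m T u \<and>
      (\<forall>\<beta>\<in>S. lin_solution n (A \<beta>) (B \<beta>) T u (X \<beta>) \<and> X \<beta> 0 = 0\<^sub>v n \<and>
        (\<forall>i<n. \<bar>(X \<beta> T - V \<beta>) $ i\<bar> \<le> e))"
  shows "\<exists>h\<in>real_span (krylov_gens \<mu> b m). \<forall>x\<in>\<Omega> S. h x = to_modal r (V (fst x)) (snd x)"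
proof (rule ccontr)
  let ?V = "\<lambda>x. to_modal r (V (fst x)) (snd x)"
  assume neg: "\<not> ?thesis"
  have fin: "finite (\<Omega> S)" using assms(1) by simp
  obtain w where w: "\<And>f. f \<in> real_span (krylov_gens \<mu> b m) \<Longrightarrow> Re (\<Sum>x\<in>\<Omega> S. w x * f x) = 0"
    and w_V: "Re (\<Sum>x\<in>\<Omega> S. w x * ?V x) \<noteq> 0"
    using finite_separation[OF fin neg] by blast
  define d where "d = \<bar>Re (\<Sum>x\<in>\<Omega> S. w x * ?V x)\<bar>"
  define W where "W = (\<Sum>x\<in>\<Omega> S. cmod (w x))"
  have "0 < d" using w_V by (simp add: d_def)
  have "0 \<le> W" by (simp add: W_def sum_nonneg)
  \<comment> \<open>The factor 2 compensates for passing from real coordinates to modal ones, as in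
    \<open>cmod_to_modal_le\<close>.\<close>
  define e where "e = d / (2 * (W + 1))"
  have e: "0 < e" using \<open>0 < d\<close> \<open>0 \<le> W\<close> by (simp add: e_def)
  from approx[OF e] obtain T u X where T: "0 < T" and u: "pw_const_control m T u"
    and X: "\<forall>\<beta>\<in>S. lin_solution n (A \<beta>) (B \<beta>) T u (X \<beta>) \<and> X \<beta> 0 = 0\<^sub>v n \<and>
        (\<forall>i<n. \<bar>(X \<beta> T - V \<beta>) $ i\<bar> \<le> e)"
    by (elim exE conjE) (rule that)
  let ?X = "\<lambda>x t. to_modal r (X (fst x) t) (snd x)"
  have X_carrier: "X \<beta> T \<in> carrier_vec n" if "\<beta> \<in> S" for \<beta>
    using X that T unfolding lin_solution_def by auto
  have zero: "Re (\<Sum>x\<in>\<Omega> S. w x * ?X x T) = 0"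
  proof (rule annihilator_solution[OF fin less_imp_le[OF T]])
    show "Re (\<Sum>x\<in>\<Omega> S. w x * (\<mu> x ^ k * b x j)) = 0" if "j < m" for j k
      by (rule w, rule real_span_base) (use that in \<open>auto simp: krylov_gens_def\<close>)
    fix x assume x: "x \<in> \<Omega> S"
    then have "fst x \<in> S" "fst x \<in> K" "snd x < r + l" using assms(2) by auto
    then show "scalar_solution m T (\<mu> x) (b x) (\<lambda>t i. u t $ i) (?X x)"
      using X lin_solution_iff[OF \<open>fst x \<in> K\<close> u, of "X (fst x)"] by (cases x) simp
    show "?X x 0 = 0"
      using X \<open>fst x \<in> S\<close> \<open>snd x < r + l\<close> by (auto simp: to_modal_def complex_eq_iff)
  qed
  have "(\<Sum>x\<in>\<Omega> S. w x * (?X x T - ?V x)) = (\<Sum>x\<in>\<Omega> S. w x * ?X x T) - (\<Sum>x\<in>\<Omega> S. w x * ?V x)"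
    by (simp only: right_diff_distrib sum_subtractf)
  then have "d = \<bar>Re (\<Sum>x\<in>\<Omega> S. w x * (?X x T - ?V x))\<bar>" unfolding d_def using zero by simp
  also have "\<dots> \<le> cmod (\<Sum>x\<in>\<Omega> S. w x * (?X x T - ?V x))" by (rule abs_Re_le_cmod)
  also have "\<dots> \<le> (\<Sum>x\<in>\<Omega> S. cmod (w x) * (2 * e))"
  proof (rule sum_norm_le)
    fix x assume "x \<in> \<Omega> S"
    then have x: "fst x \<in> S" "snd x < r + l" by auto
    have "?X x T - ?V x = to_modal r (X (fst x) T - V (fst x)) (snd x)"
      using to_modal_diff[OF X_carrier[OF x(1)] V[OF x(1)] x(2)] by simp
    moreover have "cmod (to_modal r (X (fst x) T - V (fst x)) (snd x)) \<le> 2 * e"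
      using X x by (intro cmod_to_modal_le) auto
    ultimately show "cmod (w x * (?X x T - ?V x)) \<le> cmod (w x) * (2 * e)"
      unfolding norm_mult by (intro mult_left_mono) auto
  qed
  also have "\<dots> = W * (2 * e)" by (simp add: W_def sum_distrib_right)
  also have "\<dots> < d" using \<open>0 < d\<close> \<open>0 \<le> W\<close> by (simp add: e_def field_simps)
  finally show False by simp
qed

section \<open>The Krylov span as a module on \<open>K\<close>\<close>

lemma krylov_gens_mu:
  assumes "g \<in> krylov_gens \<mu> b m"
  shows "\<exists>h\<in>real_span (krylov_gens \<mu> b m). \<forall>x\<in>\<Omega> K. h x = \<mu> x * g x"
proof -
  obtain j k where g: "g = (\<lambda>x. \<mu> x ^ k * b x j)" "j < m" using assms by (auto simp: krylov_gens_def)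
  have "(\<lambda>x. \<mu> x ^ Suc k * b x j) \<in> krylov_gens \<mu> b m"
    unfolding krylov_gens_def mem_Collect_eq using g(2) by (intro exI[of _ j] exI[of _ "Suc k"]) simp
  from real_span_base[OF this] show ?thesis by (rule bexI[rotated]) (simp add: g(1))
qed

text \<open>Here the closure of \<L> under \<open>A_star\<close> enters: the image of a generator is
  again a finite real combination of generators, and \<open>A_star\<close> acts on modal coordinates
  by the conjugate eigenvalue.\<close>

lemma krylov_gens_cnj:
  assumes closed: "\<And>f. f \<in> krylov_span K n m A B \<Longrightarrow>
      (\<lambda>\<beta>. A_star r l lam alpha omega \<beta> *\<^sub>v f \<beta>) \<in> krylov_span K n m A B"
    and "g \<in> krylov_gens \<mu> b m"
  shows "\<exists>h\<in>real_span (krylov_gens \<mu> b m). \<forall>x\<in>\<Omega> K. h x = cnj (\<mu> x) * g x"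
proof -
  obtain i k where g: "g = (\<lambda>x. \<mu> x ^ k * b x i)" "i < m" using assms(2) by (auto simp: krylov_gens_def)
  define f where "f \<beta> = A \<beta> ^\<^sub>m k *\<^sub>v col (B \<beta>) i" for \<beta>
  have col: "col (B \<beta>) i' \<in> carrier_vec n" if "\<beta> \<in> K" for \<beta> i'
    using B_carrier[OF that] by (simp add: carrier_vecI)
  have f_carrier: "f \<beta> \<in> carrier_vec n" if "\<beta> \<in> K" for \<beta>
    unfolding f_def by (rule mult_mat_vec_carrier[OF pow_carrier_mat[OF A_mat_carrier] col[OF that]])
  have "f \<in> krylov_span K n m A B"
    unfolding krylov_span_def mem_Collect_eq
  proof (intro exI[of _ "{(i, k)}"] exI[of _ "\<lambda>_ _. 1"] conjI ballI)
    show "f \<beta> = vec n (\<lambda>i'. \<Sum>(j, k)\<in>{(i, k)}. 1 * (A \<beta> ^\<^sub>m k *\<^sub>v col (B \<beta>) j) $ i')" if "\<beta> \<in> K" for \<beta>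
      using carrier_vecD[OF f_carrier[OF that]] by (intro eq_vecI) (simp_all add: f_def)
  qed (use g(2) in auto)
  from closed[OF this] obtain S c where S: "finite S" "S \<subseteq> {..<m} \<times> UNIV"
    and eq: "\<forall>\<beta>\<in>K. A_star r l lam alpha omega \<beta> *\<^sub>v f \<beta>
      = vec n (\<lambda>i. \<Sum>(j, k)\<in>S. c j k * (A \<beta> ^\<^sub>m k *\<^sub>v col (B \<beta>) j) $ i)"
    unfolding krylov_span_def mem_Collect_eq by (elim exE conjE) (rule that)
  define h where "h x = (\<Sum>s\<in>S. complex_of_real (c (fst s) (snd s)) * (\<mu> x ^ snd s * b x (fst s)))" for x
  have "(\<lambda>x. \<Sum>s\<in>S. complex_of_real (c (fst s) (snd s)) * (\<mu> x ^ snd s * b x (fst s))) \<in> real_span (krylov_gens \<mu> b m)"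
  proof (rule real_span_sum[OF S(1)])
    fix s assume "s \<in> S"
    then have "fst s < m" using S(2) by auto
    then show "(\<lambda>x. \<mu> x ^ snd s * b x (fst s)) \<in> real_span (krylov_gens \<mu> b m)"
      by (intro real_span_base) (auto simp: krylov_gens_def)
  qed
  then have "h \<in> real_span (krylov_gens \<mu> b m)" unfolding h_def[abs_def] .
  moreover have "h x = cnj (\<mu> x) * g x" if "x \<in> \<Omega> K" for x
  proof -
    obtain \<beta> j where x: "x = (\<beta>, j)" "\<beta> \<in> K" "j < r + l" using \<open>x \<in> \<Omega> K\<close> by auto
    have "cnj (\<mu> x) * g x = to_modal r (A_star r l lam alpha omega \<beta> *\<^sub>v f \<beta>) j"
      using to_modal_A_star[OF f_carrier[OF x(2)] x(3)] to_modal_A_mat_pow[OF col[OF x(2)] x(3)]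
      by (simp add: f_def g x b_def)
    also have "A_star r l lam alpha omega \<beta> *\<^sub>v f \<beta>
        = vec n (\<lambda>i. \<Sum>s\<in>S. c (fst s) (snd s) * (A \<beta> ^\<^sub>m snd s *\<^sub>v col (B \<beta>) (fst s)) $ i)"
      using eq x(2) by (simp add: case_prod_unfold)
    also have "to_modal r \<dots> j = h x"
      unfolding to_modal_sum[OF x(3), where v = "\<lambda>s. A \<beta> ^\<^sub>m snd s *\<^sub>v col (B \<beta>) (fst s)"]
        to_modal_A_mat_pow[OF col[OF x(2)] x(3)] by (simp add: h_def x b_def)
    finally show ?thesis by simp
  qed
  ultimately show ?thesis by (intro bexI) auto
qed

text \<open>Tietze extension entry by entry: ensemble controllability speaks about continuous
  targets on \<open>K\<close>, while interpolation prescribes values at finitely many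
  points.\<close>

lemma cont_vec_fun_extension:
  assumes "finite S" "S \<subseteq> K"
  shows "\<exists>W. cont_vec_fun K n W \<and> (\<forall>\<beta>\<in>S. \<forall>i<n. W \<beta> $ i = V \<beta> $ i)"
proof -
  have "\<exists>g. continuous_on K g \<and> (\<forall>\<beta>\<in>S. g \<beta> = V \<beta> $ i)" for i
  proof -
    have "continuous_on S (\<lambda>\<beta>. V \<beta> $ i)" by (rule continuous_on_finite[OF assms(1)])
    moreover have "closedin (top_of_set K) S"
      using assms finite_imp_closed by (intro closed_subset) auto
    ultimately obtain g where "continuous_on K g" "\<And>\<beta>. \<beta> \<in> S \<Longrightarrow> g \<beta> = V \<beta> $ i"
      by (rule Tietze_unbounded) blast
    then show ?thesis by blast
  qed
  then obtain g where g: "\<And>i. continuous_on K (g i)" "\<And>i \<beta>. \<beta> \<in> S \<Longrightarrow> g i \<beta> = V \<beta> $ i" by metis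
  have "cont_vec_fun K n (\<lambda>\<beta>. vec n (\<lambda>i. g i \<beta>))"
    unfolding cont_vec_fun_def using g(1) by simp
  then show ?thesis using g(2) by (intro exI conjI) auto
qed

section \<open>Fibres of the eigenvalue functions\<close>

lemma gamma_inv_subset: "gamma_inv K r l lam alpha omega \<eta> \<subseteq> K"
  unfolding gamma_inv_def by auto

lemma mu_in_eig_set:
  assumes "x \<in> \<Omega> K"
  shows "\<mu> x \<in> eig_set K r l lam alpha omega"
proof -
  obtain \<beta> j where x: "x = (\<beta>, j)" "\<beta> \<in> K" "j < r + l" using assms by auto
  show ?thesis
  proof (cases "j < r")
    case True
    then show ?thesis using x by (auto simp: modal_eig_def eig_set_def)
  next
    case False
    then have "j - r < l" using x by simp
    then show ?thesis using False x by (auto simp: modal_eig_def eig_set_def)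
  qed
qed

text \<open>\<open>modal_eig\<close> lists only \<alpha> + \<i> \<omega>. If this value is the
  conjugate of \<eta>, then \<alpha> - \<i> \<omega> equals \<eta>, so the point belongs to a minus
  branch of \<open>gamma_inv\<close>; real modes equal their conjugates.\<close>

lemma mem_gamma_inv:
  assumes "x \<in> \<Omega> K" "\<mu> x = \<eta> \<or> \<mu> x = cnj \<eta>"
  shows "fst x \<in> gamma_inv K r l lam alpha omega \<eta>"
proof -
  obtain \<beta> j where x: "x = (\<beta>, j)" "\<beta> \<in> K" "j < r + l" using assms by auto
  have "\<eta> = \<mu> x \<or> \<eta> = cnj (\<mu> x)" using assms(2) by auto
  then show ?thesis
  proof (cases "j < r")
    case True
    then have "complex_of_real (lam j \<beta>) = \<eta>" using \<open>\<eta> = \<mu> x \<or> \<eta> = cnj (\<mu> x)\<close> x by (auto simp: modal_eig_def)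
    then show ?thesis using True x by (auto simp: gamma_inv_def)
  next
    case False
    then have "j - r < l" using x by simp
    moreover have "eig_plus alpha omega (j - r) \<beta> = \<eta> \<or> eig_minus alpha omega (j - r) \<beta> = \<eta>"
      using False \<open>\<eta> = \<mu> x \<or> \<eta> = cnj (\<mu> x)\<close> x
      by (auto simp: modal_eig_def eig_plus_def eig_minus_def complex_eq_iff)
    ultimately show ?thesis using x by (auto simp: gamma_inv_def)
  qed
qed

end

lemma finite_fiber: "finite_to_one_on K f \<Longrightarrow> finite {\<beta>\<in>K. f \<beta> = \<eta>}"
proof (cases "\<eta> \<in> f ` K")
  case False
  then have "{\<beta>\<in>K. f \<beta> = \<eta>} = {}" by auto
  then show ?thesis by (metis finite.emptyI)
qed (unfold finite_to_one_on_def, blast)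

lemma finite_gamma_inv:
  assumes "\<And>j. j < r \<Longrightarrow> finite_to_one_on K (lam j)"
    and "\<And>j. j < l \<Longrightarrow> finite_to_one_on K (eig_plus alpha omega j)"
    and "\<And>j. j < l \<Longrightarrow> finite_to_one_on K (eig_minus alpha omega j)"
  shows "finite (gamma_inv K r l lam alpha omega \<eta>)"
proof -
  \<comment> \<open>The set lies in the fibre of \<open>lam j\<close> over \<open>Re \<eta>\<close>,
    for non-real \<eta> too.\<close>
  have "finite {\<beta>\<in>K. complex_of_real (lam j \<beta>) = \<eta>}" if "j < r" for j
    by (rule finite_subset[OF _ finite_fiber[OF assms(1)[OF that], of "Re \<eta>"]]) auto
  then show ?thesis
    unfolding gamma_inv_def by (auto intro: finite_fiber assms)
qed

theorem theorem3p8: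
  fixes K :: "real set"
    and r l m n :: nat
    and lam alpha omega :: "nat \<Rightarrow> real \<Rightarrow> real"
    and B :: "real \<Rightarrow> real Matrix.mat"
    and N :: "real Matrix.vec \<Rightarrow> real"
  assumes "compact K"
    and "m \<ge> 1"
    and "n = r + 2 * l"
    and "n \<ge> 1"
    and "norm_on n N"
    and "\<And>j. j < r \<Longrightarrow> continuous_on K (lam j)"
    and "\<And>j. j < l \<Longrightarrow> continuous_on K (alpha j)"
    and "\<And>j. j < l \<Longrightarrow> continuous_on K (omega j)"
    and "\<And>j. j < r \<Longrightarrow> finite_to_one_on K (lam j)"
    and "\<And>j. j < l \<Longrightarrow> finite_to_one_on K (eig_plus alpha omega j)"
    and "\<And>j. j < l \<Longrightarrow> finite_to_one_on K (eig_minus alpha omega j)"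
    and "cont_mat_fun K n m B"
    and "\<And>f. f \<in> krylov_span K n m (A_mat r l lam alpha omega) B \<Longrightarrow>
           (\<lambda>\<beta>. Matrix.mult_mat_vec (A_star r l lam alpha omega \<beta>) (f \<beta>))
             \<in> krylov_span K n m (A_mat r l lam alpha omega) B"
  shows "unif_ensemble_controllable N K n m (A_mat r l lam alpha omega) B \<longleftrightarrow>
    (\<forall>\<eta>\<in>eig_set K r l lam alpha omega.
       controllable (n * card (gamma_inv K r l lam alpha omega \<eta>)) m
         (diag_mat_at (A_mat r l lam alpha omega) (gamma_inv K r l lam alpha omega \<eta>))
         (stack_mat m B (gamma_inv K r l lam alpha omega \<eta>)))"
proof -
  note n = assms(3)
  interpret modal_ensemble K r l m lam alpha omega B
    using assms by unfold_locales auto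
  let ?S = "gamma_inv K r l lam alpha omega"
  have fin: "finite (?S \<eta>)" for \<eta> using assms(9-11) by (rule finite_gamma_inv)
  have sub: "?S \<eta> \<subseteq> K" for \<eta> by (rule gamma_inv_subset)
  have A_carrier: "A \<beta> \<in> carrier_mat n n" for \<beta> unfolding n by (rule A_mat_carrier)
  have B_carrier': "B \<beta> \<in> carrier_mat n m" if "\<beta> \<in> ?S \<eta>" for \<beta> \<eta>
    unfolding n using B_carrier sub that by blast
  have stack: "controllable (n * card (?S \<eta>)) m (diag_mat_at A (?S \<eta>)) (stack_mat m B (?S \<eta>)) \<longleftrightarrow>
      (\<forall>X0 XF. (\<forall>\<beta>\<in>?S \<eta>. X0 \<beta> \<in> carrier_vec n \<and> XF \<beta> \<in> carrier_vec n) \<longrightarrow>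
        (\<exists>T>0. \<exists>u X. pw_const_control m T u \<and>
          (\<forall>\<beta>\<in>?S \<eta>. lin_solution n (A \<beta>) (B \<beta>) T u (X \<beta>) \<and> X \<beta> 0 = X0 \<beta> \<and> X \<beta> T = XF \<beta>)))" for \<eta>
    by (rule controllable_stack_iff[OF fin A_carrier B_carrier'])
  show ?thesis
  proof
    assume unif: "unif_ensemble_controllable N K n m A B"
    obtain C where C: "0 < C" "\<And>v i. v \<in> carrier_vec n \<Longrightarrow> i < n \<Longrightarrow> \<bar>v $ i\<bar> \<le> C * N v"
      using norm_on_lower[OF assms(5)] by blast
    have full: "\<exists>h\<in>real_span (krylov_gens \<mu> b m). \<forall>x\<in>\<Omega> (?S \<eta>). h x = to_modal r (V (fst x)) (snd x)"
      if V: "\<forall>\<beta>\<in>?S \<eta>. V \<beta> \<in> carrier_vec n" for V \<eta>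
    proof (rule full_of_approx[OF fin sub])
      show "V \<beta> \<in> carrier_vec (r + 2 * l)" if "\<beta> \<in> ?S \<eta>" for \<beta> using V that n by simp
      obtain W where W: "cont_vec_fun K n W" "\<forall>\<beta>\<in>?S \<eta>. \<forall>i<n. W \<beta> $ i = V \<beta> $ i"
        using cont_vec_fun_extension[OF fin sub, of \<eta> V] unfolding n by blast
      fix e :: real assume e: "0 < e"
      \<comment> \<open>Starting at zero leaves only the forced response, on which functionals
        annihilating \<L> vanish.\<close>
      have zero: "cont_vec_fun K n (\<lambda>_. 0\<^sub>v n)" by (simp add: cont_vec_fun_def)
      \<comment> \<open>A coordinate is at most \<open>C\<close> times the norm, so accuracy
        \<open>e / C\<close> in norm gives \<open>e\<close> in each coordinate.\<close>
      have "0 < e / C" using e C by simp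
      with unif[unfolded unif_ensemble_controllable_def] zero W(1)
      have "\<exists>T>0. \<exists>u X. pw_const_control m T u \<and> (\<forall>t\<in>{0..T}. cont_vec_fun K n (X t)) \<and>
           (\<forall>\<beta>\<in>K. lin_solution n (A \<beta>) (B \<beta>) T u (\<lambda>t. X t \<beta>)) \<and> (\<forall>\<beta>\<in>K. X 0 \<beta> = 0\<^sub>v n) \<and>
           (SUP \<beta>\<in>K. ereal (N (X T \<beta> - W \<beta>))) < ereal (e / C)" by simp
      then obtain T u X where T: "0 < T" and u: "pw_const_control m T u"
        and X: "\<forall>t\<in>{0..T}. cont_vec_fun K n (X t)"
        and sol: "\<forall>\<beta>\<in>K. lin_solution n (A \<beta>) (B \<beta>) T u (\<lambda>t. X t \<beta>)" and init: "\<forall>\<beta>\<in>K. X 0 \<beta> = 0\<^sub>v n"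
        and SUP: "(SUP \<beta>\<in>K. ereal (N (X T \<beta> - W \<beta>))) < ereal (e / C)"
        by (elim exE conjE) (rule that)
      have "\<bar>(X T \<beta> - V \<beta>) $ i\<bar> \<le> e" if \<beta>: "\<beta> \<in> ?S \<eta>" and i: "i < n" for \<beta> i
      proof -
        have "\<beta> \<in> K" using \<beta> sub by blast
        have carrier: "X T \<beta> \<in> carrier_vec n" "W \<beta> \<in> carrier_vec n" "V \<beta> \<in> carrier_vec n"
          using X T W(1) V \<beta> \<open>\<beta> \<in> K\<close> by (auto simp: cont_vec_fun_def)
        have "ereal (N (X T \<beta> - W \<beta>)) < ereal (e / C)"
          using SUP_upper[OF \<open>\<beta> \<in> K\<close>, of "\<lambda>\<beta>. ereal (N (X T \<beta> - W \<beta>))"] SUP by (rule le_less_trans)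
        then have "C * N (X T \<beta> - W \<beta>) \<le> e" using C(1) by (simp add: field_simps)
        then have "\<bar>(X T \<beta> - W \<beta>) $ i\<bar> \<le> e" using C(2)[of "X T \<beta> - W \<beta>" i] carrier i by simp
        moreover have "(X T \<beta> - W \<beta>) $ i = (X T \<beta> - V \<beta>) $ i" using carrier i W(2) \<beta> by simp
        ultimately show ?thesis by simp
      qed
      then show "\<exists>T>0. \<exists>u X. pw_const_control m T u \<and>
        (\<forall>\<beta>\<in>?S \<eta>. lin_solution (r + 2 * l) (A \<beta>) (B \<beta>) T u (X \<beta>) \<and> X \<beta> 0 = 0\<^sub>v (r + 2 * l) \<and>
        (\<forall>i<r + 2 * l. \<bar>(X \<beta> T - V \<beta>) $ i\<bar> \<le> e))"
        using T u sol init sub[of \<eta>]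
        by (intro exI[of _ T] conjI exI[of _ u] exI[of _ "\<lambda>\<beta> t. X t \<beta>"]) (auto simp: n)
    qed
    show "\<forall>\<eta>\<in>eig_set K r l lam alpha omega. controllable (n * card (?S \<eta>)) m (diag_mat_at A (?S \<eta>)) (stack_mat m B (?S \<eta>))"
      unfolding stack
    proof (intro ballI allI impI)
      fix \<eta> and X0 XF :: "real \<Rightarrow> real vec"
      assume "\<forall>\<beta>\<in>?S \<eta>. X0 \<beta> \<in> carrier_vec n \<and> XF \<beta> \<in> carrier_vec n"
      then show "\<exists>T>0. \<exists>u X. pw_const_control m T u \<and>
        (\<forall>\<beta>\<in>?S \<eta>. lin_solution n (A \<beta>) (B \<beta>) T u (X \<beta>) \<and> X \<beta> 0 = X0 \<beta> \<and> X \<beta> T = XF \<beta>)"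
        unfolding n by (intro exact_of_full[OF fin sub full[unfolded n]]) simp_all
    qed
  next
    assume ctrl: "\<forall>\<eta>\<in>eig_set K r l lam alpha omega. controllable (n * card (?S \<eta>)) m (diag_mat_at A (?S \<eta>)) (stack_mat m B (?S \<eta>))"
    show "unif_ensemble_controllable N K n m A B"
      unfolding n
    proof (rule unif_of_dense)
      show "norm_on (r + 2 * l) N" using assms(5) n by simp
      fix V :: "real \<Rightarrow> real vec" and e :: real
      assume V: "cont_vec_fun K (r + 2 * l) V" and e: "0 < e"
      have V_carrier: "V \<beta> \<in> carrier_vec n" if "\<beta> \<in> K" for \<beta> using V that n by (simp add: cont_vec_fun_def)
      show "\<exists>h\<in>real_span (krylov_gens \<mu> b m). \<forall>x\<in>\<Omega> K. cmod (h x - to_modal r (V (fst x)) (snd x)) < e"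
      proof (rule dense_of_fiberwise[where \<mu> = \<mu>])
        show "continuous_on (\<Omega> K) \<mu>" by (rule continuous_on_mu)
        show "0 < e" by (rule e)
        show "\<exists>h\<in>real_span (krylov_gens \<mu> b m). \<forall>x\<in>\<Omega> K. h x = \<mu> x * g x"
          if "g \<in> krylov_gens \<mu> b m" for g
          using krylov_gens_mu[OF that] .
        show "compact (\<Omega> K)" using compact_K by (intro compact_Times) (auto intro: finite_imp_compact)
        show "continuous_on (\<Omega> K) g" if "g \<in> krylov_gens \<mu> b m" for g
          using that continuous_on_mu continuous_on_b
          by (auto simp: krylov_gens_def intro!: continuous_on_mult continuous_on_power)
        show "continuous_on (\<Omega> K) (\<lambda>x. to_modal r (V (fst x)) (snd x))"
          using V by (intro continuous_on_to_modal) (simp add: cont_vec_fun_def)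
        show "\<exists>h\<in>real_span (krylov_gens \<mu> b m). \<forall>x\<in>\<Omega> K. h x = cnj (\<mu> x) * g x"
          if "g \<in> krylov_gens \<mu> b m" for g
          using krylov_gens_cnj[OF assms(13)[unfolded n] that] .
        fix y assume y: "y \<in> \<Omega> K"
        let ?F = "?S (\<mu> y)"
        have exact: "\<exists>T>0. \<exists>u X. pw_const_control m T u \<and>
            (\<forall>\<beta>\<in>?F. lin_solution n (A \<beta>) (B \<beta>) T u (X \<beta>) \<and> X \<beta> 0 = 0\<^sub>v n \<and> X \<beta> T = V \<beta>)"
        proof -
          have "\<forall>\<beta>\<in>?F. 0\<^sub>v n \<in> carrier_vec n \<and> V \<beta> \<in> carrier_vec n" using V_carrier sub by auto
          from ctrl[unfolded stack, THEN bspec, OF mu_in_eig_set[OF y], THEN spec, THEN spec, THEN mp, OF this]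
          show ?thesis .
        qed
        have "\<exists>h\<in>real_span (krylov_gens \<mu> b m). \<forall>x\<in>\<Omega> ?F. h x = to_modal r (V (fst x)) (snd x)"
        \<comment> \<open>The exact steering over \<open>?F\<close> serves every accuracy with one
          and the same trajectory.\<close>
        proof (rule full_of_approx[OF fin sub])
          show V_carrier': "V \<beta> \<in> carrier_vec (r + 2 * l)" if "\<beta> \<in> ?F" for \<beta>
            using V_carrier sub that n by blast
          fix e :: real assume "0 < e"
          from exact obtain T u X where T: "0 < T" and u: "pw_const_control m T u"
            and X: "\<forall>\<beta>\<in>?F. lin_solution n (A \<beta>) (B \<beta>) T u (X \<beta>) \<and> X \<beta> 0 = 0\<^sub>v n \<and> X \<beta> T = V \<beta>"
            by (elim exE conjE) (rule that)
          show "\<exists>T>0. \<exists>u X. pw_const_control m T u \<and>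
            (\<forall>\<beta>\<in>?F. lin_solution (r + 2 * l) (A \<beta>) (B \<beta>) T u (X \<beta>) \<and> X \<beta> 0 = 0\<^sub>v (r + 2 * l) \<and>
            (\<forall>i<r + 2 * l. \<bar>(X \<beta> T - V \<beta>) $ i\<bar> \<le> e))"
          proof (intro exI[of _ T] conjI exI[of _ u] exI[of _ X] ballI allI impI T u)
            fix \<beta> i assume "\<beta> \<in> ?F"
            then show "lin_solution (r + 2 * l) (A \<beta>) (B \<beta>) T u (X \<beta>)" "X \<beta> 0 = 0\<^sub>v (r + 2 * l)"
              using X by (simp_all add: n)
            assume "i < r + 2 * l"
            then show "\<bar>(X \<beta> T - V \<beta>) $ i\<bar> \<le> e"
              using X V_carrier'[OF \<open>\<beta> \<in> ?F\<close>] \<open>\<beta> \<in> ?F\<close> \<open>0 < e\<close> by simp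
          qed
        qed
        then obtain h where h: "h \<in> real_span (krylov_gens \<mu> b m)"
          "\<forall>x\<in>\<Omega> ?F. h x = to_modal r (V (fst x)) (snd x)" ..
        have "h x = to_modal r (V (fst x)) (snd x)" if "x \<in> \<Omega> K" "\<mu> x = \<mu> y \<or> \<mu> x = cnj (\<mu> y)" for x
        proof -
          \<comment> \<open>Interpolation holds in all modal coordinates over the points of
            \<open>?F\<close>, in particular at every pair in the fibre of \<mu> y and its
            conjugate.\<close>
          have "x \<in> \<Omega> ?F" using mem_gamma_inv[OF that] that(1) by (simp add: mem_Times_iff)
          then show ?thesis using h(2) by blast
        qed
        then show "\<exists>h\<in>real_span (krylov_gens \<mu> b m). \<forall>x\<in>\<Omega> K. \<mu> x = \<mu> y \<or> \<mu> x = cnj (\<mu> y) \<longrightarrow>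
            h x = to_modal r (V (fst x)) (snd x)"
          using h(1) by (intro bexI[of _ h]) auto
      qed
    qed
  qed
qed

end
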